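(* Let $G\leq\mathrm{Sym}\,\Omega$ be a finite innately transitive group with a non-abelian plinth $M=T_1\times\cdots\times T_k$, where each $T_i$ is isomorphic to a finite (non-abelian) simple group $T$. Put $\mathcal T=\{T_1,\ldots,T_k\}$ and fix $\omega\in\Omega$. Let $\mathcal E\in\mathrm{CD}_{2\not\sim}(G)$, and let $\mathcal K_\omega(\mathcal E)=\{K_1,\dots,K_\ell\}$, $A_i$, $B_i$, $\overline K_j$, $\overline{\mathcal K}_\omega(\mathcal E)$, $\overline M_\omega$, $\overline\Omega$, $\overline\omega$, $\overline G$, $\Gamma(G,\mathcal E)$ be as defined in the context. Then all of the following hold. **[a] (Quotient action)** $M$ is faithful on $\overline\Omega$ (so subgroups of $M$ are identified with their images in the action on $\overline\Omega$). The set $\overline{\mathcal K}_\omega(\mathcal E)$ is a $\overline G_{\overline\omega}$-invariant Cartesian system of subgroups for $M$ with respect to $\overline\omega$. Moreover $\mathcal E(\overline{\mathcal K}_\omega(\mathcal E))\in\mathrm{CD}_{2\not\sim}(\overline G)$. **[b] (Factorisation)** For each $i\in\{1,\ldots,k\}$: (i) $A_i,B_i$ are proper subgroups of $T_i$; (ii) $A_i$ and $B_i$ are not conjugate under $G_\omega$; (iii) $A_iB_i=T_i$ and $A_i\cap B_i=\sigma_i(\overline M_\omega)$; (iv) $N_{G_\omega}(T_i)=N_{G_\omega}(A_i)=N_{G_\omega}(B_i)$. **[c] (Combinatorial)** $G_\omega$, acting by conjugation, induces a group of automorphisms of the generalised di-graph $\Gamma(G,\mathcal E)$ which is transitive on both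 the vertex set $\mathcal K_\omega(\mathcal E)$ and the arc set $\mathcal T$.
   Context: All groups act on the right. A permutation group $G\le \mathrm{Sym}\,\Omega$ is *innately transitive* if it has a transitive minimal normal subgroup, called a *plinth*. A *Cartesian decomposition* of $\Omega$ is a set $\{\Gamma_1,\dots,\Gamma_\ell\}$ of proper partitions of $\Omega$ with $|\gamma_1\cap\dots\cap\gamma_\ell|=1$ for all $\gamma_1\in\Gamma_1,\dots,\gamma_\ell\in\Gamma_\ell$. It is *$G$-invariant* if $G$ permutes the $\Gamma_i$. $\mathrm{CD}_{\mathrm{tr}}(G)$ is the set of $G$-invariant Cartesian decompositions on which $G$ acts transitively. For a transitive group $M$ on $\Omega$ and $\omega\in\Omega$, a set $\{K_1,\dots,K_\ell\}$ of proper subgroups of $M$ is a *Cartesian system of subgroups for $M$ with respect to $\omega$* if $\bigcap_i K_i=M_\omega$ and $K_i(\bigcap_{j\ne i}K_j)=M$ for all $i$. Let $G$ be innately transitive with plinth $M$. If $\mathcal E=\{\Gamma_1,\dots,\Gamma_\ell\}$ is a $G$-invariant Cartesian decomposition, it is known that each $\Gamma_i$ is $M$-invariant; let $\gamma_i\in\Gamma_i$ be the block containing $\omega$ and $\mathcal K_\omega(\mathcal E)=\{K_1,\dots,K_\ell\}$ with $K_i=M_{\gamma_i}$ (setwise stabiliser). It is known that $\mathcal E\mapsto\mathcal K_\omega(\mathcal E)$ is a bijection from $G$-invariant Cartesian decompositions to $G_\omega$-invariant (under conjugation) Cartesian systems for $M$ with respect to $\omega$; the inverse is $\mathcal K\mapsto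 \mathcal E(\mathcal K)=\{\{(\omega^K)^m: m\in M\}: K\in\mathcal K\}$. Let $M=T_1\times\dots\times T_k$ with $T_i$ non-abelian simple; $\sigma_i:M\to T_i$ is the projection. Put $\mathcal F_i(\mathcal E,M,\omega)=\{\sigma_i(K_j): 1\le j\le\ell,\ \sigma_i(K_j)\neq T_i\}$. (Distinct $j$ with $\sigma_i(K_j)\ne T_i$ give distinct subgroups, and $|\mathcal F_i|$ is independent of $i$ for $\mathcal E\in \mathrm{CD}_{\mathrm{tr}}(G)$.) $\mathrm{CD}_{2\not\sim}(G)$ is the set of $\mathcal E\in\mathrm{CD}_{\mathrm{tr}}(G)$ such that $|\mathcal F_i|=2$ and the two subgroups in $\mathcal F_i$ are not $G_\omega$-conjugate; this is independent of $\omega$. A *generalised di-graph* is a 4-tuple $(V,E,\beta,\varepsilon)$ with $V$, $E$ disjoint sets (vertices, arcs), $V\neq\emptyset$, and maps $\beta,\varepsilon:E\to V$ (initial and terminal vertex) with $\beta(e)\ne\varepsilon(e)$ for all $e\in E$. An automorphism is $\alpha\in\mathrm{Sym}\,V\times\mathrm{Sym}\,E$ with $\alpha(\beta(e))=\beta(\alpha(e))$ and $\alpha(\varepsilon(e))=\varepsilon(\alpha(e))$ for all $e\in E$. Let $\mathcal E\in\mathrm{CD}_{2\not\sim}(G)$ and write $\mathcal F_1(\mathcal E,M,\omega)=\{A_1,B_1\}$. For each $i$ there are unique indices $j_1,j_2$ such that $\sigma_i(K_{j_1})$ is $G_\omega$-conjugate to $A_1$ and $\sigma_i(K_{j_2})$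 is $G_\omega$-conjugate to $B_1$; put $A_i=\sigma_i(K_{j_1})$, $B_i=\sigma_i(K_{j_2})$, $\beta(T_i)=K_{j_1}$, $\varepsilon(T_i)=K_{j_2}$. This defines the generalised di-graph $\Gamma(G,\mathcal E)=(\mathcal K_\omega(\mathcal E),\mathcal T,\beta,\varepsilon)$. Put $\overline K_j=\sigma_1(K_j)\times\dots\times\sigma_k(K_j)$, $\overline{\mathcal K}_\omega(\mathcal E)=\{\overline K_1,\dots,\overline K_\ell\}$, $\overline M_\omega=\overline K_1\cap\dots\cap\overline K_\ell$, and $\overline\Omega=\{(\omega^{\overline M_\omega})^m: m\in M\}$, which is a $G$-invariant partition of $\Omega$; $\overline\omega$ is the block of $\overline\Omega$ containing $\omega$, so $M_{\overline\omega}=\overline M_\omega$ and $G_{\overline\omega}=\overline M_\omega G_\omega$. $\overline G$ is the permutation group induced by $G$ on $\overline\Omega$ and $\overline G_{\overline\omega}$ is the image of $G_{\overline\omega}$ in $\overline G$. *)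

theory Defs
  imports
    "HOL-Algebra.Group_Action"
    "HOL-Algebra.Generated_Groups"
    "HOL-Algebra.SimpleGroups"
    "HOL-Library.Disjoint_Sets"
    "Graph_Theory.Digraph"
begin

(* Permutations of Omega are the elements of BijGroup Omega, which composes from the right to
   the left, so groups act on the left here.  Passing from a right action to a left one
   replaces a product by the product in the opposite order and g^-1 X g by g X g^-1, which
   changes none of the notions below. *)

abbreviation perm_grp :: "'a set \<Rightarrow> ('a \<Rightarrow> 'a) set \<Rightarrow> ('a \<Rightarrow> 'a) monoid"
  where "perm_grp \<Omega> H \<equiv> (BijGroup \<Omega>)\<lparr>carrier := H\<rparr>"

abbreviation point_stab :: "'a set \<Rightarrow> ('a \<Rightarrow> 'a) set \<Rightarrow> 'a \<Rightarrow> ('a \<Rightarrow> 'a) set"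
  where "point_stab \<Omega> H x \<equiv> stabilizer (perm_grp \<Omega> H) (\<lambda>g. g) x"

abbreviation set_stab :: "'a set \<Rightarrow> ('a \<Rightarrow> 'a) set \<Rightarrow> 'a set \<Rightarrow> ('a \<Rightarrow> 'a) set"
  where "set_stab \<Omega> H B \<equiv> stabilizer (perm_grp \<Omega> H) (\<lambda>g X. g ` X) B"

abbreviation point_orbit :: "'a set \<Rightarrow> ('a \<Rightarrow> 'a) set \<Rightarrow> 'a \<Rightarrow> 'a set"
  where "point_orbit \<Omega> H x \<equiv> orbit (perm_grp \<Omega> H) (\<lambda>g. g) x"

definition conj_set :: "('g, 'm) monoid_scheme \<Rightarrow> 'g \<Rightarrow> 'g set \<Rightarrow> 'g set"
  where "conj_set S g X = g <#\<^bsub>S\<^esub> X #>\<^bsub>S\<^esub> (inv\<^bsub>S\<^esub> g)"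

definition conjugate_under :: "('g, 'm) monoid_scheme \<Rightarrow> 'g set \<Rightarrow> 'g set \<Rightarrow> 'g set \<Rightarrow> bool"
  where "conjugate_under S H X Y \<longleftrightarrow> (\<exists>g\<in>H. Y = conj_set S g X)"

(* X need not be contained in H, so the normalizer is first taken in the ambient group S. *)
definition normalizer_in :: "('g, 'm) monoid_scheme \<Rightarrow> 'g set \<Rightarrow> 'g set \<Rightarrow> 'g set"
  where "normalizer_in S H X = H \<inter> normalizer S X"

definition minimal_normal :: "'g set \<Rightarrow> ('g, 'm) monoid_scheme \<Rightarrow> bool"
  where "minimal_normal N G \<longleftrightarrow> N \<lhd> G \<and> N \<noteq> {\<one>\<^bsub>G\<^esub>} \<and>
    (\<forall>N'. N' \<lhd> G \<and> N' \<subseteq> N \<longrightarrow> N' = {\<one>\<^bsub>G\<^esub>} \<or> N' = N)"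

definition plinth :: "'a set \<Rightarrow> ('a \<Rightarrow> 'a) set \<Rightarrow> ('a \<Rightarrow> 'a) set \<Rightarrow> bool"
  where "plinth \<Omega> G M \<longleftrightarrow>
    minimal_normal M (perm_grp \<Omega> G) \<and> transitive_action (perm_grp \<Omega> M) \<Omega> (\<lambda>g. g)"

(* The internal direct decomposition M = T_1 x ... x T_k is given by the set Ts of its factors;
   the factors themselves serve as the indices. *)
definition internal_direct_product :: "('g, 'm) monoid_scheme \<Rightarrow> 'g set \<Rightarrow> 'g set set \<Rightarrow> bool"
  where "internal_direct_product S M Ts \<longleftrightarrow>
    (\<forall>T\<in>Ts. T \<lhd> S\<lparr>carrier := M\<rparr>) \<and> generate S (\<Union>Ts) = M \<and>
    (\<forall>T\<in>Ts. T \<inter> generate S (\<Union>(Ts - {T})) = {\<one>\<^bsub>S\<^esub>})"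

definition factor_proj :: "('g, 'm) monoid_scheme \<Rightarrow> 'g set set \<Rightarrow> 'g set \<Rightarrow> 'g \<Rightarrow> 'g"
  where "factor_proj S Ts T m =
    (THE t. t \<in> T \<and> (\<exists>c\<in>generate S (\<Union>(Ts - {T})). m = t \<otimes>\<^bsub>S\<^esub> c))"

(* A partition is proper if it has more than one block. The discrete partition is allowed: it
   corresponds to K = M_omega in the bijection with Cartesian systems of proper subgroups.
   The function \<gamma> selects one block from each partition. *)
definition cartesian_decomposition :: "'a set \<Rightarrow> 'a set set set \<Rightarrow> bool"
  where "cartesian_decomposition \<Omega> \<E> \<longleftrightarrow> \<E> \<noteq> {} \<and>
    (\<forall>\<Gamma>\<in>\<E>. partition_on \<Omega> \<Gamma> \<and> \<Gamma> \<noteq> {\<Omega>}) \<and>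
    (\<forall>\<gamma>. (\<forall>\<Gamma>\<in>\<E>. \<gamma> \<Gamma> \<in> \<Gamma>) \<longrightarrow> card (\<Inter>\<Gamma>\<in>\<E>. \<gamma> \<Gamma>) = 1)"

definition CD_tr :: "'a set \<Rightarrow> ('a \<Rightarrow> 'a) set \<Rightarrow> 'a set set set set"
  where "CD_tr \<Omega> G = {\<E>. cartesian_decomposition \<Omega> \<E> \<and>
    transitive_action (perm_grp \<Omega> G) \<E> (\<lambda>g. \<lambda>\<Gamma>\<in>\<E>. (\<lambda>\<gamma>. g ` \<gamma>) ` \<Gamma>)}"

(* The intersection with M covers the case of a single subgroup, where the intersection over
   the remaining ones is M. *)
definition cartesian_system ::
    "'a set \<Rightarrow> ('a \<Rightarrow> 'a) set \<Rightarrow> 'a \<Rightarrow> ('a \<Rightarrow> 'a) set set \<Rightarrow> bool"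
  where "cartesian_system \<Omega> M \<omega> \<K> \<longleftrightarrow> \<K> \<noteq> {} \<and>
    (\<forall>K\<in>\<K>. subgroup K (perm_grp \<Omega> M) \<and> K \<noteq> M) \<and>
    \<Inter>\<K> = point_stab \<Omega> M \<omega> \<and>
    (\<forall>K\<in>\<K>. K <#>\<^bsub>BijGroup \<Omega>\<^esub> (M \<inter> \<Inter>(\<K> - {K})) = M)"

definition system_of_decomposition ::
    "'a set \<Rightarrow> ('a \<Rightarrow> 'a) set \<Rightarrow> 'a \<Rightarrow> 'a set set set \<Rightarrow> ('a \<Rightarrow> 'a) set set"
  where "system_of_decomposition \<Omega> M \<omega> \<E> =
    {set_stab \<Omega> M \<gamma> |\<gamma> \<Gamma>. \<Gamma> \<in> \<E> \<and> \<gamma> \<in> \<Gamma> \<and> \<omega> \<in> \<gamma>}"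

definition translates :: "('a \<Rightarrow> 'a) set \<Rightarrow> 'a set \<Rightarrow> 'a set set"
  where "translates M B = {m ` B |m. m \<in> M}"

definition decomposition_of_system ::
    "'a set \<Rightarrow> ('a \<Rightarrow> 'a) set \<Rightarrow> 'a \<Rightarrow> ('a \<Rightarrow> 'a) set set \<Rightarrow> 'a set set set"
  where "decomposition_of_system \<Omega> M \<omega> \<K> =
    {translates M (point_orbit \<Omega> K \<omega>) |K. K \<in> \<K>}"

(* \<F>_i(\<E>, M, \<omega>), with T in place of the index i. *)
definition proper_projections :: "'a set \<Rightarrow> ('a \<Rightarrow> 'a) set \<Rightarrow> ('a \<Rightarrow> 'a) set set \<Rightarrow>
    'a \<Rightarrow> 'a set set set \<Rightarrow> ('a \<Rightarrow> 'a) set \<Rightarrow> ('a \<Rightarrow> 'a) set set"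
  where "proper_projections \<Omega> M Ts \<omega> \<E> T =
    {factor_proj (BijGroup \<Omega>) Ts T ` K |K. K \<in> system_of_decomposition \<Omega> M \<omega> \<E> \<and>
       factor_proj (BijGroup \<Omega>) Ts T ` K \<noteq> T}"

(* The condition depends neither on \<omega> nor on the factor T, whence the universal quantifiers. *)
definition CD_2nc :: "'a set \<Rightarrow> ('a \<Rightarrow> 'a) set \<Rightarrow> ('a \<Rightarrow> 'a) set \<Rightarrow> ('a \<Rightarrow> 'a) set set \<Rightarrow>
    'a set set set set"
  where "CD_2nc \<Omega> G M Ts = {\<E> \<in> CD_tr \<Omega> G. \<forall>\<omega>\<in>\<Omega>. \<forall>T\<in>Ts.
    card (proper_projections \<Omega> M Ts \<omega> \<E> T) = 2 \<and>
    (\<forall>A\<in>proper_projections \<Omega> M Ts \<omega> \<E> T. \<forall>B\<in>proper_projections \<Omega> M Ts \<omega> \<E> T.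
       A \<noteq> B \<longrightarrow> \<not> conjugate_under (BijGroup \<Omega>) (point_stab \<Omega> G \<omega>) A B)}"

(* sigma_1(K) x ... x sigma_k(K) as a subgroup of M. *)
definition bar_subgroup ::
    "('g, 'm) monoid_scheme \<Rightarrow> 'g set \<Rightarrow> 'g set set \<Rightarrow> 'g set \<Rightarrow> 'g set"
  where "bar_subgroup S M Ts K =
    {m \<in> M. \<forall>T\<in>Ts. factor_proj S Ts T m \<in> factor_proj S Ts T ` K}"

definition block_of :: "'a set set \<Rightarrow> 'a \<Rightarrow> 'a set"
  where "block_of P x = (THE B. B \<in> P \<and> x \<in> B)"

definition induced_perm :: "'a set set \<Rightarrow> ('a \<Rightarrow> 'a) \<Rightarrow> 'a set \<Rightarrow> 'a set"
  where "induced_perm P g = (\<lambda>B\<in>P. g ` B)"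

(* loopfree_digraph allows multiple arcs but no loops, as required of a generalised di-graph. *)
definition generalised_digraph :: "('v, 'v) pre_digraph \<Rightarrow> bool"
  where "generalised_digraph D \<longleftrightarrow>
    loopfree_digraph D \<and> verts D \<noteq> {} \<and> verts D \<inter> arcs D = {}"

definition digraph_auts :: "('v, 'e) pre_digraph \<Rightarrow> (('v \<Rightarrow> 'v) \<times> ('e \<Rightarrow> 'e)) set"
  where "digraph_auts D =
    {(\<alpha>V, \<alpha>E) \<in> carrier (BijGroup (verts D) \<times>\<times> BijGroup (arcs D)).
       \<forall>e\<in>arcs D. \<alpha>V (tail D e) = tail D (\<alpha>E e) \<and> \<alpha>V (head D e) = head D (\<alpha>E e)}"

definition digraph_aut_group :: "('v, 'e) pre_digraph \<Rightarrow> (('v \<Rightarrow> 'v) \<times> ('e \<Rightarrow> 'e)) monoid"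
  where "digraph_aut_group D =
    (BijGroup (verts D) \<times>\<times> BijGroup (arcs D))\<lparr>carrier := digraph_auts D\<rparr>"

(* The unique K in \<K>_\<omega>(\<E>) whose projection to the factor T is G_\<omega>-conjugate to A1. *)
definition member_over :: "'a set \<Rightarrow> ('a \<Rightarrow> 'a) set \<Rightarrow> ('a \<Rightarrow> 'a) set \<Rightarrow> ('a \<Rightarrow> 'a) set set \<Rightarrow>
    'a \<Rightarrow> 'a set set set \<Rightarrow> ('a \<Rightarrow> 'a) set \<Rightarrow> ('a \<Rightarrow> 'a) set \<Rightarrow> ('a \<Rightarrow> 'a) set"
  where "member_over \<Omega> G M Ts \<omega> \<E> A1 T =
    (THE K. K \<in> system_of_decomposition \<Omega> M \<omega> \<E> \<and>
       conjugate_under (BijGroup \<Omega>) (point_stab \<Omega> G \<omega>) A1 (factor_proj (BijGroup \<Omega>) Ts T ` K))"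

(* \<Gamma>(G, \<E>). The two elements A1, B1 of \<F>_1(\<E>, M, \<omega>) are arguments, since their order fixes
   the direction of the arcs. *)
definition decomposition_digraph ::
    "'a set \<Rightarrow> ('a \<Rightarrow> 'a) set \<Rightarrow> ('a \<Rightarrow> 'a) set \<Rightarrow> ('a \<Rightarrow> 'a) set set \<Rightarrow> 'a \<Rightarrow> 'a set set set \<Rightarrow>
     ('a \<Rightarrow> 'a) set \<Rightarrow> ('a \<Rightarrow> 'a) set \<Rightarrow> (('a \<Rightarrow> 'a) set, ('a \<Rightarrow> 'a) set) pre_digraph"
  where "decomposition_digraph \<Omega> G M Ts \<omega> \<E> A1 B1 =
    \<lparr>verts = system_of_decomposition \<Omega> M \<omega> \<E>, arcs = Ts,
     tail = member_over \<Omega> G M Ts \<omega> \<E> A1, head = member_over \<Omega> G M Ts \<omega> \<E> B1\<rparr>"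

end

theory Submission
  imports Defs "HOL-Combinatorics.Permutations" "HOL-Computational_Algebra.Primes"
begin

text \<open>The number \<open>l\<close> of partitions is too small for the plinth \<open>M\<close> to permute them faithfully, so \<open>M\<close>
  fixes each of them, the subgroups \<open>K\<close> in the Cartesian system are permuted transitively by
  the point stabiliser \<open>H\<close>, and so are the simple factors \<open>T\<close>.  If \<open>K \<noteq> L\<close>, then \<open>K L = M\<close>
  projects to \<open>\<sigma> T K \<cdot> \<sigma> T L = T\<close>; hence over each \<open>T\<close> exactly two members of the system project
  properly.  They are told apart by their \<open>H\<close>-classes, which \<open>H\<close> preserves: this makes the
  digraph well defined and \<open>H\<close>-invariant and yields the equality of normalisers.  The kernel of
  \<open>M\<close> on the quotient is normal in \<open>G\<close> and contained in the proper subgroup \<open>Mb\<close>, so it is trivial,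
  and the system, the projections and the conjugacy classes can be carried over along \<open>\<phi>\<close>.  An element
  of \<open>G\<close> fixing the block of \<open>\<omega>\<close> is a product of an element of \<open>Mb\<close> and one of \<open>H\<close>, and
  \<open>Mb\<close> normalises the projections, so no new conjugacies arise in the quotient.\<close>

section \<open>Conjugation and direct decompositions\<close>

text \<open>Two facts that the informal notions take as known have to be derived: the plinth fixes
  every partition of an invariant Cartesian decomposition, and decompositions correspond to
  Cartesian systems. The passage to a system serves the given decomposition; the way back, with the
  round trip that recovers the system, serves the quotient, whose projections are read off from its
  system.

  The recurring device is the factorisation \<open>G = M H\<close>, a Frattini argument from the
  transitivity of \<open>M\<close>. As \<open>M\<close> fixes every partition and normalises every
  factor, it drops out, and transitivity of \<open>G\<close> on partitions or factors becomes
  transitivity of \<open>H\<close>.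

  Only \<open>M\<close> is shown to be faithful on the quotient, not \<open>G\<close>; so minimality
  of the image of \<open>M\<close> comes from pulling normal subgroups back along
  \<open>\<phi>\<close>. Since \<open>CD_2nc\<close> quantifies over all base points while the
  quotient is studied at one, conjugation by elements of \<open>M\<close> must link them. The
  locales leave the group and the permuted set open, so that the quotient becomes a second
  instance.\<close>

lemma conj_set_image: "conj_set S g X = (\<lambda>x. g \<otimes>\<^bsub>S\<^esub> x \<otimes>\<^bsub>S\<^esub> inv\<^bsub>S\<^esub> g) ` X"
  by (auto simp: conj_set_def l_coset_def r_coset_def)

lemma conj_set_mono: "X \<subseteq> Y \<Longrightarrow> conj_set S g X \<subseteq> conj_set S g Y"
  by (auto simp: conj_set_image)

context group
begin

lemma subgroup_restrict_iff:
  assumes "subgroup M G"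
  shows "subgroup K (G\<lparr>carrier := M\<rparr>) \<longleftrightarrow> subgroup K G \<and> K \<subseteq> M"
proof
  assume *: "subgroup K (G\<lparr>carrier := M\<rparr>)"
  then show "subgroup K G \<and> K \<subseteq> M"
    using incl_subgroup[OF assms *] subgroup.subset[OF *] by simp
next
  assume "subgroup K G \<and> K \<subseteq> M"
  then show "subgroup K (G\<lparr>carrier := M\<rparr>)"
    using subgroup_incl[OF _ assms] by blast
qed

text \<open>Normality refers to the restricted structure, while all computations take place in the
  ambient group; the two agree because inverses in a subgroup are ambient inverses.\<close>

lemma normal_restrict_iff:
  assumes "subgroup M G"
  shows "N \<lhd> G\<lparr>carrier := M\<rparr> \<longleftrightarrow>
    subgroup N G \<and> N \<subseteq> M \<and> (\<forall>m\<in>M. \<forall>n\<in>N. m \<otimes> n \<otimes> inv m \<in> N)"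
proof -
  interpret M: group "G\<lparr>carrier := M\<rparr>"
    using assms by (rule subgroup_imp_group)
  show ?thesis
    unfolding M.normal_inv_iff subgroup_restrict_iff[OF assms]
    using m_inv_consistent[OF assms] by auto
qed

lemma conj_mult:
  "\<lbrakk>g \<in> carrier G; x \<in> carrier G; y \<in> carrier G\<rbrakk> \<Longrightarrow>
    g \<otimes> (x \<otimes> y) \<otimes> inv g = (g \<otimes> x \<otimes> inv g) \<otimes> (g \<otimes> y \<otimes> inv g)"
  by (simp add: m_assoc inv_solve_left)

lemma conj_inv:
  "\<lbrakk>g \<in> carrier G; x \<in> carrier G\<rbrakk> \<Longrightarrow> g \<otimes> inv x \<otimes> inv g = inv (g \<otimes> x \<otimes> inv g)"
  by (simp add: m_assoc inv_mult_group)

lemma conj_comp: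
  "\<lbrakk>g \<in> carrier G; h \<in> carrier G; x \<in> carrier G\<rbrakk> \<Longrightarrow>
    (g \<otimes> h) \<otimes> x \<otimes> inv (g \<otimes> h) = g \<otimes> (h \<otimes> x \<otimes> inv h) \<otimes> inv g"
  by (simp add: m_assoc inv_mult_group)

lemma conj_inv_conj:
  "\<lbrakk>g \<in> carrier G; x \<in> carrier G\<rbrakk> \<Longrightarrow> inv g \<otimes> (g \<otimes> x \<otimes> inv g) \<otimes> g = x"
  by (simp add: m_assoc flip: m_assoc[of "inv g" g])

lemma conj_set_closed: "g \<in> carrier G \<Longrightarrow> X \<subseteq> carrier G \<Longrightarrow> conj_set G g X \<subseteq> carrier G"
  by (auto simp: conj_set_image)

lemma conj_set_mult:
  "\<lbrakk>g \<in> carrier G; h \<in> carrier G; X \<subseteq> carrier G\<rbrakk> \<Longrightarrow>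
    conj_set G (g \<otimes> h) X = conj_set G g (conj_set G h X)"
  unfolding conj_set_image image_image by (rule image_cong) (auto simp: conj_comp)

lemma conj_set_one: "X \<subseteq> carrier G \<Longrightarrow> conj_set G \<one> X = X"
  by (auto simp: conj_set_image subset_iff image_iff)

lemma conj_set_inv_conj_set:
  "\<lbrakk>g \<in> carrier G; X \<subseteq> carrier G\<rbrakk> \<Longrightarrow> conj_set G (inv g) (conj_set G g X) = X"
  by (simp flip: conj_set_mult add: conj_set_one)

lemma conj_set_conj_set_inv:
  "\<lbrakk>g \<in> carrier G; X \<subseteq> carrier G\<rbrakk> \<Longrightarrow> conj_set G g (conj_set G (inv g) X) = X"
  by (simp flip: conj_set_mult add: conj_set_one)

lemma mem_conj_set_iff:
  assumes "g \<in> carrier G" "X \<subseteq> carrier G" "x \<in> carrier G"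
  shows "x \<in> conj_set G g X \<longleftrightarrow> inv g \<otimes> x \<otimes> g \<in> X"
proof
  assume "x \<in> conj_set G g X"
  then show "inv g \<otimes> x \<otimes> g \<in> X"
    using assms by (auto simp: conj_set_image conj_inv_conj subset_iff)
next
  assume "inv g \<otimes> x \<otimes> g \<in> X"
  moreover have "x = g \<otimes> (inv g \<otimes> x \<otimes> g) \<otimes> inv g"
    using assms conj_inv_conj[of "inv g" x] by simp
  ultimately show "x \<in> conj_set G g X"
    unfolding conj_set_image by blast
qed

lemma conj_set_subgroup:
  assumes "g \<in> carrier G" "subgroup K G"
  shows "subgroup (conj_set G g K) G"
proof -
  interpret group_hom G G "\<lambda>x. g \<otimes> x \<otimes> inv g"
    using assms by unfold_locales (auto simp: hom_def conj_mult)
  show ?thesis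
    unfolding conj_set_image by (rule subgroup_img_is_subgroup[OF assms(2)])
qed

text \<open>Stability of \<open>X\<close> under the elements of \<open>H\<close> is only an
  inclusion; used for \<open>inv g\<close>, it supplies the reverse inclusion for
  \<open>g\<close>.\<close>

lemma conj_set_invariant:
  assumes "subgroup H G" "X \<subseteq> carrier G" "\<And>h x. h \<in> H \<Longrightarrow> x \<in> X \<Longrightarrow> h \<otimes> x \<otimes> inv h \<in> X" "g \<in> H"
  shows "conj_set G g X = X"
proof -
  have sub: "conj_set G h X \<subseteq> X" if "h \<in> H" for h
    using assms(3) that by (auto simp: conj_set_image)
  have "X = conj_set G g (conj_set G (inv g) X)"
    using assms subgroup.mem_carrier[OF assms(1)] by (simp add: conj_set_conj_set_inv)
  also have "\<dots> \<subseteq> conj_set G g X"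
    using assms by (intro conj_set_mono sub) (auto simp: subgroup.m_inv_closed)
  finally show ?thesis using sub[OF assms(4)] by blast
qed

lemma conj_set_self: "subgroup K G \<Longrightarrow> g \<in> K \<Longrightarrow> conj_set G g K = K"
  by (rule conj_set_invariant[of K]) (auto intro!: subgroup.m_closed subgroup.m_inv_closed subgroup.subset)

lemma conjugate_under_sym:
  assumes "subgroup H G" "X \<subseteq> carrier G" "conjugate_under G H X Y"
  shows "conjugate_under G H Y X"
  using assms unfolding conjugate_under_def
  by (metis conj_set_inv_conj_set subgroup.m_inv_closed subgroup.mem_carrier)

lemma conjugate_under_trans:
  assumes "subgroup H G" "X \<subseteq> carrier G" "conjugate_under G H X Y" "conjugate_under G H Y Z"
  shows "conjugate_under G H X Z"
  using assms unfolding conjugate_under_def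
  by (metis conj_set_mult subgroup.m_closed subgroup.mem_carrier)

lemma normalizer_in_iff:
  assumes "H \<subseteq> carrier G" "X \<subseteq> carrier G"
  shows "g \<in> normalizer_in G H X \<longleftrightarrow> g \<in> H \<and> conj_set G g X = X"
  using assms by (auto simp: normalizer_in_def normalizer_def stabilizer_def conj_set_def)

text \<open>The centraliser of \<open>x\<close> is closed under products and inverses, so it
  contains whatever a subset of it generates.\<close>

lemma commute_generate:
  assumes "x \<in> carrier G" "H \<subseteq> carrier G" "\<And>h. h \<in> H \<Longrightarrow> x \<otimes> h = h \<otimes> x"
    and "y \<in> generate G H"
  shows "x \<otimes> y = y \<otimes> x"
  using assms(4)
proof induction
  case (inv h)
  then have h: "h \<in> carrier G" "x \<otimes> h = h \<otimes> x" using assms by auto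
  have "x \<otimes> inv h = inv h \<otimes> (h \<otimes> x) \<otimes> inv h"
    using h(1) assms(1) by (simp flip: m_assoc)
  also have "\<dots> = inv h \<otimes> (x \<otimes> h) \<otimes> inv h" using h(2) by simp
  also have "\<dots> = inv h \<otimes> x" using h(1) assms(1) by (simp add: m_assoc)
  finally show ?case .
next
  case (eng h1 h2)
  then have "h1 \<in> carrier G" "h2 \<in> carrier G"
    using generate_in_carrier assms(2) by auto
  then show ?case
    using eng.IH assms(1) by (metis m_assoc)
qed (use assms in auto)

text \<open>The commutator of \<open>x\<close> and \<open>y\<close> lies in \<open>B\<close> when
  bracketed as a conjugate of \<open>y\<close> times \<open>inv y\<close>, and in \<open>A\<close>
  when bracketed as \<open>x\<close> times a conjugate of \<open>inv x\<close>; so it is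
  trivial.\<close>

lemma normal_disjoint_commute:
  assumes "subgroup A G" "subgroup B G" "A \<inter> B \<subseteq> {\<one>}"
    and "\<And>a b. a \<in> A \<Longrightarrow> b \<in> B \<Longrightarrow> a \<otimes> b \<otimes> inv a \<in> B"
    and "\<And>a b. a \<in> A \<Longrightarrow> b \<in> B \<Longrightarrow> b \<otimes> a \<otimes> inv b \<in> A"
    and "x \<in> A" "y \<in> B"
  shows "x \<otimes> y = y \<otimes> x"
proof -
  have c: "x \<in> carrier G" "y \<in> carrier G"
    using assms by (auto dest: subgroup.mem_carrier)
  have "(x \<otimes> y \<otimes> inv x) \<otimes> inv y \<in> B"
    by (rule subgroup.m_closed[OF assms(2)]) (use assms subgroup.m_inv_closed[OF assms(2)] in auto)
  moreover have "x \<otimes> (y \<otimes> inv x \<otimes> inv y) \<in> A"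
    by (rule subgroup.m_closed[OF assms(1)]) (use assms subgroup.m_inv_closed[OF assms(1)] in auto)
  ultimately have "x \<otimes> y \<otimes> inv x \<otimes> inv y = \<one>"
    using assms(3) c by (auto simp: m_assoc)
  then show ?thesis
    using c by (simp add: inv_solve_right')
qed

text \<open>An action is a homomorphism into \<open>BijGroup E\<close>, whose elements are undefined
  outside \<open>E\<close>; hence the restriction of \<open>f g\<close> to \<open>E\<close>.
  Bijectivity follows from the action laws, since \<open>f (inv g)\<close> inverts
  \<open>f g\<close>.\<close>

lemma group_actionI:
  assumes H: "subgroup H G"
    and closed: "\<And>g x. g \<in> H \<Longrightarrow> x \<in> E \<Longrightarrow> f g x \<in> E"
    and one: "\<And>x. x \<in> E \<Longrightarrow> f \<one> x = x"
    and mult: "\<And>g h x. g \<in> H \<Longrightarrow> h \<in> H \<Longrightarrow> x \<in> E \<Longrightarrow> f (g \<otimes> h) x = f g (f h x)"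
  shows "group_action (G\<lparr>carrier := H\<rparr>) E (\<lambda>g. \<lambda>x\<in>E. f g x)"
proof -
  have inv: "f (inv g) (f g x) = x \<and> f g (f (inv g) x) = x" if "g \<in> H" "x \<in> E" for g x
    using that mult[of "inv g" g x] mult[of g "inv g" x] one H
    by (simp add: subgroup.m_inv_closed subgroup.mem_carrier)
  have bij: "(\<lambda>x\<in>E. f g x) \<in> Bij E" if g: "g \<in> H" for g
  proof -
    have "bij_betw (f g) E E"
      using g H by (intro bij_betwI[where g = "f (inv g)"]) (auto simp: closed inv subgroup.m_inv_closed)
    then have "bij_betw (\<lambda>x\<in>E. f g x) E E"
      by (simp cong: bij_betw_cong)
    then show ?thesis by (simp add: Bij_def)
  qed
  interpret H: group "G\<lparr>carrier := H\<rparr>" using H by (rule subgroup_imp_group)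
  show ?thesis
    unfolding group_action_def group_hom_def group_hom_axioms_def
    using H.is_group group_BijGroup[of E]
    by (auto simp: hom_def BijGroup_def bij mult compose_def closed fun_eq_iff)
qed

lemma transitive_actionI:
  assumes "subgroup H G"
    and "\<And>g x. g \<in> H \<Longrightarrow> x \<in> E \<Longrightarrow> f g x \<in> E"
    and "\<And>x. x \<in> E \<Longrightarrow> f \<one> x = x"
    and "\<And>g h x. g \<in> H \<Longrightarrow> h \<in> H \<Longrightarrow> x \<in> E \<Longrightarrow> f (g \<otimes> h) x = f g (f h x)"
    and "\<And>x y. x \<in> E \<Longrightarrow> y \<in> E \<Longrightarrow> \<exists>g\<in>H. f g x = y"
  shows "transitive_action (G\<lparr>carrier := H\<rparr>) E (\<lambda>g. \<lambda>x\<in>E. f g x)"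
proof -
  interpret group_action "G\<lparr>carrier := H\<rparr>" E "\<lambda>g. \<lambda>x\<in>E. f g x"
    using assms by (intro group_actionI) auto
  show ?thesis
    by unfold_locales (use assms(5) in auto)
qed

end

section \<open>Internal direct products and their projections\<close>

locale factor_decomposition = group S for S (structure) +
  fixes M Ts
  assumes M: "subgroup M S"
    and decomposition: "internal_direct_product S M Ts"
    and trivial_centre: "\<And>z. z \<in> M \<Longrightarrow> (\<And>m. m \<in> M \<Longrightarrow> z \<otimes> m = m \<otimes> z) \<Longrightarrow> z = \<one>"
begin

abbreviation "\<sigma> \<equiv> factor_proj S Ts"
abbreviation "C T \<equiv> generate S (\<Union>(Ts - {T}))"

lemma M_carrier: "m \<in> M \<Longrightarrow> m \<in> carrier S"
  using M by (rule subgroup.mem_carrier)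

lemma factor:
  assumes "T \<in> Ts"
  shows factor_subgroup: "subgroup T S" and factor_subset: "T \<subseteq> M"
    and factor_conj: "\<And>m t. m \<in> M \<Longrightarrow> t \<in> T \<Longrightarrow> m \<otimes> t \<otimes> inv m \<in> T"
    and factor_inter: "T \<inter> C T = {\<one>}"
  using assms decomposition normal_restrict_iff[OF M] unfolding internal_direct_product_def by auto

lemma factor_carrier: "T \<in> Ts \<Longrightarrow> t \<in> T \<Longrightarrow> t \<in> carrier S"
  using factor_subgroup subgroup.mem_carrier by metis

lemma generate_factors: "generate S (\<Union>Ts) = M"
  using decomposition unfolding internal_direct_product_def by blast

lemma C_subgroup: "subgroup (C T) S"
  by (rule generate_is_subgroup) (auto intro: factor_carrier)

lemma C_subset: "C T \<subseteq> M"
  unfolding generate_factors[symmetric] by (rule mono_generate) auto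

lemma C_carrier: "c \<in> C T \<Longrightarrow> c \<in> carrier S"
  using C_subset M_carrier by blast

lemma factor_subset_C: "T' \<in> Ts \<Longrightarrow> T' \<noteq> T \<Longrightarrow> T' \<subseteq> C T"
  by (auto intro: generate.incl)

lemma factors_disjoint: "T \<in> Ts \<Longrightarrow> T' \<in> Ts \<Longrightarrow> T \<noteq> T' \<Longrightarrow> T \<inter> T' = {\<one>}"
  using factor_inter[of T] factor_subset_C[of T' T] factor_subgroup[of T] factor_subgroup[of T']
    subgroup.one_closed by blast

lemma factors_commute:
  assumes "T \<in> Ts" "T' \<in> Ts" "T \<noteq> T'" "t \<in> T" "t' \<in> T'"
  shows "t \<otimes> t' = t' \<otimes> t"
proof (rule normal_disjoint_commute[of T T'])
  show "a \<otimes> b \<otimes> inv a \<in> T'" if "a \<in> T" "b \<in> T'" for a b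
    using that assms(1,2) factor_subset factor_conj by blast
  show "b \<otimes> a \<otimes> inv b \<in> T" if "a \<in> T" "b \<in> T'" for a b
    using that assms(1,2) factor_subset factor_conj by blast
qed (use assms factors_disjoint factor_subgroup in auto)

lemma C_commute:
  assumes "T \<in> Ts" "t \<in> T" "c \<in> C T"
  shows "t \<otimes> c = c \<otimes> t"
  using assms(3)
  by (rule commute_generate[rotated -1]) (use assms factors_commute factor_carrier in auto)

lemma factor_mult_C_mult:
  assumes "T \<in> Ts" "t \<in> T" "c \<in> C T" "t' \<in> T" "c' \<in> C T"
  shows "(t \<otimes> c) \<otimes> (t' \<otimes> c') = (t \<otimes> t') \<otimes> (c \<otimes> c')"
proof -
  have car: "t \<in> carrier S" "c \<in> carrier S" "t' \<in> carrier S" "c' \<in> carrier S"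
    using assms factor_carrier C_carrier by auto
  have "(t \<otimes> c) \<otimes> (t' \<otimes> c') = t \<otimes> (c \<otimes> t') \<otimes> c'"
    using car by (simp add: m_assoc)
  also have "\<dots> = t \<otimes> (t' \<otimes> c) \<otimes> c'"
    using C_commute[of T t' c] assms by simp
  finally show ?thesis using car by (simp add: m_assoc)
qed

text \<open>\<open>T\<close> and its complement \<open>C T\<close> commute elementwise, so the
  products of their elements are closed under multiplication, and every factor lies in one of the
  two.\<close>

lemma factor_split:
  assumes "T \<in> Ts" "m \<in> M"
  shows "\<exists>t\<in>T. \<exists>c\<in>C T. m = t \<otimes> c"
proof -
  have T1: "\<one> \<in> T" and C1: "\<one> \<in> C T"
    using assms factor_subgroup C_subgroup subgroup.one_closed by auto
  have *: "\<exists>t\<in>T. \<exists>c\<in>C T. h = t \<otimes> c" if "h \<in> T' " "T' \<in> Ts" for h T'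
  proof (cases "T' = T")
    case True
    then have "h = h \<otimes> \<one>" "h \<in> T" using that factor_carrier by auto
    then show ?thesis using C1 by blast
  next
    case False
    then have "h = \<one> \<otimes> h" "h \<in> C T"
      using that factor_carrier factor_subset_C[of T' T] by auto
    then show ?thesis using T1 by blast
  qed
  have "m \<in> generate S (\<Union>Ts)" using assms generate_factors by simp
  then show ?thesis
  proof induction
    case one
    have "\<one> = \<one> \<otimes> \<one>" by simp
    then show ?case using T1 C1 by blast
  next
    case (incl h)
    then show ?case using * by blast
  next
    case (inv h)
    then obtain T' where "T' \<in> Ts" "h \<in> T'" by blast
    then show ?case using *[of "inv h" T'] factor_subgroup subgroup.m_inv_closed by metis
  next
    case (eng h1 h2)
    then obtain t1 c1 t2 c2 where "t1 \<in> T" "c1 \<in> C T" "h1 = t1 \<otimes> c1" "t2 \<in> T" "c2 \<in> C T" "h2 = t2 \<otimes> c2"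
      by blast
    moreover from this have "h1 \<otimes> h2 = (t1 \<otimes> t2) \<otimes> (c1 \<otimes> c2)"
      using factor_mult_C_mult assms by blast
    ultimately show ?case
      using factor_subgroup[OF assms(1)] C_subgroup[of T] subgroup.m_closed by metis
  qed
qed

text \<open>This resolves the description operator in \<open>factor_proj\<close>: two splittings of
  one element differ by an element of both \<open>T\<close> and \<open>C T\<close>, that is, by the
  identity.\<close>

lemma proj_eqI:
  assumes "T \<in> Ts" "t \<in> T" "c \<in> C T"
  shows "\<sigma> T (t \<otimes> c) = t"
  unfolding factor_proj_def
proof (rule the_equality)
  show "t \<in> T \<and> (\<exists>c'\<in>C T. t \<otimes> c = t \<otimes> c')" using assms by blast
next
  fix u assume "u \<in> T \<and> (\<exists>c'\<in>C T. t \<otimes> c = u \<otimes> c')"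
  then obtain c' where u: "u \<in> T" "c' \<in> C T" "t \<otimes> c = u \<otimes> c'" by blast
  have car: "t \<in> carrier S" "c \<in> carrier S" "u \<in> carrier S" "c' \<in> carrier S"
    using assms u factor_carrier C_carrier by auto
  have "inv u \<otimes> t = c' \<otimes> inv c"
    using u(3) car by (metis inv_closed inv_solve_left inv_solve_right m_assoc m_closed)
  moreover have "inv u \<otimes> t \<in> T" "c' \<otimes> inv c \<in> C T"
    using assms u factor_subgroup[OF assms(1)] C_subgroup[of T]
    by (auto intro!: subgroup.m_closed subgroup.m_inv_closed)
  ultimately have "inv u \<otimes> t = \<one>" using factor_inter[OF assms(1)] by auto
  then show "u = t" using car by (metis inv_solve_left r_one one_closed)
qed

lemma proj_split:
  assumes "T \<in> Ts" "m \<in> M"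
  shows "\<exists>c\<in>C T. m = \<sigma> T m \<otimes> c" and proj_closed: "\<sigma> T m \<in> T"
  using factor_split[OF assms] proj_eqI[OF assms(1)] by auto

lemma proj_mult:
  assumes "T \<in> Ts" "m \<in> M" "n \<in> M"
  shows "\<sigma> T (m \<otimes> n) = \<sigma> T m \<otimes> \<sigma> T n"
proof -
  obtain c d where cd: "c \<in> C T" "m = \<sigma> T m \<otimes> c" "d \<in> C T" "n = \<sigma> T n \<otimes> d"
    using proj_split(1)[OF assms(1,2)] proj_split(1)[OF assms(1,3)] by blast
  then have "m \<otimes> n = (\<sigma> T m \<otimes> \<sigma> T n) \<otimes> (c \<otimes> d)"
    using factor_mult_C_mult[OF assms(1)] proj_closed assms by metis
  then show ?thesis
    using cd assms proj_closed factor_subgroup C_subgroup proj_eqI subgroup.m_closed by metis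
qed

lemma proj_group_hom: "T \<in> Ts \<Longrightarrow> group_hom (S\<lparr>carrier := M\<rparr>) S (\<sigma> T)"
  using M by (auto simp: group_hom_def group_hom_axioms_def hom_def proj_mult
      intro: subgroup_imp_group is_group factor_carrier proj_closed)

lemma proj_factor: "T \<in> Ts \<Longrightarrow> t \<in> T \<Longrightarrow> \<sigma> T t = t"
  using proj_eqI[of T t \<one>] factor_carrier by (simp add: generate.one)

lemma proj_C: "T \<in> Ts \<Longrightarrow> c \<in> C T \<Longrightarrow> \<sigma> T c = \<one>"
  using proj_eqI[of T \<one> c] C_carrier factor_subgroup subgroup.one_closed by fastforce

lemma proj_other: "T \<in> Ts \<Longrightarrow> T' \<in> Ts \<Longrightarrow> T' \<noteq> T \<Longrightarrow> t \<in> T' \<Longrightarrow> \<sigma> T t = \<one>"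
  using proj_C factor_subset_C by blast

lemma proj_inv: "T \<in> Ts \<Longrightarrow> m \<in> M \<Longrightarrow> \<sigma> T (inv m) = inv (\<sigma> T m)"
  using group_hom.hom_inv[OF proj_group_hom, of T m] m_inv_consistent[OF M] by simp

lemma proj_subgroup:
  assumes "T \<in> Ts" "subgroup K S" "K \<subseteq> M"
  shows "subgroup (\<sigma> T ` K) S" "\<sigma> T ` K \<subseteq> T"
  using group_hom.subgroup_img_is_subgroup[OF proj_group_hom[OF assms(1)], of K]
    subgroup_restrict_iff[OF M] assms proj_closed by auto

lemma proj_M: "T \<in> Ts \<Longrightarrow> \<sigma> T ` M = T"
  using proj_closed proj_factor factor_subset by (auto simp: image_iff) (metis subsetD)

text \<open>Conjugation by \<open>g\<close> permutes the factors, so it maps the complement of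
  \<open>T\<close> into the complement of the conjugate factor. The conjugated splitting of
  \<open>m\<close> is therefore the splitting over that factor.\<close>

lemma proj_conj:
  assumes "T \<in> Ts" "m \<in> M" "g \<in> carrier S" "\<And>T. T \<in> Ts \<Longrightarrow> conj_set S g T \<in> Ts"
  shows "\<sigma> (conj_set S g T) (g \<otimes> m \<otimes> inv g) = g \<otimes> \<sigma> T m \<otimes> inv g"
proof -
  have sub: "X \<subseteq> carrier S" if "X \<in> Ts" for X using factor_carrier that by blast
  interpret group_hom S S "\<lambda>x. g \<otimes> x \<otimes> inv g"
    using assms by unfold_locales (auto simp: hom_def conj_mult)
  obtain c where c: "c \<in> C T" "m = \<sigma> T m \<otimes> c"
    using proj_split(1)[OF assms(1,2)] by blast
  have "(\<lambda>x. g \<otimes> x \<otimes> inv g) ` C T = generate S ((\<lambda>x. g \<otimes> x \<otimes> inv g) ` \<Union>(Ts - {T}))"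
    by (rule generate_img[symmetric]) (use factor_carrier in auto)
  also have "\<dots> \<subseteq> C (conj_set S g T)"
  proof (rule mono_generate, rule subsetI)
    fix y assume "y \<in> (\<lambda>x. g \<otimes> x \<otimes> inv g) ` \<Union>(Ts - {T})"
    then obtain T' where T': "T' \<in> Ts" "T' \<noteq> T" "y \<in> conj_set S g T'"
      unfolding conj_set_image by blast
    then have "conj_set S g T' \<noteq> conj_set S g T"
      using conj_set_inv_conj_set[OF assms(3)] sub assms(1) by metis
    then show "y \<in> \<Union>(Ts - {conj_set S g T})" using assms(4) T' by blast
  qed
  finally have "g \<otimes> c \<otimes> inv g \<in> C (conj_set S g T)" using c by blast
  moreover have "g \<otimes> m \<otimes> inv g = (g \<otimes> \<sigma> T m \<otimes> inv g) \<otimes> (g \<otimes> c \<otimes> inv g)"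
    using c assms proj_closed factor_carrier C_carrier conj_mult by metis
  moreover have "g \<otimes> \<sigma> T m \<otimes> inv g \<in> conj_set S g T"
    using proj_closed assms by (auto simp: conj_set_image)
  ultimately show ?thesis using proj_eqI assms by simp
qed

lemma proj_conj_set:
  assumes "T \<in> Ts" "K \<subseteq> M" "g \<in> carrier S" "\<And>T. T \<in> Ts \<Longrightarrow> conj_set S g T \<in> Ts"
  shows "\<sigma> (conj_set S g T) ` conj_set S g K = conj_set S g (\<sigma> T ` K)"
  unfolding conj_set_image[of S g K] conj_set_image[of S g "\<sigma> T ` K"] image_image
  using assms by (intro image_cong) (auto simp: proj_conj subset_iff)

lemma conj_set_factor: "T \<in> Ts \<Longrightarrow> m \<in> M \<Longrightarrow> conj_set S m T = T"
  by (rule conj_set_invariant[OF M _ factor_conj]) (auto intro: factor_carrier)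

text \<open>A normal subgroup meeting every factor trivially commutes with every factor, hence with
  the whole product that they generate; it is central, and the centre is trivial.\<close>

lemma normal_subgroup_meets_factor:
  assumes "subgroup N S" "N \<subseteq> M" "\<And>m n. m \<in> M \<Longrightarrow> n \<in> N \<Longrightarrow> m \<otimes> n \<otimes> inv m \<in> N"
    and "\<And>T. T \<in> Ts \<Longrightarrow> N \<inter> T \<subseteq> {\<one>}"
  shows "N = {\<one>}"
proof -
  have "n = \<one>" if n: "n \<in> N" for n
  proof (rule trivial_centre)
    have c: "n \<otimes> t = t \<otimes> n" if t: "t \<in> \<Union>Ts" for t
    proof -
      obtain T where T: "T \<in> Ts" "t \<in> T" using t by blast
      show ?thesis
      proof (rule normal_disjoint_commute[of N T])
        show "a \<otimes> b \<otimes> inv a \<in> T" if "a \<in> N" "b \<in> T" for a b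
          using that T assms(2) factor_conj by blast
        show "b \<otimes> a \<otimes> inv b \<in> N" if "a \<in> N" "b \<in> T" for a b
          using that T assms(3) factor_subset by blast
      qed (use T n assms factor_subgroup in auto)
    qed
    show "n \<otimes> m = m \<otimes> n" if "m \<in> M" for m
      by (rule commute_generate[of n "\<Union>Ts"])
        (use c that n generate_factors assms M_carrier factor_carrier in auto)
  qed (use n assms in auto)
  then show ?thesis using assms(1) subgroup.one_closed by blast
qed

text \<open>The conjugate of \<open>T\<close> is again normal in \<open>M\<close>, so it meets some
  factor \<open>T'\<close> nontrivially. By simplicity of \<open>T'\<close> it contains
  \<open>T'\<close>, and by simplicity of \<open>T\<close> nothing more.\<close>

lemma conj_set_factor_mem:
  assumes simple: "\<And>T. T \<in> Ts \<Longrightarrow> simple_group (S\<lparr>carrier := T\<rparr>)"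
    and g: "g \<in> carrier S" "conj_set S g M = M" and T: "T \<in> Ts"
  shows "conj_set S g T \<in> Ts"
proof -
  have Tc: "T \<subseteq> carrier S" if "T \<in> Ts" for T using factor_carrier that by blast
  have Mc: "M \<subseteq> carrier S" using M_carrier by blast
  have conjM: "conj_set S x T \<subseteq> M \<and> (\<forall>m\<in>M. \<forall>n\<in>conj_set S x T. m \<otimes> n \<otimes> inv m \<in> conj_set S x T)"
    if x: "x \<in> carrier S" "conj_set S x M = M" and T: "T \<in> Ts" for x T
  proof
    show "conj_set S x T \<subseteq> M"
      using conj_set_mono[of T M S x] x factor_subset[OF T] by simp
    show "\<forall>m\<in>M. \<forall>n\<in>conj_set S x T. m \<otimes> n \<otimes> inv m \<in> conj_set S x T"
    proof (intro ballI)
      fix m n assume m: "m \<in> M" and n: "n \<in> conj_set S x T"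
      obtain m' where m': "m' \<in> M" "m = x \<otimes> m' \<otimes> inv x"
        using m x(2) unfolding conj_set_image by blast
      obtain t where t: "t \<in> T" "n = x \<otimes> t \<otimes> inv x"
        using n unfolding conj_set_image by blast
      have car: "m' \<in> carrier S" "t \<in> carrier S"
        using m' t M_carrier factor_carrier[OF T] by auto
      have "m \<otimes> n \<otimes> inv m = x \<otimes> (m' \<otimes> t \<otimes> inv m') \<otimes> inv x"
        unfolding m'(2) t(2) conj_inv[OF x(1) car(1), symmetric]
        using car x(1) by (simp only: conj_mult m_closed inv_closed)
      then show "m \<otimes> n \<otimes> inv m \<in> conj_set S x T"
        using factor_conj[OF T m'(1) t(1)] unfolding conj_set_image by blast
    qed
  qed
  \<comment> \<open>A conjugate of one factor inside another is a nontrivial normal subgroup of it,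
    so simplicity turns the inclusion into equality. It is stated for any \<open>x\<close>
    normalising \<open>M\<close> because it will be applied to \<open>inv g\<close>.\<close>
  have sub: "conj_set S x T = T'"
    if x: "x \<in> carrier S" "conj_set S x M = M" and T: "T \<in> Ts" and T': "T' \<in> Ts"
      and "conj_set S x T \<subseteq> T'" for x T T'
  proof -
    interpret T': simple_group "S\<lparr>carrier := T'\<rparr>" using simple T' by blast
    interpret T: simple_group "S\<lparr>carrier := T\<rparr>" using simple T by blast
    have "conj_set S x T \<lhd> S\<lparr>carrier := T'\<rparr>"
      using that conjM[OF x T] factor_subset[OF T'] conj_set_subgroup[OF x(1) factor_subgroup[OF T]]
      unfolding normal_restrict_iff[OF factor_subgroup[OF T']] by blast
    then have "conj_set S x T = T' \<or> conj_set S x T = {\<one>}"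
      using T'.no_real_normal_subgroup by auto
    moreover have "conj_set S x T \<noteq> {\<one>}"
    proof
      assume "conj_set S x T = {\<one>}"
      then have "T = {\<one>}"
        using conj_set_inv_conj_set[OF x(1) Tc[OF T]] x by (simp add: conj_set_image)
      then show False using T.simple_not_triv by simp
    qed
    ultimately show ?thesis by blast
  qed
  let ?N = "conj_set S g T"
  have N: "subgroup ?N S" using conj_set_subgroup g factor_subgroup T by blast
  have "?N \<noteq> {\<one>}"
  proof
    assume "?N = {\<one>}"
    then have "T = {\<one>}"
      using conj_set_inv_conj_set[OF g(1) Tc[OF T]] g by (simp add: conj_set_image)
    then show False using simple[OF T] simple_group.simple_not_triv by fastforce
  qed
  then obtain T' where T': "T' \<in> Ts" "\<not> ?N \<inter> T' \<subseteq> {\<one>}"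
    using normal_subgroup_meets_factor[OF N] conjM[OF g T] by blast
  interpret T': simple_group "S\<lparr>carrier := T'\<rparr>" using simple T' by blast
  have "?N \<inter> T' \<lhd> S\<lparr>carrier := T'\<rparr>"
    using conjM[OF g T] factor_subset[OF T'(1)] factor_subgroup[OF T'(1)] N
      factor_conj[OF T'(1)]
    unfolding normal_restrict_iff[OF factor_subgroup[OF T'(1)]]
    by (auto simp: subgroups_Inter_pair subset_iff)
  then have "?N \<inter> T' = T'" using T'.no_real_normal_subgroup T'(2) by auto
  \<comment> \<open>Conjugating back turns \<open>T' \<subseteq> ?N\<close> into an inclusion of a
    conjugate of \<open>T'\<close> in the factor \<open>T\<close>, the situation of
    \<open>sub\<close>.\<close>
  then have "conj_set S (inv g) T' \<subseteq> conj_set S (inv g) ?N"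
    by (intro conj_set_mono) blast
  then have "conj_set S (inv g) T' \<subseteq> T"
    using conj_set_inv_conj_set[OF g(1) Tc[OF T]] by simp
  moreover have "conj_set S (inv g) M = M"
    using conj_set_inv_conj_set[OF g(1) Mc] g by simp
  ultimately have "conj_set S (inv g) T' = T" using sub g T T' by auto
  then have "T' = ?N" using conj_set_conj_set_inv[OF g(1) Tc[OF T'(1)]] by simp
  then show ?thesis using T' by simp
qed

end

text \<open>Injectivity on \<open>M\<close> keeps distinct factors distinct, makes images commute
  with intersections and reflects commutation, so decomposition and trivial centre survive. It will
  be applied to the action of \<open>M\<close> on the quotient.\<close>

lemma factor_decomposition_image:
  fixes S (structure)
  assumes fd: "factor_decomposition S M Ts"
    and h: "group_hom (S\<lparr>carrier := M\<rparr>) S' h" and inj: "inj_on h M"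
  shows "factor_decomposition S' (h ` M) ((`) h ` Ts)"
    and "\<And>T m. T \<in> Ts \<Longrightarrow> m \<in> M \<Longrightarrow> factor_proj S' ((`) h ` Ts) (h ` T) (h m) = h (factor_proj S Ts T m)"
proof -
  interpret factor_decomposition S M Ts by fact
  interpret h: group_hom "S\<lparr>carrier := M\<rparr>" S' h by fact
  have sub: "\<Union>(Ts - X) \<subseteq> M" for X using factor_subset by blast
  have inj2: "inj_on ((`) h) Ts"
    by (rule inj_onI) (metis inj factor_subset inj_on_image_eq_iff)
  have gen: "generate S' (h ` X) = h ` generate S X" if "X \<subseteq> M" for X
    using h.generate_img[of X] generate_consistent[OF that M] that by simp
  have imgsub: "subgroup (h ` X) S'" if "subgroup X S" "X \<subseteq> M" for X
    using h.subgroup_img_is_subgroup[of X] subgroup_restrict_iff[OF M] that by blast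
  have M': "subgroup (h ` M) S'" using imgsub M by blast
  \<comment> \<open>Since distinct factors have distinct images, removing \<open>h\<close> followed
    by the factor removes the image of that one factor only; complements go to complements.\<close>
  have rest: "\<Union>((`) h ` Ts - {h ` T}) = h ` \<Union>(Ts - {T})" if "T \<in> Ts" for T
  proof -
    have "(`) h ` Ts - {h ` T} = (`) h ` (Ts - {T})"
      using inj_on_image_set_diff[OF inj2, of Ts "{T}"] that by simp
    then show ?thesis by (simp only: image_Union)
  qed
  have hm: "h (x \<otimes> y) = h x \<otimes>\<^bsub>S'\<^esub> h y" if "x \<in> M" "y \<in> M" for x y
    using h.hom_mult[of x y] that by simp
  have hi: "h (inv x) = inv\<^bsub>S'\<^esub> h x" if "x \<in> M" for x
    using h.hom_inv[of x] m_inv_consistent[OF M] that by simp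
  have conjh: "h m \<otimes>\<^bsub>S'\<^esub> h t \<otimes>\<^bsub>S'\<^esub> inv\<^bsub>S'\<^esub> h m = h (m \<otimes> t \<otimes> inv m)" if "m \<in> M" "t \<in> M" for m t
    using that hm hi subgroup.m_closed[OF M] subgroup.m_inv_closed[OF M] by simp
  have idp: "internal_direct_product S' (h ` M) ((`) h ` Ts)"
    unfolding internal_direct_product_def
  proof (intro conjI ballI)
    fix X assume "X \<in> (`) h ` Ts"
    then obtain T where T: "T \<in> Ts" "X = h ` T" by blast
    have "\<forall>m\<in>M. \<forall>t\<in>T. h m \<otimes>\<^bsub>S'\<^esub> h t \<otimes>\<^bsub>S'\<^esub> inv\<^bsub>S'\<^esub> h m \<in> h ` T"
      using T factor_conj factor_subset[OF T(1)] by (auto simp: conjh subset_iff)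
    then show "X \<lhd> S'\<lparr>carrier := h ` M\<rparr>"
      unfolding h.H.normal_restrict_iff[OF M'] T
      using imgsub factor_subgroup[OF T(1)] factor_subset[OF T(1)] by auto
    have "h ` T \<inter> h ` C T = h ` (T \<inter> C T)"
      using inj factor_subset[OF T(1)] C_subset by (simp add: inj_on_image_Int)
    then show "X \<inter> generate S' (\<Union>((`) h ` Ts - {X})) = {\<one>\<^bsub>S'\<^esub>}"
      using h.hom_one rest[OF T(1)] gen[OF sub] T factor_inter[OF T(1)] by simp
  next
    have "\<Union>((`) h ` Ts) = h ` \<Union>Ts" by auto
    then show "generate S' (\<Union>((`) h ` Ts)) = h ` M"
      using gen[of "\<Union>Ts"] factor_subset generate_factors by auto
  qed
  show fd': "factor_decomposition S' (h ` M) ((`) h ` Ts)"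
  proof (intro factor_decomposition.intro factor_decomposition_axioms.intro)
    fix z assume z: "z \<in> h ` M" "\<And>m. m \<in> h ` M \<Longrightarrow> z \<otimes>\<^bsub>S'\<^esub> m = m \<otimes>\<^bsub>S'\<^esub> z"
    then obtain x where x: "x \<in> M" "z = h x" by blast
    have "x = \<one>"
    proof (rule trivial_centre)
      fix m assume m: "m \<in> M"
      then have "h (x \<otimes> m) = h (m \<otimes> x)"
        using z(2)[of "h m"] x h.hom_mult[of x m] h.hom_mult[of m x] by simp
      then show "x \<otimes> m = m \<otimes> x"
        using inj m x M by (auto simp: inj_on_def subgroup.m_closed)
    qed (use x in auto)
    then show "z = \<one>\<^bsub>S'\<^esub>" using x h.hom_one by simp
  qed (use M' idp h.H.is_group in auto)
  interpret f': factor_decomposition S' "h ` M" "(`) h ` Ts" by fact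
  fix T m assume T: "T \<in> Ts" and m: "m \<in> M"
  obtain c where c: "c \<in> C T" "m = \<sigma> T m \<otimes> c"
    using proj_split(1)[OF T m] by blast
  have "h m = h (\<sigma> T m) \<otimes>\<^bsub>S'\<^esub> h c"
    using h.hom_mult[of "\<sigma> T m" c] c C_subset proj_closed[OF T m] factor_subset[OF T] by auto
  moreover have "h c \<in> generate S' (\<Union>((`) h ` Ts - {h ` T}))"
    using c rest[OF T] gen[OF sub] by simp
  ultimately show "f'.\<sigma> (h ` T) (h m) = h (\<sigma> T m)"
    using f'.proj_eqI[of "h ` T" "h (\<sigma> T m)" "h c"] T proj_closed[OF T m] by simp
qed

section \<open>Cartesian systems of transitive groups\<close>

text \<open>One step of Legendre's formula: the multiples of \<open>p\<close> up to \<open>n\<close>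
  are \<open>p\<close> times \<open>1, ..., n div p\<close>, and \<open>u\<close> is the product of
  the remaining numbers.\<close>

lemma fact_prime_part:
  assumes "prime (p::nat)"
  shows "\<exists>u. \<not> p dvd u \<and> fact n = u * p ^ (n div p) * fact (n div p)"
proof (induction n)
  case 0
  show ?case using assms by (intro exI[of _ 1]) (auto simp: prime_nat_iff)
next
  case (Suc n)
  then obtain u where u: "\<not> p dvd u" "fact n = u * p ^ (n div p) * fact (n div p)" by blast
  show ?case
  proof (cases "p dvd Suc n")
    case True
    then have d: "Suc n div p = Suc (n div p)"
      by (simp add: div_Suc dvd_eq_mod_eq_0)
    then have "Suc n = p * Suc (n div p)" using True by (metis dvd_mult_div_cancel)
    then have "fact (Suc n) = p * Suc (n div p) * (u * p ^ (n div p) * fact (n div p))"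
      using u(2) by (metis fact_Suc of_nat_id)
    then show ?thesis
      using u(1) d by (intro exI[of _ u]) (simp add: algebra_simps)
  next
    case False
    then have "Suc n div p = n div p"
      by (simp add: div_Suc dvd_eq_mod_eq_0)
    moreover have "\<not> p dvd Suc n * u"
      using u(1) False assms prime_dvd_mult_nat by blast
    ultimately show ?thesis
      using u(2) by (intro exI[of _ "Suc n * u"]) (simp add: algebra_simps)
  qed
qed

text \<open>Descent on \<open>n\<close> with \<open>q = n div p\<close>: cancelling
  \<open>p ^ q\<close> and the part prime to \<open>p\<close> leaves \<open>p ^ (n - q)\<close>
  dividing \<open>fact q\<close>. As \<open>p \<ge> 2\<close>, \<open>q \<le> n - q\<close>, so
  \<open>p ^ q\<close> divides \<open>fact q\<close> and the induction hypothesis applies, unless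
  \<open>q = 0\<close>, where the divisibility is plainly absurd.\<close>

lemma prime_power_not_dvd_fact:
  assumes "prime (p::nat)" "n > 0"
  shows "\<not> p ^ n dvd fact n"
  using assms(2)
proof (induction n rule: less_induct)
  case (less n)
  obtain u where u: "\<not> p dvd u" "fact n = u * p ^ (n div p) * fact (n div p)"
    using fact_prime_part[OF assms(1)] by blast
  let ?q = "n div p"
  have p: "p \<ge> 2" using assms(1) prime_ge_2_nat by blast
  have q2: "2 * ?q \<le> n"
    using p by (metis div_times_less_eq_dividend mult_le_mono1 mult.commute order_trans)
  show ?case
  proof
    assume "p ^ n dvd fact n"
    moreover have "p ^ n = p ^ ?q * p ^ (n - ?q)"
      using q2 by (simp flip: power_add)
    ultimately have "p ^ ?q * p ^ (n - ?q) dvd p ^ ?q * (u * fact ?q)"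
      using u(2) by (simp add: ac_simps)
    then have "p ^ (n - ?q) dvd u * fact ?q"
      using p by simp
    moreover have "coprime (p ^ (n - ?q)) u"
      using u(1) assms(1) by (simp add: prime_imp_coprime)
    ultimately have d: "p ^ (n - ?q) dvd fact ?q"
      by (simp add: coprime_dvd_mult_right_iff)
    show False
    proof (cases "?q = 0")
      case True
      then have "p ^ n dvd 1" using d by simp
      then show False using less.prems p by simp
    next
      case False
      moreover have "p ^ ?q dvd p ^ (n - ?q)"
        using q2 by (intro le_imp_power_dvd) simp
      moreover have "?q < n" using False q2 by simp
      ultimately show False using less.IH[of ?q] d dvd_trans by blast
    qed
  qed
qed

text \<open>The elements of \<open>Bij E\<close> are undefined outside \<open>E\<close>, whereas
  permutations in the sense of \<open>permutes\<close> are the identity there; changing that default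
  value is a bijection.\<close>

lemma card_Bij: "finite E \<Longrightarrow> card (Bij E) = fact (card E)"
proof -
  assume fin: "finite E"
  have "bij_betw (\<lambda>p. restrict p E) {p. p permutes E} (Bij E)"
  proof (rule bij_betw_byWitness[where f' = "\<lambda>f x. if x \<in> E then f x else x"])
    show "\<forall>p\<in>{p. p permutes E}. (\<lambda>x. if x \<in> E then restrict p E x else x) = p"
      by (auto simp: permutes_def fun_eq_iff)
    show "\<forall>f\<in>Bij E. restrict (\<lambda>x. if x \<in> E then f x else x) E = f"
      by (auto simp: Bij_def extensional_def fun_eq_iff)
    show "(\<lambda>p. restrict p E) ` {p. p permutes E} \<subseteq> Bij E"
      by (auto simp: Bij_def permutes_imp_bij cong: bij_betw_cong)
    show "(\<lambda>f x. if x \<in> E then f x else x) ` Bij E \<subseteq> {p. p permutes E}"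
      by (auto simp: Bij_def cong: bij_betw_cong intro!: bij_imp_permutes)
  qed
  then show ?thesis
    using card_permutations[OF refl fin] bij_betw_same_card by metis
qed

lemma block_of_eqI: "partition_on X P \<Longrightarrow> B \<in> P \<Longrightarrow> x \<in> B \<Longrightarrow> block_of P x = B"
  unfolding block_of_def partition_on_def disjoint_def by (rule the_equality) blast+

lemma block_of_mem:
  assumes "partition_on X P" "x \<in> X"
  shows "block_of P x \<in> P" "x \<in> block_of P x"
proof -
  obtain B where "B \<in> P" "x \<in> B" using assms by (auto simp: partition_on_def)
  then show "block_of P x \<in> P" "x \<in> block_of P x"
    using block_of_eqI[OF assms(1)] by auto
qed

lemma point_stab_iff: "g \<in> point_stab \<Omega> H x \<longleftrightarrow> g \<in> H \<and> g x = x"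
  by (simp add: stabilizer_def)

lemma set_stab_iff: "g \<in> set_stab \<Omega> H B \<longleftrightarrow> g \<in> H \<and> g ` B = B"
  by (simp add: stabilizer_def)

lemma point_orbit_eq: "point_orbit \<Omega> H x = (\<lambda>g. g x) ` H"
  by (auto simp: orbit_def)

section \<open>Permutation groups inside \<open>BijGroup\<close>\<close>

locale perm_space =
  fixes \<Omega> :: "'a set" and S (structure)
  assumes S_def: "S = BijGroup \<Omega>"

sublocale perm_space \<subseteq> group S
  by (simp add: S_def group_BijGroup)

context perm_space
begin

lemma perm_closed: "g \<in> carrier S \<Longrightarrow> x \<in> \<Omega> \<Longrightarrow> g x \<in> \<Omega>"
  by (auto simp: S_def BijGroup_def Bij_def bij_betw_def)

lemma perm_mult: "g \<in> carrier S \<Longrightarrow> h \<in> carrier S \<Longrightarrow> x \<in> \<Omega> \<Longrightarrow> (g \<otimes> h) x = g (h x)"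
  by (simp add: S_def BijGroup_def compose_def)

lemma perm_one: "x \<in> \<Omega> \<Longrightarrow> \<one> x = x"
  by (simp add: S_def BijGroup_def)

lemma perm_inv_apply: "g \<in> carrier S \<Longrightarrow> x \<in> \<Omega> \<Longrightarrow> (inv g) (g x) = x"
  by (simp flip: perm_mult add: perm_one)

lemma perm_apply_inv: "g \<in> carrier S \<Longrightarrow> x \<in> \<Omega> \<Longrightarrow> g ((inv g) x) = x"
  by (simp flip: perm_mult add: perm_one)

lemma perm_image_closed: "g \<in> carrier S \<Longrightarrow> X \<subseteq> \<Omega> \<Longrightarrow> g ` X \<subseteq> \<Omega>"
  using perm_closed by blast

lemma perm_image_mult:
  "g \<in> carrier S \<Longrightarrow> h \<in> carrier S \<Longrightarrow> X \<subseteq> \<Omega> \<Longrightarrow> (g \<otimes> h) ` X = g ` (h ` X)"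
  unfolding image_image by (rule image_cong) (auto simp: perm_mult)

lemma perm_image_one: "X \<subseteq> \<Omega> \<Longrightarrow> \<one> ` X = X"
  by (auto simp: perm_one subset_iff image_iff)

lemma perm_image_inv:
  assumes "g \<in> carrier S" "X \<subseteq> \<Omega>"
  shows "(inv g) ` (g ` X) = X" "g ` ((inv g) ` X) = X"
  using assms by (simp_all flip: perm_image_mult add: perm_image_one)

lemma point_stab_subgroup:
  assumes H: "subgroup H S" and x: "x \<in> \<Omega>"
  shows "subgroup (point_stab \<Omega> H x) S"
proof (rule subgroupI)
  have car: "g \<in> carrier S" if "g \<in> H" for g using H that by (rule subgroup.mem_carrier)
  then show "point_stab \<Omega> H x \<subseteq> carrier S" by (auto simp: point_stab_iff)
  have "\<one> \<in> point_stab \<Omega> H x"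
    using H x by (simp add: point_stab_iff perm_one subgroup.one_closed)
  then show "point_stab \<Omega> H x \<noteq> {}" by blast
  show "inv g \<in> point_stab \<Omega> H x" if "g \<in> point_stab \<Omega> H x" for g
    using that H x perm_inv_apply[of g x] car by (simp add: point_stab_iff subgroup.m_inv_closed)
  show "g \<otimes> h \<in> point_stab \<Omega> H x" if "g \<in> point_stab \<Omega> H x" "h \<in> point_stab \<Omega> H x" for g h
    using that H x car by (simp add: point_stab_iff subgroup.m_closed perm_mult)
qed

lemma set_stab_subgroup:
  assumes H: "subgroup H S" and B: "B \<subseteq> \<Omega>"
  shows "subgroup (set_stab \<Omega> H B) S"
proof (rule subgroupI)
  have car: "g \<in> carrier S" if "g \<in> H" for g using H that by (rule subgroup.mem_carrier)
  then show "set_stab \<Omega> H B \<subseteq> carrier S" by (auto simp: set_stab_iff)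
  have "\<one> \<in> set_stab \<Omega> H B"
    using H B by (simp add: set_stab_iff perm_image_one subgroup.one_closed)
  then show "set_stab \<Omega> H B \<noteq> {}" by blast
  show "inv g \<in> set_stab \<Omega> H B" if "g \<in> set_stab \<Omega> H B" for g
    using that H B perm_image_inv(1)[of g B] car by (simp add: set_stab_iff subgroup.m_inv_closed)
  show "g \<otimes> h \<in> set_stab \<Omega> H B" if "g \<in> set_stab \<Omega> H B" "h \<in> set_stab \<Omega> H B" for g h
    using that H B car by (simp add: set_stab_iff subgroup.m_closed perm_image_mult)
qed

text \<open>An element fixes the image of \<open>B\<close> under \<open>g\<close> exactly if its
  conjugate by \<open>inv g\<close> fixes \<open>B\<close>. Here \<open>g\<close> need only
  normalise \<open>H\<close>, because the use is for \<open>H = M\<close> and \<open>g\<close> in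
  \<open>G\<close>.\<close>

lemma conj_set_set_stab:
  assumes "subgroup H S" "g \<in> carrier S" "conj_set S g H = H" "B \<subseteq> \<Omega>"
  shows "conj_set S g (set_stab \<Omega> H B) = set_stab \<Omega> H (g ` B)"
proof -
  have sub: "set_stab \<Omega> H B \<subseteq> carrier S" "H \<subseteq> carrier S"
    using assms set_stab_subgroup subgroup.subset by blast+
  have "x \<in> conj_set S g (set_stab \<Omega> H B) \<longleftrightarrow> x \<in> set_stab \<Omega> H (g ` B)"
    if x: "x \<in> carrier S" for x
  proof -
    have "inv g \<otimes> x \<otimes> g \<in> H \<longleftrightarrow> x \<in> H"
      using mem_conj_set_iff[OF assms(2) sub(2) x] assms(3) by simp
    moreover have "(inv g \<otimes> x \<otimes> g) ` B = (inv g) ` (x ` (g ` B))"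
      using x assms by (simp add: perm_image_mult perm_image_closed)
    moreover have "(inv g) ` (x ` (g ` B)) = B \<longleftrightarrow> x ` (g ` B) = g ` B"
      using x assms perm_image_inv perm_image_closed by metis
    ultimately show ?thesis
      unfolding mem_conj_set_iff[OF assms(2) sub(1) x] set_stab_iff by simp
  qed
  moreover have "set_stab \<Omega> H (g ` B) \<subseteq> carrier S" using sub(2) by (auto simp: set_stab_iff)
  ultimately show ?thesis using conj_set_closed[OF assms(2) sub(1)] by blast
qed

lemma conj_set_point_stab:
  assumes "subgroup H S" "g \<in> H" "x \<in> \<Omega>"
  shows "conj_set S g (point_stab \<Omega> H x) = point_stab \<Omega> H (g x)"
proof -
  have g: "g \<in> carrier S" using assms subgroup.mem_carrier by metis
  have "conj_set S g (set_stab \<Omega> H {x}) = set_stab \<Omega> H (g ` {x})"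
    using assms g by (intro conj_set_set_stab conj_set_self) auto
  moreover have "point_stab \<Omega> H y = set_stab \<Omega> H {y}" for y
    by (auto simp: set_stab_iff point_stab_iff)
  ultimately show ?thesis by simp
qed

end

section \<open>Blocks of a transitive group and subgroups above a point stabiliser\<close>

locale transitive_perm = perm_space +
  fixes M
  assumes M: "subgroup M S"
    and trans: "\<And>x y. x \<in> \<Omega> \<Longrightarrow> y \<in> \<Omega> \<Longrightarrow> \<exists>m\<in>M. m x = y"
begin

lemma M_car: "m \<in> M \<Longrightarrow> m \<in> carrier S"
  using M by (rule subgroup.mem_carrier)

lemma orbit_subset: "K \<subseteq> M \<Longrightarrow> \<omega> \<in> \<Omega> \<Longrightarrow> point_orbit \<Omega> K \<omega> \<subseteq> \<Omega>"
  using M_car perm_closed by (auto simp: point_orbit_eq)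

context
  fixes K \<omega>
  assumes K: "subgroup K S" "K \<subseteq> M" and \<omega>: "\<omega> \<in> \<Omega>" and stab: "point_stab \<Omega> M \<omega> \<subseteq> K"
begin

text \<open>Points correspond to cosets of the point stabiliser, and the translate by
  \<open>m\<close> of the \<open>K\<close>-orbit corresponds to the coset of \<open>m\<close> modulo
  \<open>K\<close>. This is well defined because \<open>K\<close> contains the stabiliser.\<close>

lemma mem_translate_orbit:
  assumes "m \<in> M" "m' \<in> M"
  shows "m' \<omega> \<in> m ` point_orbit \<Omega> K \<omega> \<longleftrightarrow> inv m \<otimes> m' \<in> K"
proof
  have car: "m \<in> carrier S" "m' \<in> carrier S" using assms M_car by auto
  assume "m' \<omega> \<in> m ` point_orbit \<Omega> K \<omega>"
  then obtain k where k: "k \<in> K" "m' \<omega> = m (k \<omega>)" by (auto simp: point_orbit_eq)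
  have kc: "k \<in> carrier S" using k K subgroup.mem_carrier by metis
  \<comment> \<open>Chosen to fix \<open>\<omega>\<close>: as an element of the stabiliser it lies
    in \<open>K\<close>, and hence so does \<open>k\<close> times it.\<close>
  let ?x = "inv k \<otimes> (inv m \<otimes> m')"
  have "?x \<in> M"
    using assms k K M by (auto intro!: subgroup.m_closed[OF M] subgroup.m_inv_closed[OF M])
  moreover have "?x \<omega> = \<omega>"
    using k(2) kc car \<omega> by (simp add: perm_mult perm_inv_apply perm_closed)
  ultimately have "?x \<in> K" using stab by (auto simp: point_stab_iff)
  then have "k \<otimes> ?x \<in> K" using K k subgroup.m_closed by metis
  then show "inv m \<otimes> m' \<in> K" using kc car by (simp flip: m_assoc)
next
  have car: "m \<in> carrier S" "m' \<in> carrier S" using assms M_car by auto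
  assume *: "inv m \<otimes> m' \<in> K"
  have "m' \<omega> = m ((inv m \<otimes> m') \<omega>)"
    using car \<omega> by (simp add: perm_mult perm_closed perm_apply_inv)
  then show "m' \<omega> \<in> m ` point_orbit \<Omega> K \<omega>" using * by (auto simp: point_orbit_eq)
qed

lemma translate_orbit_eq_iff:
  assumes "m \<in> M" "m' \<in> M"
  shows "m ` point_orbit \<Omega> K \<omega> = m' ` point_orbit \<Omega> K \<omega> \<longleftrightarrow> inv m \<otimes> m' \<in> K"
proof
  assume "m ` point_orbit \<Omega> K \<omega> = m' ` point_orbit \<Omega> K \<omega>"
  moreover have "m' \<omega> \<in> m' ` point_orbit \<Omega> K \<omega>"
    using mem_translate_orbit[of m' m'] assms K M_car by (simp add: subgroup.one_closed)
  ultimately show "inv m \<otimes> m' \<in> K" using mem_translate_orbit assms by metis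
next
  assume *: "inv m \<otimes> m' \<in> K"
  have iff: "n \<omega> \<in> m ` point_orbit \<Omega> K \<omega> \<longleftrightarrow> n \<omega> \<in> m' ` point_orbit \<Omega> K \<omega>" if n: "n \<in> M" for n
  proof -
    have car: "m \<in> carrier S" "m' \<in> carrier S" "n \<in> carrier S" using assms n M_car by auto
    have 1: "inv m \<otimes> n = (inv m \<otimes> m') \<otimes> (inv m' \<otimes> n)"
      using car by (simp add: m_assoc flip: m_assoc[of m' "inv m'"])
    have 2: "inv m' \<otimes> n = inv (inv m \<otimes> m') \<otimes> (inv m \<otimes> n)"
      using car by (simp add: inv_mult_group m_assoc flip: m_assoc[of m "inv m"])
    have "inv m \<otimes> n \<in> K \<longleftrightarrow> inv m' \<otimes> n \<in> K"
      using 1 2 * K(1) subgroup.m_closed subgroup.m_inv_closed by metis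
    then show ?thesis using mem_translate_orbit assms n by simp
  qed
  have sub: "m ` point_orbit \<Omega> K \<omega> \<subseteq> \<Omega>" "m' ` point_orbit \<Omega> K \<omega> \<subseteq> \<Omega>"
    using perm_image_closed[OF M_car orbit_subset] assms K \<omega> by auto
  have "x \<in> m ` point_orbit \<Omega> K \<omega> \<longleftrightarrow> x \<in> m' ` point_orbit \<Omega> K \<omega>" if "x \<in> \<Omega>" for x
    using trans[OF \<omega> that] iff by metis
  then show "m ` point_orbit \<Omega> K \<omega> = m' ` point_orbit \<Omega> K \<omega>" using sub by blast
qed

lemma orbit_in_translates: "point_orbit \<Omega> K \<omega> \<in> translates M (point_orbit \<Omega> K \<omega>)"
  using perm_image_one[OF orbit_subset[OF K(2) \<omega>]] subgroup.one_closed[OF M]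
  unfolding translates_def by fastforce

lemma mem_orbit_iff: "m \<in> M \<Longrightarrow> m \<omega> \<in> point_orbit \<Omega> K \<omega> \<longleftrightarrow> m \<in> K"
  using mem_translate_orbit[of \<one> m] perm_image_one[OF orbit_subset[OF K(2) \<omega>]] M M_car
  by (simp add: subgroup.one_closed)

lemma base_in_orbit: "\<omega> \<in> point_orbit \<Omega> K \<omega>"
  using mem_orbit_iff[of \<one>] M K(1) \<omega> by (simp add: subgroup.one_closed perm_one)

lemma translates_partition: "partition_on \<Omega> (translates M (point_orbit \<Omega> K \<omega>))"
proof (rule partition_onI)
  have sub: "m ` point_orbit \<Omega> K \<omega> \<subseteq> \<Omega>" if "m \<in> M" for m
    using perm_image_closed[OF M_car orbit_subset] that K \<omega> by auto
  have mem: "m \<omega> \<in> m ` point_orbit \<Omega> K \<omega>" if "m \<in> M" for m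
    using base_in_orbit by blast
  show "\<Union>(translates M (point_orbit \<Omega> K \<omega>)) = \<Omega>"
  proof (intro equalityI subsetI)
    show "x \<in> \<Omega>" if "x \<in> \<Union>(translates M (point_orbit \<Omega> K \<omega>))" for x
      using that sub unfolding translates_def by blast
    show "x \<in> \<Union>(translates M (point_orbit \<Omega> K \<omega>))" if x: "x \<in> \<Omega>" for x
    proof -
      obtain m where "m \<in> M" "m \<omega> = x" using trans[OF \<omega> x] by blast
      then show ?thesis using mem[of m] unfolding translates_def by blast
    qed
  qed
  show "{} \<notin> translates M (point_orbit \<Omega> K \<omega>)"
    using base_in_orbit unfolding translates_def by blast
  fix p q assume "p \<in> translates M (point_orbit \<Omega> K \<omega>)" "q \<in> translates M (point_orbit \<Omega> K \<omega>)"
    and "p \<noteq> q"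
  then obtain m n where mn: "m \<in> M" "n \<in> M" "p = m ` point_orbit \<Omega> K \<omega>" "q = n ` point_orbit \<Omega> K \<omega>"
    unfolding translates_def by blast
  have "p = q" if x: "x \<in> p" "x \<in> q" for x
  proof -
    have "x \<in> \<Omega>" using x(1) sub[OF mn(1)] mn(3) by blast
    then obtain l where l: "l \<in> M" "x = l \<omega>" using trans[OF \<omega>] by metis
    then show ?thesis
      using x mn mem_translate_orbit translate_orbit_eq_iff by metis
  qed
  then show "disjnt p q" using \<open>p \<noteq> q\<close> by (auto simp: disjnt_def)
qed

text \<open>A subgroup above the point stabiliser is recovered from its block, since translates
  coincide exactly when the cosets do.\<close>

lemma set_stab_orbit: "set_stab \<Omega> M (point_orbit \<Omega> K \<omega>) = K"
proof -
  have "m ` point_orbit \<Omega> K \<omega> = point_orbit \<Omega> K \<omega> \<longleftrightarrow> m \<in> K" if "m \<in> M" for m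
    using translate_orbit_eq_iff[of \<one> m] perm_image_one[OF orbit_subset[OF K(2) \<omega>]] M M_car that
    by (auto simp: subgroup.one_closed)
  then show ?thesis using K(2) by (auto simp: set_stab_iff)
qed

lemma block_of_base: "block_of (translates M (point_orbit \<Omega> K \<omega>)) \<omega> = point_orbit \<Omega> K \<omega>"
  by (rule block_of_eqI[OF translates_partition orbit_in_translates base_in_orbit])

end

section \<open>From Cartesian systems to Cartesian decompositions\<close>

context
  fixes \<K> \<omega>
  assumes system: "cartesian_system \<Omega> M \<omega> \<K>" and \<omega>: "\<omega> \<in> \<Omega>"
begin

lemma system_member:
  assumes "K \<in> \<K>"
  shows "subgroup K S" "K \<subseteq> M" "K \<noteq> M" "point_stab \<Omega> M \<omega> \<subseteq> K"
  using assms system subgroup_restrict_iff[OF M, of K] unfolding cartesian_system_def S_def by auto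

text \<open>A Chinese remainder argument: cosets of the members of the system, one for each, have a
  common element. The congruences are solved one at a time.\<close>

lemma system_solve:
  assumes "finite \<K>" "\<And>K. K \<in> \<K> \<Longrightarrow> r K \<in> M"
  shows "\<exists>m\<in>M. \<forall>K\<in>\<K>. inv (r K) \<otimes> m \<in> K"
proof -
  have "\<exists>m\<in>M. \<forall>K\<in>F. inv (r K) \<otimes> m \<in> K" if "finite F" "F \<subseteq> \<K>" for F
    using that
  proof induction
    case empty
    show ?case using subgroup.one_closed[OF M] by auto
  next
    case (insert K F)
    then obtain m where m: "m \<in> M" "\<forall>K\<in>F. inv (r K) \<otimes> m \<in> K" by auto
    have K: "K \<in> \<K>" using insert by simp
    have "inv (r K) \<otimes> m \<in> M"
      using m assms(2)[OF K] M by (simp add: subgroup.m_closed subgroup.m_inv_closed)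
    also have "M = K <#> (M \<inter> \<Inter>(\<K> - {K}))"
      using system K unfolding cartesian_system_def S_def by simp
    finally obtain k c where kc: "k \<in> K" "c \<in> M" "\<And>L. L \<in> \<K> - {K} \<Longrightarrow> c \<in> L" "inv (r K) \<otimes> m = k \<otimes> c"
      unfolding set_mult_def by blast
    have car: "r K \<in> carrier S" "m \<in> carrier S" "c \<in> carrier S" "k \<in> carrier S"
      using m kc assms(2)[OF K] M_car subgroup.mem_carrier[OF system_member(1)[OF K]] by auto
    \<comment> \<open>The correction \<open>inv c\<close> is made on the right: it settles the
      congruence for \<open>K\<close>, and since \<open>c\<close> lies in every other member it
      leaves the congruences already solved intact.\<close>
    have "inv (r K) \<otimes> (m \<otimes> inv c) = k"
      using kc(4) car by (simp add: m_assoc flip: m_assoc[of "inv (r K)"])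
    moreover have "inv (r L) \<otimes> (m \<otimes> inv c) \<in> L" if L: "L \<in> F" for L
    proof -
      have LK: "L \<in> \<K> - {K}" using L insert by auto
      then have "(inv (r L) \<otimes> m) \<otimes> inv c \<in> L"
        using m(2) L kc(3)[OF LK] system_member(1)[of L]
        by (simp add: subgroup.m_closed subgroup.m_inv_closed)
      then show ?thesis using car M_car[OF assms(2), of L] LK by (simp add: m_assoc)
    qed
    moreover have "m \<otimes> inv c \<in> M" using m kc M by (simp add: subgroup.m_closed subgroup.m_inv_closed)
    ultimately show ?case using kc(1) by auto
  qed
  then show ?thesis using assms(1) by blast
qed

text \<open>A choice of one block in each partition is a choice of one coset for each member. A
  common representative \<open>m\<close> turns the intersection of the blocks into the
  \<open>m\<close>-translate of the intersection of the orbits, which is one point because the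
  members intersect in the stabiliser.\<close>

lemma decomposition_of_system_cartesian:
  assumes "finite \<K>"
  shows "cartesian_decomposition \<Omega> (decomposition_of_system \<Omega> M \<omega> \<K>)"
proof -
  note mem = system_member
  let ?O = "\<lambda>K. point_orbit \<Omega> K \<omega>"
  have E: "decomposition_of_system \<Omega> M \<omega> \<K> = (\<lambda>K. translates M (?O K)) ` \<K>"
    unfolding decomposition_of_system_def by blast
  have ne: "\<K> \<noteq> {}" using system unfolding cartesian_system_def by blast
  have proper: "translates M (?O K) \<noteq> {\<Omega>}" if K: "K \<in> \<K>" for K
  proof
    assume "translates M (?O K) = {\<Omega>}"
    then have "?O K = \<Omega>"
      using orbit_in_translates[OF mem(1,2)[OF K] \<omega> mem(4)[OF K]] by simp
    then have "M \<subseteq> K"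
      using mem_orbit_iff[OF mem(1,2)[OF K] \<omega> mem(4)[OF K]] perm_closed[OF M_car \<omega>] by auto
    then show False using mem[OF K] by blast
  qed
  have "card (\<Inter>\<Gamma>\<in>decomposition_of_system \<Omega> M \<omega> \<K>. \<gamma> \<Gamma>) = 1"
    if \<gamma>: "\<forall>\<Gamma>\<in>decomposition_of_system \<Omega> M \<omega> \<K>. \<gamma> \<Gamma> \<in> \<Gamma>" for \<gamma>
  proof -
    have "\<forall>K\<in>\<K>. \<exists>m\<in>M. \<gamma> (translates M (?O K)) = m ` ?O K"
      using \<gamma> unfolding E translates_def by fastforce
    then obtain r where r: "\<And>K. K \<in> \<K> \<Longrightarrow> r K \<in> M"
        "\<And>K. K \<in> \<K> \<Longrightarrow> \<gamma> (translates M (?O K)) = r K ` ?O K"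
      by metis
    obtain m where m: "m \<in> M" "\<And>K. K \<in> \<K> \<Longrightarrow> inv (r K) \<otimes> m \<in> K"
      using system_solve[of r, OF assms r(1)] by blast
    \<comment> \<open>All chosen blocks are now translates by the same element.\<close>
    have eq: "r K ` ?O K = m ` ?O K" if K: "K \<in> \<K>" for K
      using translate_orbit_eq_iff[OF mem(1,2)[OF K] \<omega> mem(4)[OF K] r(1)[OF K] m(1)] m(2)[OF K] by simp
    have "(\<Inter>\<Gamma>\<in>decomposition_of_system \<Omega> M \<omega> \<K>. \<gamma> \<Gamma>) = (\<Inter>K\<in>\<K>. m ` ?O K)"
      unfolding E using r(2) eq by auto
    also have "\<dots> = {m \<omega>}"
    proof (intro equalityI subsetI)
      fix x assume x: "x \<in> (\<Inter>K\<in>\<K>. m ` ?O K)"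
      obtain K0 where K0: "K0 \<in> \<K>" using ne by blast
      then have "x \<in> \<Omega>"
        using x perm_image_closed[OF M_car[OF m(1)] orbit_subset[OF mem(2)[OF K0] \<omega>]] by blast
      then obtain n where n: "n \<in> M" "x = n \<omega>" using trans[OF \<omega>] by metis
      have "inv m \<otimes> n \<in> K" if K: "K \<in> \<K>" for K
        using mem_translate_orbit[OF mem(1,2)[OF K] \<omega> mem(4)[OF K] m(1) n(1)] x n(2) K by blast
      then have "inv m \<otimes> n \<in> \<Inter>\<K>" by blast
      then have "(inv m \<otimes> n) \<omega> = \<omega>"
        using system unfolding cartesian_system_def by (simp add: point_stab_iff)
      then have "m ((inv m \<otimes> n) \<omega>) = m \<omega>" by simp
      then show "x \<in> {m \<omega>}"
        using n m M_car \<omega> by (simp add: perm_mult perm_closed perm_apply_inv)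
    next
      fix x assume "x \<in> {m \<omega>}"
      then show "x \<in> (\<Inter>K\<in>\<K>. m ` ?O K)"
        using base_in_orbit[OF mem(1,2) \<omega> mem(4)] by auto
    qed
    finally show ?thesis by simp
  qed
  then show ?thesis
    unfolding cartesian_decomposition_def
    using ne proper translates_partition[OF mem(1,2) \<omega> mem(4)] by (auto simp: E)
qed

text \<open>Each partition has the orbit of its subgroup as its block at \<open>\<omega>\<close>,
  and the stabiliser of that block is the subgroup again. The projections of the decomposition of
  the quotient are computed through this.\<close>

lemma system_of_decomposition_of_system:
  "system_of_decomposition \<Omega> M \<omega> (decomposition_of_system \<Omega> M \<omega> \<K>) = \<K>"
proof -
  note mem = system_member
  have "\<gamma> = point_orbit \<Omega> K \<omega>"
    if "K \<in> \<K>" "\<gamma> \<in> translates M (point_orbit \<Omega> K \<omega>)" "\<omega> \<in> \<gamma>" for K \<gamma>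
    using block_of_base[OF mem(1,2)[OF that(1)] \<omega> mem(4)[OF that(1)]]
      block_of_eqI[OF translates_partition[OF mem(1,2)[OF that(1)] \<omega> mem(4)[OF that(1)]] that(2,3)]
    by simp
  then have K: "K = set_stab \<Omega> M \<gamma>"
    if "K \<in> \<K>" "\<gamma> \<in> translates M (point_orbit \<Omega> K \<omega>)" "\<omega> \<in> \<gamma>" for K \<gamma>
    using set_stab_orbit[OF mem(1,2)[OF that(1)] \<omega> mem(4)[OF that(1)]] that by blast
  show ?thesis
  proof (intro equalityI subsetI)
    fix L assume "L \<in> system_of_decomposition \<Omega> M \<omega> (decomposition_of_system \<Omega> M \<omega> \<K>)"
    then obtain \<gamma> K where "L = set_stab \<Omega> M \<gamma>" "K \<in> \<K>"
        "\<gamma> \<in> translates M (point_orbit \<Omega> K \<omega>)" "\<omega> \<in> \<gamma>"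
      unfolding system_of_decomposition_def decomposition_of_system_def by auto
    then show "L \<in> \<K>" using K by metis
  next
    fix K assume K': "K \<in> \<K>"
    note mem' = mem(1,2)[OF K'] \<omega> mem(4)[OF K']
    show "K \<in> system_of_decomposition \<Omega> M \<omega> (decomposition_of_system \<Omega> M \<omega> \<K>)"
      unfolding system_of_decomposition_def decomposition_of_system_def mem_Collect_eq
      using K' set_stab_orbit[OF mem'] orbit_in_translates[OF mem'] base_in_orbit[OF mem']
      by (intro exI[of _ "point_orbit \<Omega> K \<omega>"] exI[of _ "translates M (point_orbit \<Omega> K \<omega>)"]) auto
  qed
qed

end

end

section \<open>Innately transitive groups\<close>

lemma card_1_mem_eq: "card A = 1 \<Longrightarrow> x \<in> A \<Longrightarrow> y \<in> A \<Longrightarrow> x = y"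
  by (auto simp: card_1_singleton_iff)

locale innately_transitive = perm_space +
  fixes G M
  assumes finite_space: "finite \<Omega>" and G: "subgroup G S" and plinth: "plinth \<Omega> G M"
begin

lemma G_car: "g \<in> G \<Longrightarrow> g \<in> carrier S"
  using G by (rule subgroup.mem_carrier)

lemma plinth_facts:
  shows plinth_subgroup: "subgroup M S" and plinth_subset: "M \<subseteq> G"
    and plinth_conj: "\<And>g m. g \<in> G \<Longrightarrow> m \<in> M \<Longrightarrow> g \<otimes> m \<otimes> inv g \<in> M"
    and plinth_nontrivial: "M \<noteq> {\<one>}"
  using plinth normal_restrict_iff[OF G, of M] unfolding plinth_def minimal_normal_def S_def by auto

lemma plinth_minimal:
  assumes "subgroup N S" "N \<subseteq> M" "\<And>g n. g \<in> G \<Longrightarrow> n \<in> N \<Longrightarrow> g \<otimes> n \<otimes> inv g \<in> N"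
  shows "N = {\<one>} \<or> N = M"
proof -
  have "N \<lhd> S\<lparr>carrier := G\<rparr>"
    unfolding normal_restrict_iff[OF G] using assms plinth_subset by blast
  then show ?thesis
    using plinth assms(2) unfolding plinth_def minimal_normal_def S_def by simp
qed

lemma plinth_transitive: "transitive_action (perm_grp \<Omega> M) \<Omega> (\<lambda>g. g)"
  using plinth unfolding plinth_def by blast

end

sublocale innately_transitive \<subseteq> transitive_perm \<Omega> S M
proof (intro transitive_perm.intro transitive_perm_axioms.intro perm_space_axioms)
qed (use plinth_subgroup transitive_action.unique_orbit[OF plinth_transitive] in auto)

context innately_transitive
begin

lemma conj_set_plinth: "g \<in> G \<Longrightarrow> conj_set S g M = M"
  using conj_set_invariant[OF G _ plinth_conj] M_car by blast

text \<open>Frattini argument: the transitive \<open>M\<close> contains an element that agrees with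
  \<open>g\<close> at \<open>\<omega>\<close>, and the quotient of the two fixes
  \<open>\<omega>\<close>.\<close>

lemma plinth_stab_split:
  assumes "g \<in> G" "\<omega> \<in> \<Omega>"
  shows "\<exists>m\<in>M. \<exists>h\<in>point_stab \<Omega> G \<omega>. g = m \<otimes> h"
proof -
  obtain m where m: "m \<in> M" "m \<omega> = g \<omega>"
    using trans[OF assms(2) perm_closed[OF G_car assms(2)]] assms by blast
  have car: "m \<in> carrier S" "g \<in> carrier S" using m assms M_car G_car by auto
  have "inv m \<otimes> g \<in> point_stab \<Omega> G \<omega>"
    using m assms car plinth_subset perm_inv_apply[of m \<omega>] subgroup.m_closed[OF G] subgroup.m_inv_closed[OF G]
    by (auto simp: point_stab_iff perm_mult)
  moreover have "g = m \<otimes> (inv m \<otimes> g)" using car by (simp flip: m_assoc)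
  ultimately show ?thesis using m by blast
qed

lemma image_orbit:
  assumes "h \<in> point_stab \<Omega> G \<omega>" "\<omega> \<in> \<Omega>" "K \<subseteq> M"
  shows "h ` point_orbit \<Omega> K \<omega> = point_orbit \<Omega> (conj_set S h K) \<omega>"
proof -
  have h: "h \<in> carrier S" "h \<omega> = \<omega>" using assms G_car by (auto simp: point_stab_iff)
  have "(inv h) \<omega> = \<omega>" using perm_inv_apply[OF h(1) assms(2)] h(2) by simp
  then have "(h \<otimes> k \<otimes> inv h) \<omega> = h (k \<omega>)" if "k \<in> K" for k
    using that assms M_car[of k] h(1) by (auto simp: perm_mult perm_closed)
  then show ?thesis
    unfolding point_orbit_eq conj_set_image image_image by (intro image_cong) auto
qed

text \<open>The translate by \<open>n\<close> is moved to the translate by \<open>m\<close> times a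
  conjugate of \<open>n\<close>, now of the orbit of the conjugated subgroup. The factor
  \<open>m\<close> only reindexes the translates, so the effect on the partition depends on
  \<open>h\<close> alone.\<close>

lemma image_translates:
  assumes "h \<in> point_stab \<Omega> G \<omega>" "\<omega> \<in> \<Omega>" "K \<subseteq> M" "m \<in> M"
  shows "(\<lambda>\<gamma>. (m \<otimes> h) ` \<gamma>) ` translates M (point_orbit \<Omega> K \<omega>) =
    translates M (point_orbit \<Omega> (conj_set S h K) \<omega>)"
proof -
  let ?O = "point_orbit \<Omega> K \<omega>"
  have hG: "h \<in> G" and h: "h \<in> carrier S" using assms G_car by (auto simp: point_stab_iff)
  have m: "m \<in> carrier S" using assms M_car by blast
  have O: "?O \<subseteq> \<Omega>" using orbit_subset assms by blast
  have key: "(m \<otimes> h) ` (n ` ?O) = (m \<otimes> (h \<otimes> n \<otimes> inv h)) ` (h ` ?O)" if n: "n \<in> M" for n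
  proof -
    have "m \<otimes> (h \<otimes> n \<otimes> inv h) \<otimes> h = m \<otimes> h \<otimes> n"
      using m h n M_car by (simp add: m_assoc)
    then show ?thesis
      using m h n M_car O by (metis perm_image_mult m_closed inv_closed)
  qed
  \<comment> \<open>As \<open>h\<close> normalises \<open>M\<close> and \<open>m\<close> lies in it,
    the new index runs over all of \<open>M\<close>.\<close>
  have surj: "(\<lambda>n. m \<otimes> (h \<otimes> n \<otimes> inv h)) ` M = M"
  proof -
    have "(\<lambda>n. m \<otimes> (h \<otimes> n \<otimes> inv h)) ` M = (\<lambda>n. m \<otimes> n) ` (conj_set S h M)"
      unfolding conj_set_image image_image ..
    also have "\<dots> = (\<lambda>n. m \<otimes> n) ` M" using conj_set_plinth[OF hG] by simp
    also have "\<dots> = M"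
    proof (intro equalityI subsetI)
      show "x \<in> M" if "x \<in> (\<lambda>n. m \<otimes> n) ` M" for x
        using that assms(4) subgroup.m_closed[OF M] by blast
      show "x \<in> (\<lambda>n. m \<otimes> n) ` M" if "x \<in> M" for x
      proof
        show "x = m \<otimes> (inv m \<otimes> x)" using m that M_car by (simp flip: m_assoc)
        show "inv m \<otimes> x \<in> M"
          using assms(4) that subgroup.m_closed[OF M] subgroup.m_inv_closed[OF M] by blast
      qed
    qed
    finally show ?thesis .
  qed
  have "(\<lambda>\<gamma>. (m \<otimes> h) ` \<gamma>) ` translates M ?O = (\<lambda>n. (m \<otimes> h) ` (n ` ?O)) ` M"
    unfolding translates_def by blast
  also have "\<dots> = (\<lambda>n. (m \<otimes> (h \<otimes> n \<otimes> inv h)) ` (h ` ?O)) ` M"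
    using key by (rule image_cong[OF refl])
  also have "\<dots> = (\<lambda>n. n ` (h ` ?O)) ` ((\<lambda>n. m \<otimes> (h \<otimes> n \<otimes> inv h)) ` M)"
    unfolding image_image ..
  also have "\<dots> = translates M (h ` ?O)"
    unfolding surj translates_def by blast
  finally show ?thesis using image_orbit[OF assms(1-3)] by simp
qed

lemma partition_image_mult:
  assumes "g \<in> carrier S" "h \<in> carrier S" "\<Gamma> \<subseteq> Pow \<Omega>"
  shows "(\<lambda>\<gamma>. (g \<otimes> h) ` \<gamma>) ` \<Gamma> = (\<lambda>\<gamma>. g ` \<gamma>) ` (\<lambda>\<gamma>. h ` \<gamma>) ` \<Gamma>"
  unfolding image_image[of "\<lambda>\<gamma>. g ` \<gamma>"]
  by (rule image_cong[OF refl], rule perm_image_mult) (use assms in auto)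

lemma partition_image_one: "\<Gamma> \<subseteq> Pow \<Omega> \<Longrightarrow> (\<lambda>\<gamma>. \<one> ` \<gamma>) ` \<Gamma> = \<Gamma>"
  using perm_image_one by (simp add: subset_iff)

text \<open>By \<open>plinth_stab_split\<close> and \<open>image_translates\<close>, the action of
  \<open>G\<close> on the partitions is the conjugation action of the point stabiliser on the
  system.\<close>

lemma decomposition_of_system_CD_tr:
  assumes system: "cartesian_system \<Omega> M \<omega> \<K>" and \<omega>: "\<omega> \<in> \<Omega>" and fin: "finite \<K>"
    and invariant: "\<And>h K. h \<in> point_stab \<Omega> G \<omega> \<Longrightarrow> K \<in> \<K> \<Longrightarrow> conj_set S h K \<in> \<K>"
    and transitive: "\<And>K L. K \<in> \<K> \<Longrightarrow> L \<in> \<K> \<Longrightarrow> \<exists>h\<in>point_stab \<Omega> G \<omega>. conj_set S h K = L"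
  shows "decomposition_of_system \<Omega> M \<omega> \<K> \<in> CD_tr \<Omega> G"
proof -
  note mem = system_member[OF system \<omega>]
  let ?t = "\<lambda>K. translates M (point_orbit \<Omega> K \<omega>)"
  let ?E = "decomposition_of_system \<Omega> M \<omega> \<K>"
  have E: "?E = ?t ` \<K>"
    unfolding decomposition_of_system_def by blast
  have Pow: "\<Gamma> \<subseteq> Pow \<Omega>" if \<Gamma>: "\<Gamma> \<in> ?E" for \<Gamma>
  proof -
    obtain K where K: "K \<in> \<K>" "\<Gamma> = ?t K" using \<Gamma> E by blast
    show ?thesis
      using partition_onD1[OF translates_partition[OF mem(1,2)[OF K(1)] \<omega> mem(4)[OF K(1)]]] K(2) by blast
  qed
  have "transitive_action (S\<lparr>carrier := G\<rparr>) ?E (\<lambda>g. \<lambda>\<Gamma>\<in>?E. (\<lambda>\<gamma>. g ` \<gamma>) ` \<Gamma>)"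
  proof (rule transitive_actionI[OF G])
    fix g \<Gamma> assume g: "g \<in> G" and \<Gamma>: "\<Gamma> \<in> ?E"
    obtain K where K: "K \<in> \<K>" "\<Gamma> = ?t K" using \<Gamma> E by blast
    obtain m h where "m \<in> M" "h \<in> point_stab \<Omega> G \<omega>" "g = m \<otimes> h"
      using plinth_stab_split[OF g \<omega>] by blast
    then show "(\<lambda>\<gamma>. g ` \<gamma>) ` \<Gamma> \<in> ?E"
      using image_translates[of h \<omega> K m] \<omega> K mem(2) invariant E by auto
  next
    show "(\<lambda>\<gamma>. \<one> ` \<gamma>) ` \<Gamma> = \<Gamma>" if "\<Gamma> \<in> ?E" for \<Gamma>
      by (rule partition_image_one[OF Pow[OF that]])
    show "(\<lambda>\<gamma>. (g \<otimes> h) ` \<gamma>) ` \<Gamma> = (\<lambda>\<gamma>. g ` \<gamma>) ` (\<lambda>\<gamma>. h ` \<gamma>) ` \<Gamma>"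
      if "g \<in> G" "h \<in> G" "\<Gamma> \<in> ?E" for g h \<Gamma>
      by (rule partition_image_mult[OF G_car[OF that(1)] G_car[OF that(2)] Pow[OF that(3)]])
  next
    fix \<Gamma> \<Delta> assume \<Gamma>: "\<Gamma> \<in> ?E" and \<Delta>: "\<Delta> \<in> ?E"
    obtain K where K: "K \<in> \<K>" "\<Gamma> = ?t K" using \<Gamma> unfolding E by (rule imageE)
    obtain L where L: "L \<in> \<K>" "\<Delta> = ?t L" using \<Delta> unfolding E by (rule imageE)
    obtain h where h: "h \<in> point_stab \<Omega> G \<omega>" "conj_set S h K = L"
      using transitive[OF K(1) L(1)] by (rule bexE)
    then have hG: "h \<in> G" "\<one> \<otimes> h = h" using G_car by (auto simp: point_stab_iff)
    have "(\<lambda>\<gamma>. h ` \<gamma>) ` \<Gamma> = \<Delta>"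
      using image_translates[OF h(1) \<omega> mem(2)[OF K(1)] subgroup.one_closed[OF M]]
      unfolding hG(2) K(2) L(2) h(2) .
    then show "\<exists>g\<in>G. (\<lambda>\<gamma>. g ` \<gamma>) ` \<Gamma> = \<Delta>" using hG(1) by (rule bexI)
  qed
  then show ?thesis
    using decomposition_of_system_cartesian[OF system \<omega> fin] unfolding CD_tr_def S_def by simp
qed

section \<open>From Cartesian decompositions to Cartesian systems\<close>

context
  fixes E
  assumes E: "E \<in> CD_tr \<Omega> G" and nonempty: "\<Omega> \<noteq> {}"
begin

lemma CD_partition:
  assumes "\<Gamma> \<in> E"
  shows "partition_on \<Omega> \<Gamma>" "\<Gamma> \<subseteq> Pow \<Omega>" "\<Gamma> \<noteq> {\<Omega>}"
proof -
  show p: "partition_on \<Omega> \<Gamma>" and "\<Gamma> \<noteq> {\<Omega>}"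
    using E assms by (simp_all add: CD_tr_def cartesian_decomposition_def)
  show "\<Gamma> \<subseteq> Pow \<Omega>" using partition_onD1[OF p] by blast
qed

lemma CD_nonempty: "E \<noteq> {}"
  using E by (simp add: CD_tr_def cartesian_decomposition_def)

lemma CD_card: "(\<And>\<Gamma>. \<Gamma> \<in> E \<Longrightarrow> \<gamma> \<Gamma> \<in> \<Gamma>) \<Longrightarrow> card (\<Inter>\<Gamma>\<in>E. \<gamma> \<Gamma>) = 1"
  using E by (simp add: CD_tr_def cartesian_decomposition_def)

lemma CD_finite: "finite E"
proof (rule finite_subset)
  show "E \<subseteq> Pow (Pow \<Omega>)" using CD_partition by blast
qed (use finite_space in simp)

lemma CD_transitive: "transitive_action (S\<lparr>carrier := G\<rparr>) E (\<lambda>g. \<lambda>\<Gamma>\<in>E. (\<lambda>\<gamma>. g ` \<gamma>) ` \<Gamma>)"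
  using E unfolding CD_tr_def S_def by blast

lemma CD_image:
  assumes "g \<in> G" "\<Gamma> \<in> E"
  shows "(\<lambda>\<gamma>. g ` \<gamma>) ` \<Gamma> \<in> E"
  using group_action.element_image[OF transitive_action.axioms(1)[OF CD_transitive], of g \<Gamma>] assms by simp

lemma CD_unique_orbit:
  assumes "\<Gamma> \<in> E" "\<Delta> \<in> E"
  shows "\<exists>g\<in>G. (\<lambda>\<gamma>. g ` \<gamma>) ` \<Gamma> = \<Delta>"
  using transitive_action.unique_orbit[OF CD_transitive assms] assms by auto

lemma card_block_set_ge_2:
  assumes "\<Gamma> \<in> E"
  shows "card \<Gamma> \<ge> 2"
proof -
  have fin: "finite \<Gamma>" using finite_subset[OF CD_partition(2)[OF assms]] finite_space by simp
  have "card \<Gamma> \<noteq> 0"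
    using fin CD_partition(1)[OF assms] nonempty by (auto simp: partition_on_def)
  moreover have "card \<Gamma> \<noteq> 1"
  proof
    assume "card \<Gamma> = 1"
    then obtain B where "\<Gamma> = {B}" by (auto simp: card_1_singleton_iff)
    then show False using CD_partition[OF assms] by (auto simp: partition_on_def)
  qed
  ultimately show ?thesis by linarith
qed

lemma card_block_set_eq:
  assumes "\<Gamma> \<in> E" "\<Delta> \<in> E"
  shows "card \<Gamma> = card \<Delta>"
proof -
  obtain g where g: "g \<in> G" "(\<lambda>\<gamma>. g ` \<gamma>) ` \<Gamma> = \<Delta>" using CD_unique_orbit[OF assms] by blast
  have "inj_on (\<lambda>\<gamma>. g ` \<gamma>) \<Gamma>"
    by (rule inj_onI) (metis CD_partition(2)[OF assms(1)] G_car PowD g(1) perm_image_inv(1) subsetD)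
  then show ?thesis using card_image g(2) by metis
qed

text \<open>The blocks containing a point serve as its coordinates: the defining property of a
  Cartesian decomposition says that every choice of one block from each partition belongs to exactly
  one point.\<close>

lemma card_space_eq_prod: "card \<Omega> = (\<Prod>\<Gamma>\<in>E. card \<Gamma>)"
proof -
  have "bij_betw (\<lambda>x. \<lambda>\<Gamma>\<in>E. block_of \<Gamma> x) \<Omega> (PiE E (\<lambda>\<Gamma>. \<Gamma>))"
    unfolding bij_betw_def
  proof
    show "inj_on (\<lambda>x. \<lambda>\<Gamma>\<in>E. block_of \<Gamma> x) \<Omega>"
    proof (rule inj_onI)
      fix x y assume xy: "x \<in> \<Omega>" "y \<in> \<Omega>" "(\<lambda>\<Gamma>\<in>E. block_of \<Gamma> x) = (\<lambda>\<Gamma>\<in>E. block_of \<Gamma> y)"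
      have "block_of \<Gamma> x = block_of \<Gamma> y" if "\<Gamma> \<in> E" for \<Gamma>
        using fun_cong[OF xy(3), of \<Gamma>] that by simp
      then have inter: "x \<in> (\<Inter>\<Gamma>\<in>E. block_of \<Gamma> x)" "y \<in> (\<Inter>\<Gamma>\<in>E. block_of \<Gamma> x)"
        using block_of_mem(2)[OF CD_partition(1) xy(1)] block_of_mem(2)[OF CD_partition(1) xy(2)] by auto
      have "card (\<Inter>\<Gamma>\<in>E. block_of \<Gamma> x) = 1"
        by (rule CD_card) (rule block_of_mem(1)[OF CD_partition(1) xy(1)])
      then show "x = y" using inter by (rule card_1_mem_eq)
    qed
    show "(\<lambda>x. \<lambda>\<Gamma>\<in>E. block_of \<Gamma> x) ` \<Omega> = PiE E (\<lambda>\<Gamma>. \<Gamma>)"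
    proof (intro equalityI subsetI)
      show "f \<in> PiE E (\<lambda>\<Gamma>. \<Gamma>)" if "f \<in> (\<lambda>x. \<lambda>\<Gamma>\<in>E. block_of \<Gamma> x) ` \<Omega>" for f
        using that block_of_mem[OF CD_partition(1)] by auto
      fix f assume f: "f \<in> PiE E (\<lambda>\<Gamma>. \<Gamma>)"
      then have "card (\<Inter>\<Gamma>\<in>E. f \<Gamma>) = 1" by (intro CD_card) auto
      then obtain x where x: "(\<Inter>\<Gamma>\<in>E. f \<Gamma>) = {x}" by (auto simp: card_1_singleton_iff)
      then have xf: "x \<in> f \<Gamma>" "f \<Gamma> \<in> \<Gamma>" if "\<Gamma> \<in> E" for \<Gamma> using f that by auto
      have "block_of \<Gamma> x = f \<Gamma>" if "\<Gamma> \<in> E" for \<Gamma>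
        by (rule block_of_eqI[OF CD_partition(1)[OF that] xf(2)[OF that] xf(1)[OF that]])
      then have "f = (\<lambda>\<Gamma>\<in>E. block_of \<Gamma> x)"
        using f by (intro ext) (simp add: PiE_def extensional_def)
      moreover have "x \<in> \<Omega>"
        using xf CD_nonempty CD_partition(2) by blast
      ultimately show "f \<in> (\<lambda>x. \<lambda>\<Gamma>\<in>E. block_of \<Gamma> x) ` \<Omega>" by blast
    qed
  qed
  then show ?thesis
    using bij_betw_same_card card_PiE[OF CD_finite, of "\<lambda>\<Gamma>. \<Gamma>"] by metis
qed

text \<open>Orbit-stabiliser for the transitive plinth. With a faithful action on the partitions,
  this would make \<open>card \<Omega>\<close> divide \<open>fact (card E)\<close>.\<close>

lemma card_space_dvd_card_plinth: "card \<Omega> dvd card M"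
proof -
  interpret A: transitive_action "perm_grp \<Omega> M" \<Omega> "\<lambda>g. g" by (rule plinth_transitive)
  obtain \<omega> where \<omega>: "\<omega> \<in> \<Omega>" using nonempty by blast
  have "point_orbit \<Omega> M \<omega> = \<Omega>"
    using trans[OF \<omega>] perm_closed[OF M_car \<omega>] by (auto simp: point_orbit_eq image_iff)
  then show ?thesis
    using A.orbit_stabilizer_theorem[OF \<omega>] dvd_triv_left[of "card \<Omega>" "card (point_stab \<Omega> M \<omega>)"]
    by (simp add: order_def)
qed

text \<open>If the plinth did not fix every partition, it would act faithfully on \<open>E\<close> by minimality.  With
  \<open>l\<close> the number of partitions and \<open>n\<close> their common size, \<open>n ^ l\<close> divides the order of the plinth
  and hence \<open>fact l\<close>, which no prime divisor of \<open>n\<close> allows.\<close>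

lemma plinth_fixes_partitions:
  assumes "m \<in> M" "\<Gamma> \<in> E"
  shows "(\<lambda>\<gamma>. m ` \<gamma>) ` \<Gamma> = \<Gamma>"
proof -
  let ?a = "\<lambda>g \<Gamma>. (\<lambda>\<gamma>. g ` \<gamma>) ` \<Gamma>"
  define N where "N = {m \<in> M. \<forall>\<Gamma>\<in>E. ?a m \<Gamma> = \<Gamma>}"
  have mult: "?a (g \<otimes> h) \<Gamma> = ?a g (?a h \<Gamma>)" if "g \<in> G" "h \<in> G" "\<Gamma> \<in> E" for g h \<Gamma>
    by (rule partition_image_mult[OF G_car[OF that(1)] G_car[OF that(2)] CD_partition(2)[OF that(3)]])
  have one: "?a \<one> \<Gamma> = \<Gamma>" if "\<Gamma> \<in> E" for \<Gamma>
    by (rule partition_image_one[OF CD_partition(2)[OF that]])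
  have inv: "?a (inv g) (?a g \<Gamma>) = \<Gamma>" "?a g (?a (inv g) \<Gamma>) = \<Gamma>" if "g \<in> G" "\<Gamma> \<in> E" for g \<Gamma>
    using mult[of "inv g" g \<Gamma>] mult[of g "inv g" \<Gamma>] one[of \<Gamma>] that G_car subgroup.m_inv_closed[OF G]
    by auto
  have NM: "N \<subseteq> M" by (auto simp: N_def)
  have N: "subgroup N S"
  proof (rule subgroupI)
    show "N \<subseteq> carrier S" using NM M_car by blast
    have "\<one> \<in> N" using one subgroup.one_closed[OF M] by (simp add: N_def)
    then show "N \<noteq> {}" by blast
    show "inv x \<in> N" if "x \<in> N" for x
    proof -
      have x: "x \<in> M" "x \<in> G" using that plinth_subset by (auto simp: N_def)
      have "?a (inv x) \<Gamma> = \<Gamma>" if "\<Gamma> \<in> E" for \<Gamma>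
        using inv(1)[OF x(2) that] \<open>x \<in> N\<close> that by (simp add: N_def)
      then show ?thesis using x subgroup.m_inv_closed[OF M] by (simp add: N_def)
    qed
    show "x \<otimes> y \<in> N" if "x \<in> N" "y \<in> N" for x y
      using that mult plinth_subset subgroup.m_closed[OF M] by (auto simp: N_def subset_iff)
  qed
  have "N = {\<one>} \<or> N = M"
  proof (rule plinth_minimal[OF N NM])
    fix g n assume g: "g \<in> G" and n: "n \<in> N"
    have nG: "n \<in> G" and nM: "n \<in> M" using n NM plinth_subset by auto
    have ig: "inv g \<in> G" using g subgroup.m_inv_closed[OF G] by blast
    \<comment> \<open>The kernel is normal in \<open>G\<close> because \<open>inv g\<close> carries
      \<open>\<Gamma>\<close> to another member of \<open>E\<close>, and \<open>n\<close> fixes that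
      one too.\<close>
    have "?a (g \<otimes> n \<otimes> inv g) \<Gamma> = \<Gamma>" if \<Gamma>: "\<Gamma> \<in> E" for \<Gamma>
    proof -
      have "?a (g \<otimes> n \<otimes> inv g) \<Gamma> = ?a g (?a n (?a (inv g) \<Gamma>))"
        using mult[of "g \<otimes> n" "inv g" \<Gamma>] mult[of g n "?a (inv g) \<Gamma>"] g nG ig \<Gamma> CD_image[OF ig \<Gamma>]
          subgroup.m_closed[OF G] by simp
      also have "?a n (?a (inv g) \<Gamma>) = ?a (inv g) \<Gamma>"
        using n CD_image[OF ig \<Gamma>] by (simp add: N_def)
      finally show ?thesis using inv(2)[OF g \<Gamma>] by simp
    qed
    then show "g \<otimes> n \<otimes> inv g \<in> N" using plinth_conj[OF g nM] by (simp add: N_def)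
  qed
  moreover have "N \<noteq> {\<one>}"
  proof
    assume N1: "N = {\<one>}"
    define \<rho> where "\<rho> = (\<lambda>g :: 'a \<Rightarrow> 'a. \<lambda>\<Gamma>\<in>E. ?a g \<Gamma>)"
    have "group_action (S\<lparr>carrier := M\<rparr>) E \<rho>"
      unfolding \<rho>_def
    proof (rule group_actionI[OF M])
      show "?a g \<Gamma> \<in> E" if "g \<in> M" "\<Gamma> \<in> E" for g \<Gamma>
        using CD_image plinth_subset that by blast
      show "?a \<one> \<Gamma> = \<Gamma>" if "\<Gamma> \<in> E" for \<Gamma>
        by (rule one[OF that])
      show "?a (g \<otimes> h) \<Gamma> = ?a g (?a h \<Gamma>)" if "g \<in> M" "h \<in> M" "\<Gamma> \<in> E" for g h \<Gamma>
        by (rule mult) (use that plinth_subset in auto)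
    qed
    then have hom: "group_hom (S\<lparr>carrier := M\<rparr>) (BijGroup E) \<rho>"
      by (simp add: group_action_def)
    have "inj_on \<rho> M"
    proof (rule inj_onI)
      fix x y assume xy: "x \<in> M" "y \<in> M" "\<rho> x = \<rho> y"
      have ix: "inv x \<in> G" "x \<in> G" "y \<in> G"
        using xy plinth_subset subgroup.m_inv_closed[OF M] by auto
      have "?a (inv x \<otimes> y) \<Gamma> = \<Gamma>" if "\<Gamma> \<in> E" for \<Gamma>
        using fun_cong[OF xy(3), of \<Gamma>] mult[OF ix(1,3) that] inv(1)[OF ix(2) that] that
        by (simp add: \<rho>_def)
      then have "inv x \<otimes> y \<in> N"
        using xy subgroup.m_closed[OF M] subgroup.m_inv_closed[OF M] by (simp add: N_def)
      then have "inv x \<otimes> y = \<one>" using N1 by blast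
      then have "x \<otimes> (inv x \<otimes> y) = x \<otimes> \<one>" by simp
      then show "x = y" using xy M_car by (simp flip: m_assoc)
    qed
    then have "card (\<rho> ` M) = card M" by (rule card_image)
    moreover have "subgroup (\<rho> ` M) (BijGroup E)"
      using group_hom.img_is_subgroup[OF hom] by simp
    then have "card (\<rho> ` M) dvd order (BijGroup E)"
      by (metis dvd_triv_right group.lagrange group_BijGroup)
    moreover have "order (BijGroup E) = fact (card E)"
      using card_Bij[OF CD_finite] by (simp add: order_def BijGroup_def)
    ultimately have "card \<Omega> dvd fact (card E)"
      using card_space_dvd_card_plinth dvd_trans by metis
    moreover have "card \<Omega> = card \<Gamma> ^ card E"
      unfolding card_space_eq_prod using card_block_set_eq[OF _ assms(2)] by simp
    moreover obtain p where p: "prime p" "p dvd card \<Gamma>"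
      using card_block_set_ge_2[OF assms(2)] prime_factor_nat[of "card \<Gamma>"] by auto
    ultimately have "p ^ card E dvd fact (card E)"
      using dvd_power_same dvd_trans by metis
    then show False
      using prime_power_not_dvd_fact[OF p(1), of "card E"] CD_nonempty CD_finite
      by (simp add: card_gt_0_iff)
  qed
  ultimately have "m \<in> N" using assms(1) by blast
  then show ?thesis using assms(2) by (simp add: N_def)
qed

lemma plinth_image_block:
  assumes "m \<in> M" "\<Gamma> \<in> E" "\<gamma> \<in> \<Gamma>"
  shows "m ` \<gamma> \<in> \<Gamma>"
  using plinth_fixes_partitions[OF assms(1,2)] assms(3) by blast

lemma system_of_decomposition_eq:
  assumes "\<omega> \<in> \<Omega>"
  shows "system_of_decomposition \<Omega> M \<omega> E = (\<lambda>\<Gamma>. set_stab \<Omega> M (block_of \<Gamma> \<omega>)) ` E"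
proof -
  have eq: "\<gamma> = block_of \<Gamma> \<omega>" if "\<Gamma> \<in> E" "\<gamma> \<in> \<Gamma>" "\<omega> \<in> \<gamma>" for \<gamma> \<Gamma>
    using block_of_eqI[OF CD_partition(1)[OF that(1)] that(2,3)] by simp
  show ?thesis
  proof (intro equalityI subsetI)
    fix K assume "K \<in> system_of_decomposition \<Omega> M \<omega> E"
    then obtain \<gamma> \<Gamma> where \<gamma>: "K = set_stab \<Omega> M \<gamma>" "\<Gamma> \<in> E" "\<gamma> \<in> \<Gamma>" "\<omega> \<in> \<gamma>"
      unfolding system_of_decomposition_def by auto
    show "K \<in> (\<lambda>\<Gamma>. set_stab \<Omega> M (block_of \<Gamma> \<omega>)) ` E"
      using \<gamma>(1) unfolding eq[OF \<gamma>(2-4)] by (rule image_eqI[OF _ \<gamma>(2)])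
  next
    fix K assume "K \<in> (\<lambda>\<Gamma>. set_stab \<Omega> M (block_of \<Gamma> \<omega>)) ` E"
    then obtain \<Gamma> where \<Gamma>: "\<Gamma> \<in> E" "K = set_stab \<Omega> M (block_of \<Gamma> \<omega>)" by (rule imageE)
    show "K \<in> system_of_decomposition \<Omega> M \<omega> E"
      unfolding system_of_decomposition_def mem_Collect_eq
      using \<Gamma> block_of_mem[OF CD_partition(1)[OF \<Gamma>(1)] assms]
      by (intro exI[of _ "block_of \<Gamma> \<omega>"] exI[of _ \<Gamma>]) simp
  qed
qed

lemma block_of_image:
  assumes "g \<in> G" "\<Gamma> \<in> E" "\<omega> \<in> \<Omega>"
  shows "block_of ((\<lambda>\<gamma>. g ` \<gamma>) ` \<Gamma>) (g \<omega>) = g ` block_of \<Gamma> \<omega>"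
  by (rule block_of_eqI[OF CD_partition(1)[OF CD_image[OF assms(1,2)]]])
    (use block_of_mem[OF CD_partition(1)[OF assms(2)] assms(3)] in auto)

lemma block_of_subset:
  assumes "\<Gamma> \<in> E" "\<omega> \<in> \<Omega>"
  shows "block_of \<Gamma> \<omega> \<subseteq> \<Omega>"
  using block_of_mem(1)[OF CD_partition(1)[OF assms(1)] assms(2)] CD_partition(2)[OF assms(1)] by blast

lemma conj_set_block_stab:
  assumes "g \<in> G" "\<Gamma> \<in> E" "\<omega> \<in> \<Omega>"
  shows "conj_set S g (set_stab \<Omega> M (block_of \<Gamma> \<omega>)) =
    set_stab \<Omega> M (block_of ((\<lambda>\<gamma>. g ` \<gamma>) ` \<Gamma>) (g \<omega>))"
  unfolding block_of_image[OF assms]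
  by (rule conj_set_set_stab[OF M G_car[OF assms(1)] conj_set_plinth[OF assms(1)] block_of_subset[OF assms(2,3)]])

lemma system_of_decomposition_conj:
  assumes "\<omega> \<in> \<Omega>" "h \<in> point_stab \<Omega> G \<omega>" "K \<in> system_of_decomposition \<Omega> M \<omega> E"
  shows "conj_set S h K \<in> system_of_decomposition \<Omega> M \<omega> E"
proof -
  have h: "h \<in> G" "h \<omega> = \<omega>" using assms by (auto simp: point_stab_iff)
  obtain \<Gamma> where \<Gamma>: "\<Gamma> \<in> E" "K = set_stab \<Omega> M (block_of \<Gamma> \<omega>)"
    using assms(3) unfolding system_of_decomposition_eq[OF assms(1)] by (rule imageE)
  show ?thesis
    unfolding system_of_decomposition_eq[OF assms(1)] \<Gamma>(2) conj_set_block_stab[OF h(1) \<Gamma>(1) assms(1)] h(2)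
    by (rule imageI[OF CD_image[OF h(1) \<Gamma>(1)]])
qed

text \<open>Some \<open>g = m h\<close> moves one partition to the other. Since \<open>m\<close>
  fixes partitions, \<open>h\<close> alone does so, and as \<open>h\<close> fixes
  \<open>\<omega>\<close> it matches the blocks through \<open>\<omega>\<close>, hence their
  stabilisers.\<close>

lemma system_of_decomposition_transitive:
  assumes "\<omega> \<in> \<Omega>" "K \<in> system_of_decomposition \<Omega> M \<omega> E" "L \<in> system_of_decomposition \<Omega> M \<omega> E"
  shows "\<exists>h\<in>point_stab \<Omega> G \<omega>. conj_set S h K = L"
proof -
  obtain \<Gamma> where \<Gamma>: "\<Gamma> \<in> E" "K = set_stab \<Omega> M (block_of \<Gamma> \<omega>)"
    using assms(2) unfolding system_of_decomposition_eq[OF assms(1)] by (rule imageE)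
  obtain \<Delta> where \<Delta>: "\<Delta> \<in> E" "L = set_stab \<Omega> M (block_of \<Delta> \<omega>)"
    using assms(3) unfolding system_of_decomposition_eq[OF assms(1)] by (rule imageE)
  obtain g where g: "g \<in> G" "(\<lambda>\<gamma>. g ` \<gamma>) ` \<Gamma> = \<Delta>" using CD_unique_orbit[OF \<Gamma>(1) \<Delta>(1)] by blast
  obtain m h where mh: "m \<in> M" "h \<in> point_stab \<Omega> G \<omega>" "g = m \<otimes> h"
    using plinth_stab_split[OF g(1) assms(1)] by blast
  have h: "h \<in> G" "h \<omega> = \<omega>" using mh by (auto simp: point_stab_iff)
  have "\<Delta> = (\<lambda>\<gamma>. m ` \<gamma>) ` (\<lambda>\<gamma>. h ` \<gamma>) ` \<Gamma>"
    using g(2) mh(3) partition_image_mult[OF M_car[OF mh(1)] G_car[OF h(1)] CD_partition(2)[OF \<Gamma>(1)]] by simp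
  then have h\<Gamma>: "(\<lambda>\<gamma>. h ` \<gamma>) ` \<Gamma> = \<Delta>"
    using plinth_fixes_partitions[OF mh(1) CD_image[OF h(1) \<Gamma>(1)]] by simp
  have "conj_set S h K = L"
    using conj_set_block_stab[OF h(1) \<Gamma>(1) assms(1)] unfolding h\<Gamma> h(2) \<Gamma>(2) \<Delta>(2) .
  then show ?thesis using mh(2) by (rule bexI)
qed

text \<open>Because \<open>m\<close> fixes each partition, it sends the block at
  \<open>\<omega>\<close> to the block at \<open>m \<omega>\<close> of the same partition. This lets
  statements about all base points be checked at one.\<close>

lemma system_of_decomposition_base_change:
  assumes "\<omega> \<in> \<Omega>" "m \<in> M"
  shows "system_of_decomposition \<Omega> M (m \<omega>) E = conj_set S m ` system_of_decomposition \<Omega> M \<omega> E"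
proof -
  have m: "m \<in> G" "m \<omega> \<in> \<Omega>" using assms plinth_subset M_car perm_closed by auto
  show ?thesis
    unfolding system_of_decomposition_eq[OF assms(1)] system_of_decomposition_eq[OF m(2)] image_image
    by (rule image_cong[OF refl])
      (simp add: conj_set_block_stab[OF m(1) _ assms(1)] plinth_fixes_partitions[OF assms(2)])
qed

text \<open>Both conditions come from blocks meeting in a single point: the blocks through
  \<open>\<omega>\<close> meet only in \<open>\<omega>\<close>, which gives the intersection, and a
  mixed choice of blocks gives the factorisation.\<close>

lemma system_of_decomposition_cartesian:
  assumes \<omega>: "\<omega> \<in> \<Omega>"
  shows "cartesian_system \<Omega> M \<omega> (system_of_decomposition \<Omega> M \<omega> E)"
proof -
  let ?K = "\<lambda>\<Gamma>. set_stab \<Omega> M (block_of \<Gamma> \<omega>)"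
  let ?\<K> = "?K ` E"
  have bl: "block_of \<Gamma> \<omega> \<in> \<Gamma>" "\<omega> \<in> block_of \<Gamma> \<omega>" if "\<Gamma> \<in> E" for \<Gamma>
    using block_of_mem[OF CD_partition(1)[OF that] \<omega>] by auto
  have sub: "subgroup (?K \<Gamma>) S" "?K \<Gamma> \<subseteq> M" if "\<Gamma> \<in> E" for \<Gamma>
    using set_stab_subgroup[OF M block_of_subset[OF that \<omega>]] by (auto simp: set_stab_iff)
  have proper: "?K \<Gamma> \<noteq> M" if \<Gamma>: "\<Gamma> \<in> E" for \<Gamma>
  proof
    assume *: "?K \<Gamma> = M"
    have "x \<in> block_of \<Gamma> \<omega>" if x: "x \<in> \<Omega>" for x
    proof -
      obtain m where m: "m \<in> M" "m \<omega> = x" using trans[OF \<omega> x] by blast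
      have "m \<in> ?K \<Gamma>" using m(1) unfolding * .
      then have "m ` block_of \<Gamma> \<omega> = block_of \<Gamma> \<omega>" by (simp add: set_stab_iff)
      then show ?thesis using m bl(2)[OF \<Gamma>] by blast
    qed
    then have B: "block_of \<Gamma> \<omega> = \<Omega>" using block_of_subset[OF \<Gamma> \<omega>] by blast
    have "\<gamma> = \<Omega>" if \<gamma>: "\<gamma> \<in> \<Gamma>" for \<gamma>
    proof -
      obtain x where x: "x \<in> \<gamma>"
        using \<gamma> partition_onD3[OF CD_partition(1)[OF \<Gamma>]] by fastforce
      then have "x \<in> \<Omega>" using CD_partition(2)[OF \<Gamma>] \<gamma> by blast
      then have "block_of \<Gamma> x = \<gamma>" "block_of \<Gamma> x = \<Omega>"
        using block_of_eqI[OF CD_partition(1)[OF \<Gamma>]] x \<gamma> bl(1)[OF \<Gamma>] B by metis+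
      then show ?thesis by simp
    qed
    then show False using CD_partition(3)[OF \<Gamma>] bl(1)[OF \<Gamma>] B by blast
  qed
  have inter: "\<Inter>?\<K> = point_stab \<Omega> M \<omega>"
  proof (intro equalityI subsetI)
    fix m assume m: "m \<in> \<Inter>?\<K>"
    then have mM: "m \<in> M" using CD_nonempty by (auto simp: set_stab_iff)
    have "m ` block_of \<Gamma> \<omega> = block_of \<Gamma> \<omega>" if "\<Gamma> \<in> E" for \<Gamma>
      using m that by (auto simp: set_stab_iff)
    then have \<omega>': "m \<omega> \<in> (\<Inter>\<Gamma>\<in>E. block_of \<Gamma> \<omega>)" "\<omega> \<in> (\<Inter>\<Gamma>\<in>E. block_of \<Gamma> \<omega>)"
      using bl(2) by blast+
    have "card (\<Inter>\<Gamma>\<in>E. block_of \<Gamma> \<omega>) = 1" by (rule CD_card[OF bl(1)])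
    then have "m \<omega> = \<omega>" using \<omega>' by (rule card_1_mem_eq)
    then show "m \<in> point_stab \<Omega> M \<omega>" using mM by (simp add: point_stab_iff)
  next
    fix m assume m: "m \<in> point_stab \<Omega> M \<omega>"
    then have m': "m \<in> M" "m \<in> G" "m \<omega> = \<omega>" using plinth_subset by (auto simp: point_stab_iff)
    have "m ` block_of \<Gamma> \<omega> = block_of \<Gamma> \<omega>" if "\<Gamma> \<in> E" for \<Gamma>
      using block_of_image[OF m'(2) that \<omega>] plinth_fixes_partitions[OF m'(1) that] m'(3) by simp
    then show "m \<in> \<Inter>?\<K>" using m' by (auto simp: set_stab_iff)
  qed
  have factor: "K <#> (M \<inter> \<Inter>(?\<K> - {K})) = M" if K: "K \<in> ?\<K>" for K
  proof (intro equalityI subsetI)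
    obtain \<Gamma> where \<Gamma>: "\<Gamma> \<in> E" "K = ?K \<Gamma>" using K by (rule imageE)
    show "x \<in> M" if "x \<in> K <#> (M \<inter> \<Inter>(?\<K> - {K}))" for x
      using that sub(2)[OF \<Gamma>(1)] \<Gamma>(2) subgroup.m_closed[OF M] unfolding set_mult_def by auto
    fix m assume m: "m \<in> M"
    have im: "inv m \<in> M" using subgroup.m_inv_closed[OF M m] .
    \<comment> \<open>Only the block of \<open>\<Gamma>\<close> is moved, by \<open>inv m\<close>.
      If \<open>c\<close> sends \<open>\<omega>\<close> to the common point, then \<open>c\<close>
      fixes the other blocks through \<open>\<omega>\<close> and \<open>m \<otimes> c\<close> fixes
      the one of \<open>\<Gamma>\<close>, so \<open>m = (m \<otimes> c) \<otimes> inv c\<close> is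
      the required factorisation.\<close>
    let ?\<gamma> = "\<lambda>\<Delta>. if \<Delta> = \<Gamma> then (inv m) ` block_of \<Gamma> \<omega> else block_of \<Delta> \<omega>"
    have \<gamma>: "?\<gamma> \<Delta> \<in> \<Delta>" if "\<Delta> \<in> E" for \<Delta>
      using that bl(1) plinth_image_block[OF im \<Gamma>(1) bl(1)[OF \<Gamma>(1)]] by auto
    then have "card (\<Inter>\<Delta>\<in>E. ?\<gamma> \<Delta>) = 1" by (rule CD_card)
    then obtain x where x: "(\<Inter>\<Delta>\<in>E. ?\<gamma> \<Delta>) = {x}" by (auto simp: card_1_singleton_iff)
    then have x\<gamma>: "x \<in> ?\<gamma> \<Delta>" if "\<Delta> \<in> E" for \<Delta> using that by blast
    have "x \<in> \<Omega>"
      using x\<gamma>[OF \<Gamma>(1)] \<gamma>[OF \<Gamma>(1)] CD_partition(2)[OF \<Gamma>(1)] by blast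
    then obtain c where c: "c \<in> M" "c \<omega> = x" using trans[OF \<omega>] by blast
    have cG: "c \<in> G" using c plinth_subset by blast
    have cbl: "c ` block_of \<Delta> \<omega> = ?\<gamma> \<Delta>" if "\<Delta> \<in> E" for \<Delta>
      using block_of_image[OF cG that \<omega>] plinth_fixes_partitions[OF c(1) that] c(2)
        block_of_eqI[OF CD_partition(1)[OF that] \<gamma>[OF that] x\<gamma>[OF that]] by simp
    have car: "m \<in> carrier S" "c \<in> carrier S" using m c M_car by auto
    have "(m \<otimes> c) ` block_of \<Gamma> \<omega> = block_of \<Gamma> \<omega>"
      using cbl[OF \<Gamma>(1)] car block_of_subset[OF \<Gamma>(1) \<omega>]
      by (simp add: perm_image_mult perm_image_inv)
    then have mc: "m \<otimes> c \<in> K"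
      using \<Gamma>(2) m c subgroup.m_closed[OF M] by (simp add: set_stab_iff)
    have "inv c \<in> L" if L: "L \<in> ?\<K> - {K}" for L
    proof -
      obtain \<Delta> where \<Delta>: "\<Delta> \<in> E" "L = ?K \<Delta>" "\<Delta> \<noteq> \<Gamma>" using L \<Gamma> by blast
      then have "c \<in> L" using cbl[OF \<Delta>(1)] c by (simp add: set_stab_iff)
      then show ?thesis using sub(1)[OF \<Delta>(1)] \<Delta>(2) subgroup.m_inv_closed by metis
    qed
    then have "inv c \<in> M \<inter> \<Inter>(?\<K> - {K})" using c subgroup.m_inv_closed[OF M] by blast
    moreover have "m = (m \<otimes> c) \<otimes> inv c" using car by (simp add: m_assoc)
    ultimately show "m \<in> K <#> (M \<inter> \<Inter>(?\<K> - {K}))"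
      using mc unfolding set_mult_def by blast
  qed
  have "subgroup K (S\<lparr>carrier := M\<rparr>) \<and> K \<noteq> M" if "K \<in> ?\<K>" for K
    using that sub proper subgroup_restrict_iff[OF M] by auto
  then show ?thesis
    unfolding cartesian_system_def system_of_decomposition_eq[OF \<omega>]
    using CD_nonempty inter factor unfolding S_def by simp
qed

end

end

section \<open>Decompositions with two classes of projections\<close>

text \<open>One base point suffices: passing to \<open>m \<omega>\<close> conjugates the system, the
  projections and the point stabiliser by \<open>m\<close>, while every factor stays in place
  because it is normal in \<open>M\<close>.\<close>

lemma (in innately_transitive) CD_2ncI:
  assumes fd: "factor_decomposition S M Ts" and E: "E \<in> CD_tr \<Omega> G" and \<omega>: "\<omega> \<in> \<Omega>"
    and card: "\<And>T. T \<in> Ts \<Longrightarrow> card (proper_projections \<Omega> M Ts \<omega> E T) = 2"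
    and nonconj: "\<And>T A B. T \<in> Ts \<Longrightarrow> A \<in> proper_projections \<Omega> M Ts \<omega> E T \<Longrightarrow>
      B \<in> proper_projections \<Omega> M Ts \<omega> E T \<Longrightarrow> A \<noteq> B \<Longrightarrow> \<not> conjugate_under S (point_stab \<Omega> G \<omega>) A B"
  shows "E \<in> CD_2nc \<Omega> G M Ts"
proof -
  interpret factor_decomposition S M Ts by fact
  have ne: "\<Omega> \<noteq> {}" using \<omega> by blast
  note cart = system_of_decomposition_cartesian[OF E ne \<omega>]
  have "card (proper_projections \<Omega> M Ts \<omega>' E T) = 2 \<and>
    (\<forall>A\<in>proper_projections \<Omega> M Ts \<omega>' E T. \<forall>B\<in>proper_projections \<Omega> M Ts \<omega>' E T.
       A \<noteq> B \<longrightarrow> \<not> conjugate_under S (point_stab \<Omega> G \<omega>') A B)"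
    if \<omega>': "\<omega>' \<in> \<Omega>" and T: "T \<in> Ts" for \<omega>' T
  proof -
    obtain m where m: "m \<in> M" "m \<omega> = \<omega>'" using trans[OF \<omega> \<omega>'] by blast
    have mc: "m \<in> carrier S" and mG: "m \<in> G" using m M_car plinth_subset by auto
    have pp: "X \<in> proper_projections \<Omega> M Ts \<omega>0 E T \<longleftrightarrow>
        (\<exists>K\<in>system_of_decomposition \<Omega> M \<omega>0 E. X = \<sigma> T ` K \<and> X \<noteq> T)" for X \<omega>0
      unfolding proper_projections_def S_def by auto
    note base_change = system_of_decomposition_base_change[OF E ne \<omega> m(1), unfolded m(2)]
    let ?P = "proper_projections \<Omega> M Ts \<omega> E T"
    have Tc: "T \<subseteq> carrier S" using factor_carrier[OF T] by blast
    have proj: "\<sigma> T ` conj_set S m K = conj_set S m (\<sigma> T ` K)" if "K \<in> system_of_decomposition \<Omega> M \<omega> E" for K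
      using proj_conj_set[OF T system_member(2)[OF cart \<omega> that] mc] conj_set_factor[OF _ m(1)] T by simp
    have Pc: "A \<subseteq> carrier S" if A: "A \<in> ?P" for A
    proof -
      obtain K where K: "K \<in> system_of_decomposition \<Omega> M \<omega> E" "A = \<sigma> T ` K"
        using A unfolding pp by blast
      show ?thesis
        using proj_subgroup(2)[OF T system_member(1,2)[OF cart \<omega> K(1)]] Tc K(2) by blast
    qed
    have neT: "conj_set S m X \<noteq> T \<longleftrightarrow> X \<noteq> T" if "X \<subseteq> carrier S" for X
      using conj_set_inv_conj_set[OF mc that] conj_set_inv_conj_set[OF mc Tc] conj_set_factor[OF T m(1)]
      by metis
    have P': "proper_projections \<Omega> M Ts \<omega>' E T = conj_set S m ` ?P"
    proof (intro equalityI subsetI)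
      fix X assume "X \<in> proper_projections \<Omega> M Ts \<omega>' E T"
      then obtain K where K: "K \<in> system_of_decomposition \<Omega> M \<omega> E" "X = \<sigma> T ` conj_set S m K" "X \<noteq> T"
        unfolding pp base_change by blast
      have sub: "\<sigma> T ` K \<subseteq> carrier S"
        using proj_subgroup(2)[OF T system_member(1,2)[OF cart \<omega> K(1)]] Tc by blast
      have "\<sigma> T ` K \<noteq> T" using K(2,3) neT[OF sub] proj[OF K(1)] by simp
      then have "\<sigma> T ` K \<in> ?P" unfolding pp using K(1) by blast
      then show "X \<in> conj_set S m ` ?P" using K proj[OF K(1)] by simp
    next
      fix X assume "X \<in> conj_set S m ` ?P"
      then obtain A where A: "A \<in> ?P" "X = conj_set S m A" by (rule imageE)
      obtain K where K: "K \<in> system_of_decomposition \<Omega> M \<omega> E" "A = \<sigma> T ` K" "A \<noteq> T"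
        using A(1) unfolding pp by blast
      have "X = \<sigma> T ` conj_set S m K" "X \<noteq> T"
        using A(2) K(2,3) neT[OF Pc[OF A(1)]] proj[OF K(1)] by simp_all
      then show "X \<in> proper_projections \<Omega> M Ts \<omega>' E T"
        unfolding pp base_change using K(1) by blast
    qed
    have inj: "inj_on (conj_set S m) ?P"
      by (rule inj_on_inverseI[where g = "conj_set S (inv m)"]) (rule conj_set_inv_conj_set[OF mc Pc])
    have "\<not> conjugate_under S (point_stab \<Omega> G \<omega>') (conj_set S m A) (conj_set S m B)"
      if A: "A \<in> ?P" and B: "B \<in> ?P" and "A \<noteq> B" for A B
    proof
      assume "conjugate_under S (point_stab \<Omega> G \<omega>') (conj_set S m A) (conj_set S m B)"
      then obtain y where y: "y \<in> conj_set S m (point_stab \<Omega> G \<omega>)"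
          "conj_set S m B = conj_set S y (conj_set S m A)"
        unfolding conjugate_under_def conj_set_point_stab[OF G mG \<omega>] m(2) by blast
      then obtain h where h: "h \<in> point_stab \<Omega> G \<omega>" "y = m \<otimes> h \<otimes> inv m"
        unfolding conj_set_image by blast
      have hc: "h \<in> carrier S" using h G_car by (auto simp: point_stab_iff)
      \<comment> \<open>The conjugating element at the new base point is the
        \<open>m\<close>-conjugate of \<open>h\<close>; cancelling \<open>m\<close> produces a
        conjugacy at the old base point.\<close>
      have "y \<otimes> m = m \<otimes> h" using hc mc h(2) by (simp add: m_assoc)
      then have "conj_set S m B = conj_set S m (conj_set S h A)"
        using y(2) hc mc h(2) Pc[OF A] by (simp flip: conj_set_mult)
      then have "conj_set S (inv m) (conj_set S m B) = conj_set S (inv m) (conj_set S m (conj_set S h A))"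
        by (rule arg_cong)
      then have "B = conj_set S h A"
        unfolding conj_set_inv_conj_set[OF mc Pc[OF B]]
          conj_set_inv_conj_set[OF mc conj_set_closed[OF hc Pc[OF A]]] .
      then show False
        using nonconj[OF T A B \<open>A \<noteq> B\<close>] h(1) unfolding conjugate_under_def by blast
    qed
    then show ?thesis
      unfolding P' using card_image[OF inj] card[OF T] by auto
  qed
  then show ?thesis using E unfolding CD_2nc_def S_def by simp
qed

locale two_class_decomposition = innately_transitive +
  fixes Ts E \<omega>
  assumes factors: "factor_decomposition S M Ts"
    and simple: "\<And>T. T \<in> Ts \<Longrightarrow> simple_group (S\<lparr>carrier := T\<rparr>)"
    and CD_2nc: "E \<in> CD_2nc \<Omega> G M Ts"
    and base: "\<omega> \<in> \<Omega>"

sublocale two_class_decomposition \<subseteq> factor_decomposition S M Ts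
  by (rule factors)

context two_class_decomposition
begin

abbreviation "H \<equiv> point_stab \<Omega> G \<omega>"
abbreviation "\<K> \<equiv> system_of_decomposition \<Omega> M \<omega> E"
abbreviation "P \<equiv> proper_projections \<Omega> M Ts \<omega> E"

lemma H_subgroup: "subgroup H S"
  by (rule point_stab_subgroup[OF G base])

lemma H_G: "h \<in> H \<Longrightarrow> h \<in> G"
  by (simp add: point_stab_iff)

lemma H_car: "h \<in> H \<Longrightarrow> h \<in> carrier S"
  using G_car H_G by blast

lemma E_tr: "E \<in> CD_tr \<Omega> G"
  using CD_2nc by (simp add: CD_2nc_def)

lemma space_nonempty: "\<Omega> \<noteq> {}"
  using base by blast

lemmas system = system_of_decomposition_cartesian[OF E_tr space_nonempty base]
lemmas \<K>_member = system_member[OF system base]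
lemmas \<K>_conj = system_of_decomposition_conj[OF E_tr space_nonempty base]
lemmas \<K>_transitive = system_of_decomposition_transitive[OF E_tr space_nonempty base]

lemma \<K>_finite: "finite \<K>"
  unfolding system_of_decomposition_eq[OF E_tr space_nonempty base]
  using CD_finite[OF E_tr space_nonempty] by simp

lemma \<K>_nonempty: "\<K> \<noteq> {}"
  using system by (simp add: cartesian_system_def)

lemma Ts_conj: "g \<in> G \<Longrightarrow> T \<in> Ts \<Longrightarrow> conj_set S g T \<in> Ts"
  by (rule conj_set_factor_mem[OF simple G_car conj_set_plinth])

lemma T_sub: "T \<in> Ts \<Longrightarrow> T \<subseteq> carrier S"
  using factor_carrier by blast

lemma T_nontrivial: "T \<in> Ts \<Longrightarrow> T \<noteq> {\<one>}"
  using simple_group.simple_not_triv[OF simple] by simp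

text \<open>The \<open>G\<close>-conjugates of \<open>T\<close> generate a nontrivial normal
  subgroup of \<open>G\<close> inside \<open>M\<close>, hence all of \<open>M\<close>. A factor
  missing among them would lie in its own complement. Finally the \<open>M\<close>-part of the
  conjugating element is dropped, since it normalises every factor.\<close>

lemma Ts_transitive:
  assumes T: "T \<in> Ts" and T': "T' \<in> Ts"
  shows "\<exists>h\<in>H. conj_set S h T = T'"
proof -
  let ?O = "(\<lambda>g. conj_set S g T) ` G"
  let ?N = "generate S (\<Union>?O)"
  have O: "?O \<subseteq> Ts" using Ts_conj T by blast
  then have Osub: "\<Union>?O \<subseteq> carrier S" using T_sub by blast
  have NM: "?N \<subseteq> M"
    unfolding generate_factors[symmetric] by (rule mono_generate) (use O in blast)
  have "?N = {\<one>} \<or> ?N = M"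
  proof (rule plinth_minimal[OF generate_is_subgroup[OF Osub] NM])
    fix g n assume g: "g \<in> G" and n: "n \<in> ?N"
    interpret c: group_hom S S "\<lambda>x. g \<otimes> x \<otimes> inv g"
      using G_car[OF g] by unfold_locales (auto simp: hom_def conj_mult)
    have "(\<lambda>x. g \<otimes> x \<otimes> inv g) ` \<Union>?O \<subseteq> \<Union>?O"
    proof
      fix y assume "y \<in> (\<lambda>x. g \<otimes> x \<otimes> inv g) ` \<Union>?O"
      then obtain g' where g': "g' \<in> G" "y \<in> conj_set S g (conj_set S g' T)"
        unfolding conj_set_image by blast
      then have "y \<in> conj_set S (g \<otimes> g') T"
        using conj_set_mult[OF G_car[OF g] G_car[OF g'(1)] T_sub[OF T]] by simp
      then show "y \<in> \<Union>?O" using subgroup.m_closed[OF G g g'(1)] by blast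
    qed
    then have "generate S ((\<lambda>x. g \<otimes> x \<otimes> inv g) ` \<Union>?O) \<subseteq> ?N" by (rule mono_generate)
    then show "g \<otimes> n \<otimes> inv g \<in> ?N" using c.generate_img[OF Osub] n by blast
  qed
  moreover have "?N \<noteq> {\<one>}"
  proof
    assume N1: "?N = {\<one>}"
    have "T = conj_set S \<one> T" using conj_set_one[OF T_sub[OF T]] by simp
    then have "T \<subseteq> \<Union>?O" using subgroup.one_closed[OF G] by blast
    then have "T \<subseteq> {\<one>}" unfolding N1[symmetric] using generate.incl by (metis subset_iff)
    then show False
      using T_nontrivial[OF T] subgroup.one_closed[OF factor_subgroup[OF T]] by blast
  qed
  ultimately have N: "?N = M" by blast
  have "T' \<in> ?O"
  proof (rule ccontr)
    assume "T' \<notin> ?O"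
    then have "\<Union>?O \<subseteq> \<Union>(Ts - {T'})" using O by blast
    then have "M \<subseteq> C T'" using mono_generate N by metis
    then have "T' \<subseteq> C T'" using factor_subset[OF T'] by blast
    then show False using factor_inter[OF T'] T_nontrivial[OF T'] by blast
  qed
  then obtain g where g: "g \<in> G" "T' = conj_set S g T" by blast
  obtain m h where mh: "m \<in> M" "h \<in> H" "g = m \<otimes> h"
    using plinth_stab_split[OF g(1) base] by blast
  have "T' = conj_set S m (conj_set S h T)"
    using g mh conj_set_mult[OF M_car[OF mh(1)] H_car[OF mh(2)] T_sub[OF T]] by simp
  then have "conj_set S h T = T'"
    using conj_set_factor[OF Ts_conj[OF H_G[OF mh(2)] T] mh(1)] by simp
  then show ?thesis using mh(2) by blast
qed

lemma proj_conj_\<K>: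
  assumes "g \<in> G" "T \<in> Ts" "K \<subseteq> M"
  shows "\<sigma> (conj_set S g T) ` conj_set S g K = conj_set S g (\<sigma> T ` K)"
  by (rule proj_conj_set[OF assms(2,3) G_car[OF assms(1)] Ts_conj[OF assms(1)]])

lemma proj_factorisation:
  assumes K: "K \<in> \<K>" and L: "L \<in> \<K>" and "K \<noteq> L" and T: "T \<in> Ts"
  shows "\<sigma> T ` K <#> \<sigma> T ` L = T"
proof (intro equalityI subsetI)
  note KK = \<K>_member[OF K] and LL = \<K>_member[OF L]
  show "x \<in> T" if "x \<in> \<sigma> T ` K <#> \<sigma> T ` L" for x
    using that proj_subgroup(2)[OF T KK(1,2)] proj_subgroup(2)[OF T LL(1,2)]
      subgroup.m_closed[OF factor_subgroup[OF T]] unfolding set_mult_def by blast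
  fix t assume t: "t \<in> T"
  then have "t \<in> M" using factor_subset[OF T] by blast
  also have "M = K <#> (M \<inter> \<Inter>(\<K> - {K}))"
    using system K unfolding cartesian_system_def S_def by simp
  finally obtain k c where kc: "k \<in> K" "c \<in> \<Inter>(\<K> - {K})" "t = k \<otimes> c"
    unfolding set_mult_def by blast
  have c: "c \<in> L" using kc(2) L \<open>K \<noteq> L\<close> by blast
  have "k \<in> M" "c \<in> M" using kc(1) c KK(2) LL(2) by auto
  then have "t = \<sigma> T k \<otimes> \<sigma> T c"
    using proj_factor[OF T t] proj_mult[OF T, of k c] kc(3) by simp
  then show "t \<in> \<sigma> T ` K <#> \<sigma> T ` L"
    using kc(1) c unfolding set_mult_def by blast
qed

lemma P_iff: "A \<in> P T \<longleftrightarrow> (\<exists>K\<in>\<K>. A = \<sigma> T ` K \<and> A \<noteq> T)"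
  unfolding proper_projections_def S_def by auto

lemma P_E:
  assumes "A \<in> P T" "T \<in> Ts"
  obtains K where "K \<in> \<K>" "A = \<sigma> T ` K" "A \<noteq> T" "subgroup A S" "A \<subseteq> T" "A \<subseteq> carrier S"
proof -
  obtain K where K: "K \<in> \<K>" "A = \<sigma> T ` K" "A \<noteq> T"
    using assms(1) unfolding P_iff by blast
  moreover note proj_subgroup[OF assms(2) \<K>_member(1,2)[OF K(1)]]
  ultimately show thesis using that T_sub[OF assms(2)] by blast
qed

text \<open>Distinct members with the same projection \<open>X\<close> would give
  \<open>X X = T\<close>, but a subgroup satisfies \<open>X X = X\<close>.\<close>

lemma proj_inj:
  assumes K: "K \<in> \<K>" and L: "L \<in> \<K>" and T: "T \<in> Ts" and "\<sigma> T ` K \<noteq> T" "\<sigma> T ` K = \<sigma> T ` L"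
  shows "K = L"
proof (rule ccontr)
  assume "K \<noteq> L"
  from proj_factorisation[OF K L this T] have "\<sigma> T ` K <#> \<sigma> T ` K = T"
    using assms(5) by simp
  moreover have "\<sigma> T ` K <#> \<sigma> T ` K = \<sigma> T ` K"
    by (rule subgroup_mult_id[OF proj_subgroup(1)[OF T \<K>_member(1,2)[OF K]]])
  ultimately show False using assms(4) by simp
qed

lemma P_card: "T \<in> Ts \<Longrightarrow> card (P T) = 2"
  using CD_2nc base by (simp add: CD_2nc_def)

lemma P_nonconj:
  "\<lbrakk>T \<in> Ts; A \<in> P T; B \<in> P T; A \<noteq> B\<rbrakk> \<Longrightarrow> \<not> conjugate_under S H A B"
  using CD_2nc base by (simp add: CD_2nc_def S_def)

text \<open>If one of the two proper projections were trivial, the factorisation would force the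
  other to be all of \<open>T\<close>. Nontriviality is what lets a projection determine its
  factor.\<close>

lemma P_nontrivial:
  assumes T: "T \<in> Ts" and A: "A \<in> P T"
  shows "A \<noteq> {\<one>}"
proof
  assume A1: "A = {\<one>}"
  obtain B where B: "B \<in> P T" "B \<noteq> A"
    using P_card[OF T] by (metis card_2_iff' )
  obtain K where K: "K \<in> \<K>" "A = \<sigma> T ` K" using A by (rule P_E[OF _ T])
  obtain L where L: "L \<in> \<K>" "B = \<sigma> T ` L" "B \<noteq> T" "B \<subseteq> carrier S" using B(1) by (rule P_E[OF _ T])
  have "K \<noteq> L" using K L B by blast
  from proj_factorisation[OF K(1) L(1) this T] have "{\<one>} <#> B = T"
    using K L A1 by simp
  moreover have "{\<one>} <#> B = B"
    using L(4) by (auto simp: set_mult_def subset_iff) 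
  ultimately show False using L by simp
qed

lemma P_conj:
  assumes T: "T \<in> Ts" and A: "A \<in> P T" and h: "h \<in> H"
  shows "conj_set S h A \<in> P (conj_set S h T)"
proof -
  obtain K where K: "K \<in> \<K>" "A = \<sigma> T ` K" "A \<noteq> T" "A \<subseteq> carrier S" using A by (rule P_E[OF _ T])
  have "conj_set S h A \<noteq> conj_set S h T"
    using K conj_set_inv_conj_set[OF H_car[OF h]] T_sub[OF T] by metis
  moreover have "conj_set S h A = \<sigma> (conj_set S h T) ` conj_set S h K"
    unfolding K(2) proj_conj_\<K>[OF H_G[OF h] T \<K>_member(2)[OF K(1)]] ..
  ultimately show ?thesis
    unfolding P_iff using \<K>_conj[OF h K(1)] by blast
qed

text \<open>The conjugate of \<open>A\<close> is nontrivial and lies both in \<open>T\<close> and in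
  the conjugate of \<open>T1\<close>, but distinct factors meet trivially.\<close>

lemma conjugate_projection:
  assumes T1: "T1 \<in> Ts" and A: "A \<in> P T1" and T: "T \<in> Ts" and K: "K \<in> \<K>"
    and h: "h \<in> H" and eq: "\<sigma> T ` K = conj_set S h A"
  shows "conj_set S h T1 = T" "\<sigma> T ` K \<in> P T"
proof -
  have As: "A \<subseteq> T1" "A \<subseteq> carrier S" "subgroup A S" using A by (blast elim: P_E[OF _ T1])+
  show T1T: "conj_set S h T1 = T"
  proof (rule ccontr)
    assume ne: "conj_set S h T1 \<noteq> T"
    have "conj_set S h A \<subseteq> conj_set S h T1 \<inter> T"
      using conj_set_mono[OF As(1)] eq proj_subgroup(2)[OF T \<K>_member(1,2)[OF K]] by blast
    then have "conj_set S h A \<subseteq> {\<one>}"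
      using factors_disjoint[OF Ts_conj[OF H_G[OF h] T1] T ne] by simp
    then have "conj_set S (inv h) (conj_set S h A) \<subseteq> conj_set S (inv h) {\<one>}"
      by (rule conj_set_mono)
    then have "A \<subseteq> {\<one>}"
      unfolding conj_set_inv_conj_set[OF H_car[OF h] As(2)]
      using H_car[OF h] by (simp add: conj_set_image)
    then show False
      using P_nontrivial[OF T1 A] subgroup.one_closed[OF As(3)] by blast
  qed
  show "\<sigma> T ` K \<in> P T" using P_conj[OF T1 A h] unfolding T1T eq .
qed

section \<open>Members of the system over a given factor\<close>

context
  fixes T1 A1
  assumes T1: "T1 \<in> Ts" and A1: "A1 \<in> P T1"
begin

lemma A1_sub: "A1 \<subseteq> carrier S"
  using A1 by (blast elim: P_E[OF _ T1])

lemma conjugate_over_exists: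
  assumes T: "T \<in> Ts"
  shows "\<exists>K\<in>\<K>. conjugate_under S H A1 (\<sigma> T ` K)"
proof -
  obtain K where K: "K \<in> \<K>" "A1 = \<sigma> T1 ` K" using A1 by (rule P_E[OF _ T1])
  obtain h where h: "h \<in> H" "conj_set S h T1 = T" using Ts_transitive[OF T1 T] by blast
  have "\<sigma> T ` conj_set S h K = conj_set S h A1"
    using proj_conj_\<K>[OF H_G[OF h(1)] T1 \<K>_member(2)[OF K(1)]] h K by simp
  then have "conjugate_under S H A1 (\<sigma> T ` conj_set S h K)"
    unfolding conjugate_under_def using h(1) by blast
  then show ?thesis using \<K>_conj[OF h(1) K(1)] by blast
qed

lemma conjugate_over_P:
  assumes "T \<in> Ts" "K \<in> \<K>" "conjugate_under S H A1 (\<sigma> T ` K)"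
  shows "\<sigma> T ` K \<in> P T"
proof -
  obtain h where "h \<in> H" "\<sigma> T ` K = conj_set S h A1"
    using assms(3) unfolding conjugate_under_def by (rule bexE)
  then show ?thesis by (rule conjugate_projection(2)[OF T1 A1 assms(1,2)])
qed

text \<open>Both projections are conjugate to \<open>A1\<close>, hence to each other. Conjugate
  elements of \<open>P T\<close> coincide, and \<open>proj_inj\<close> passes from projections to
  members.\<close>

lemma conjugate_over_unique:
  assumes T: "T \<in> Ts" and K: "K \<in> \<K>" "conjugate_under S H A1 (\<sigma> T ` K)"
    and L: "L \<in> \<K>" "conjugate_under S H A1 (\<sigma> T ` L)"
  shows "K = L"
proof -
  note PK = conjugate_over_P[OF T K] and PL = conjugate_over_P[OF T L]
  have sub: "\<sigma> T ` K \<subseteq> carrier S" using PK by (blast elim: P_E[OF _ T])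
  have "conjugate_under S H (\<sigma> T ` K) A1"
    by (rule conjugate_under_sym[OF H_subgroup A1_sub K(2)])
  then have "conjugate_under S H (\<sigma> T ` K) (\<sigma> T ` L)"
    by (rule conjugate_under_trans[OF H_subgroup sub _ L(2)])
  then have "\<sigma> T ` K = \<sigma> T ` L" using P_nonconj[OF T PK PL] by blast
  moreover have "\<sigma> T ` K \<noteq> T" using PK unfolding P_iff by blast
  ultimately show ?thesis using proj_inj[OF K(1) L(1) T] by blast
qed

lemma member_over:
  assumes T: "T \<in> Ts"
  shows "member_over \<Omega> G M Ts \<omega> E A1 T \<in> \<K>"
    "conjugate_under S H A1 (\<sigma> T ` member_over \<Omega> G M Ts \<omega> E A1 T)"
proof -
  let ?Q = "\<lambda>K. K \<in> \<K> \<and> conjugate_under S H A1 (\<sigma> T ` K)"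
  have "\<exists>!K. ?Q K"
    using conjugate_over_exists[OF T] conjugate_over_unique[OF T] by blast
  then have "?Q (THE K. ?Q K)" by (rule theI')
  then show "member_over \<Omega> G M Ts \<omega> E A1 T \<in> \<K>"
    "conjugate_under S H A1 (\<sigma> T ` member_over \<Omega> G M Ts \<omega> E A1 T)"
    unfolding member_over_def S_def by auto
qed

lemma member_over_eqI:
  assumes "T \<in> Ts" "K \<in> \<K>" "conjugate_under S H A1 (\<sigma> T ` K)"
  shows "member_over \<Omega> G M Ts \<omega> E A1 T = K"
  by (rule conjugate_over_unique[OF assms(1) member_over[OF assms(1)] assms(2,3)])

lemma member_over_P: "T \<in> Ts \<Longrightarrow> \<sigma> T ` member_over \<Omega> G M Ts \<omega> E A1 T \<in> P T"
  by (rule conjugate_over_P[OF _ member_over])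

text \<open>By uniqueness it is enough that the conjugated member qualifies over the conjugated
  factor. This equivariance is the compatibility required of a digraph automorphism.\<close>

lemma member_over_conj:
  assumes T: "T \<in> Ts" and h: "h \<in> H"
  shows "conj_set S h (member_over \<Omega> G M Ts \<omega> E A1 T) = member_over \<Omega> G M Ts \<omega> E A1 (conj_set S h T)"
proof (rule member_over_eqI[symmetric, OF Ts_conj[OF H_G[OF h] T]])
  note K = member_over[OF T]
  show "conj_set S h (member_over \<Omega> G M Ts \<omega> E A1 T) \<in> \<K>" by (rule \<K>_conj[OF h K(1)])
  show "conjugate_under S H A1 (\<sigma> (conj_set S h T) ` conj_set S h (member_over \<Omega> G M Ts \<omega> E A1 T))"
    unfolding proj_conj_\<K>[OF H_G[OF h] T \<K>_member(2)[OF K(1)]]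
    by (rule conjugate_under_trans[OF H_subgroup A1_sub K(2)])
      (use h in \<open>auto simp: conjugate_under_def\<close>)
qed

end

section \<open>The two projections over each factor\<close>

context
  fixes T1 A1 B1
  assumes T1: "T1 \<in> Ts" and AB1: "P T1 = {A1, B1}"
begin

abbreviation "\<beta> \<equiv> member_over \<Omega> G M Ts \<omega> E A1"
abbreviation "\<epsilon> \<equiv> member_over \<Omega> G M Ts \<omega> E B1"
abbreviation "\<A> T \<equiv> \<sigma> T ` \<beta> T"
abbreviation "\<B> T \<equiv> \<sigma> T ` \<epsilon> T"

lemma AB1_mem: "A1 \<in> P T1" "B1 \<in> P T1"
  using AB1 by auto

lemma AB1_distinct: "A1 \<noteq> B1"
  using P_card[OF T1] AB1 by auto

lemma AB_P:
  assumes "T \<in> Ts"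
  shows "\<A> T \<in> P T" "\<B> T \<in> P T"
  by (rule member_over_P[OF T1 AB1_mem(1) assms], rule member_over_P[OF T1 AB1_mem(2) assms])

text \<open>The classes are carried over from \<open>T1\<close>: a conjugacy here, inserted between
  the conjugacies with \<open>A1\<close> and \<open>B1\<close>, would make \<open>A1\<close> and
  \<open>B1\<close> conjugate.\<close>

lemma AB_nonconj:
  assumes T: "T \<in> Ts"
  shows "\<not> conjugate_under S H (\<A> T) (\<B> T)"
proof
  assume AB: "conjugate_under S H (\<A> T) (\<B> T)"
  note a = member_over[OF T1 AB1_mem(1) T] and b = member_over[OF T1 AB1_mem(2) T]
  have "conjugate_under S H A1 (\<B> T)"
    by (rule conjugate_under_trans[OF H_subgroup A1_sub[OF T1 AB1_mem(1)] a(2) AB])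
  moreover have "conjugate_under S H (\<B> T) B1"
    by (rule conjugate_under_sym[OF H_subgroup A1_sub[OF T1 AB1_mem(2)] b(2)])
  ultimately have "conjugate_under S H A1 B1"
    by (rule conjugate_under_trans[OF H_subgroup A1_sub[OF T1 AB1_mem(1)]])
  then show False using P_nonconj[OF T1 AB1_mem AB1_distinct] by blast
qed

lemma AB_distinct:
  assumes T: "T \<in> Ts"
  shows "\<A> T \<noteq> \<B> T"
proof
  have "\<A> T \<subseteq> carrier S" using AB_P(1)[OF T] by (blast elim: P_E[OF _ T])
  then have "conjugate_under S H (\<A> T) (\<A> T)"
    using conj_set_one[of "\<A> T"] subgroup.one_closed[OF H_subgroup] unfolding conjugate_under_def by metis
  moreover assume "\<A> T = \<B> T"
  ultimately show False using AB_nonconj[OF T] by simp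
qed

lemma P_eq:
  assumes T: "T \<in> Ts"
  shows "P T = {\<A> T, \<B> T}"
proof (rule card_subset_eq[symmetric])
  show "finite (P T)" using P_card[OF T] by (metis card.infinite zero_neq_numeral)
  show "{\<A> T, \<B> T} \<subseteq> P T" using AB_P[OF T] by blast
  show "card {\<A> T, \<B> T} = card (P T)" using P_card[OF T] AB_distinct[OF T] by simp
qed

lemma AB_subgroup:
  assumes T: "T \<in> Ts"
  shows "subgroup (\<A> T) S" "\<A> T \<subseteq> T" "\<A> T \<noteq> T" "subgroup (\<B> T) S" "\<B> T \<subseteq> T" "\<B> T \<noteq> T"
  using AB_P[OF T] by (blast elim: P_E[OF _ T])+

lemma AB_factorisation:
  assumes T: "T \<in> Ts"
  shows "\<A> T <#> \<B> T = T"
proof (rule proj_factorisation[OF _ _ _ T])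
  show "\<beta> T \<in> \<K>" "\<epsilon> T \<in> \<K>"
    by (rule member_over(1)[OF T1 AB1_mem(1) T], rule member_over(1)[OF T1 AB1_mem(2) T])
  show "\<beta> T \<noteq> \<epsilon> T" using AB_distinct[OF T] by auto
qed

text \<open>An element normalising \<open>T\<close> sends \<open>X\<close> to a conjugate member of
  \<open>P T\<close>, which can only be \<open>X\<close>. Conversely, an element normalising
  \<open>X\<close> keeps its factor, because the nontrivial \<open>X\<close> lies in one factor
  only.\<close>

lemma normalizer_in_projection:
  assumes T: "T \<in> Ts" and X: "X \<in> P T"
  shows "normalizer_in S H T = normalizer_in S H X"
proof -
  obtain K where K: "K \<in> \<K>" "X = \<sigma> T ` K" "X \<subseteq> T" "X \<subseteq> carrier S" "subgroup X S"
    using X by (rule P_E[OF _ T])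
  have Hs: "H \<subseteq> carrier S" using H_car by blast
  have eq: "conj_set S h T = T \<longleftrightarrow> conj_set S h X = X" if h: "h \<in> H" for h
  proof
    assume *: "conj_set S h T = T"
    have hX: "conj_set S h X \<in> P T" using P_conj[OF T X h] unfolding * .
    have "conjugate_under S H X (conj_set S h X)"
      using h unfolding conjugate_under_def by blast
    then show "conj_set S h X = X" using P_nonconj[OF T X hX] by metis
  next
    assume *: "conj_set S h X = X"
    show "conj_set S h T = T"
      by (rule conjugate_projection(1)[OF T X T K(1) h]) (simp add: * K(2)[symmetric])
  qed
  show ?thesis
  proof (rule Set.set_eqI)
    show "h \<in> normalizer_in S H T \<longleftrightarrow> h \<in> normalizer_in S H X" for h
      unfolding normalizer_in_iff[OF Hs T_sub[OF T]] normalizer_in_iff[OF Hs K(4)]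
      using eq[of h] by (rule conj_cong[OF refl])
  qed
qed

end

end

section \<open>The quotient action\<close>

lemma mem_Int_pairD: "x \<in> Y \<inter> Z \<Longrightarrow> X \<in> {Y, Z} \<Longrightarrow> x \<in> X"
  by blast

lemma set_multI: "x \<in> X \<Longrightarrow> y \<in> Y \<Longrightarrow> x \<otimes>\<^bsub>G\<^esub> y \<in> X <#>\<^bsub>G\<^esub> Y"
  by (auto simp: set_mult_def)

context perm_space
begin

lemma inclusion_action:
  assumes H: "subgroup H S"
  shows "group_action (S\<lparr>carrier := H\<rparr>) \<Omega> (\<lambda>g. g)"
  unfolding group_action_def group_hom_def group_hom_axioms_def hom_def
  using subgroup_imp_group[OF H] is_group subgroup.subset[OF H] by (auto simp flip: S_def)

end

context two_class_decomposition
begin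

section \<open>Products of projections and their intersection\<close>

abbreviation "bar \<equiv> bar_subgroup S M Ts"

lemma bar_iff: "x \<in> bar K \<longleftrightarrow> x \<in> M \<and> (\<forall>T\<in>Ts. \<sigma> T x \<in> \<sigma> T ` K)"
  by (simp add: bar_subgroup_def)

context
  fixes K
  assumes K: "subgroup K S" "K \<subseteq> M"
begin

lemma bar_subset: "bar K \<subseteq> M"
  by (auto simp: bar_iff)

lemma bar_superset: "K \<subseteq> bar K"
  using K by (auto simp: bar_iff)

lemma bar_subgroup: "subgroup (bar K) S"
proof (rule subgroupI)
  show "bar K \<subseteq> carrier S" using bar_subset M_car by blast
  show "bar K \<noteq> {}" using bar_superset subgroup.one_closed[OF K(1)] by blast
  show "inv x \<in> bar K" if x: "x \<in> bar K" for x
  proof -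
    have "\<sigma> T (inv x) \<in> \<sigma> T ` K" if T: "T \<in> Ts" for T
      using x T proj_inv[OF T, of x] subgroup.m_inv_closed[OF proj_subgroup(1)[OF T K]] by (simp add: bar_iff)
    then show ?thesis using x subgroup.m_inv_closed[OF M] by (simp add: bar_iff)
  qed
  show "x \<otimes> y \<in> bar K" if x: "x \<in> bar K" and y: "y \<in> bar K" for x y
  proof -
    have "\<sigma> T (x \<otimes> y) \<in> \<sigma> T ` K" if T: "T \<in> Ts" for T
      using x y T proj_mult[OF T, of x y] subgroup.m_closed[OF proj_subgroup(1)[OF T K]] by (simp add: bar_iff)
    then show ?thesis using x y subgroup.m_closed[OF M] by (simp add: bar_iff)
  qed
qed

lemma proj_bar:
  assumes "T \<in> Ts"
  shows "\<sigma> T ` bar K = \<sigma> T ` K"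
proof
  show "\<sigma> T ` bar K \<subseteq> \<sigma> T ` K" using assms by (auto simp: bar_iff)
  show "\<sigma> T ` K \<subseteq> \<sigma> T ` bar K" by (rule image_mono[OF bar_superset])
qed

text \<open>Membership in \<open>bar\<close> is tested factor by factor, and the
  \<open>T\<close>-component of a conjugate is the conjugate of the component over the factor that
  \<open>g\<close> sends to \<open>T\<close>.\<close>

lemma conj_set_bar_subset:
  assumes g: "g \<in> G"
  shows "conj_set S g (bar K) \<subseteq> bar (conj_set S g K)"
proof
  have gc: "g \<in> carrier S" and ig: "inv g \<in> G"
    using g G_car subgroup.m_inv_closed[OF G] by auto
  fix y assume "y \<in> conj_set S g (bar K)"
  then obtain x where x: "x \<in> bar K" "y = g \<otimes> x \<otimes> inv g" unfolding conj_set_image by (rule imageE)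
  have xM: "x \<in> M" using x(1) by (simp add: bar_iff)
  have "\<sigma> T y \<in> \<sigma> T ` conj_set S g K" if T: "T \<in> Ts" for T
  proof -
    let ?T = "conj_set S (inv g) T"
    have T': "?T \<in> Ts" and gT: "conj_set S g ?T = T"
      using Ts_conj[OF ig T] conj_set_conj_set_inv[OF gc T_sub[OF T]] by auto
    have "\<sigma> T y = g \<otimes> \<sigma> ?T x \<otimes> inv g"
      using proj_conj[OF T' xM gc Ts_conj[OF g]] unfolding gT x(2) .
    moreover have "\<sigma> ?T x \<in> \<sigma> ?T ` K" using x(1) T' by (simp add: bar_iff)
    ultimately have "\<sigma> T y \<in> conj_set S g (\<sigma> ?T ` K)"
      unfolding conj_set_image by simp
    then show ?thesis using proj_conj_\<K>[OF g T' K(2)] unfolding gT by simp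
  qed
  then show "y \<in> bar (conj_set S g K)"
    using plinth_conj[OF g xM] x(2) by (simp add: bar_iff)
qed

end

text \<open>The reverse inclusion is \<open>conj_set_bar_subset\<close> for \<open>inv g\<close> and
  the conjugated subgroup, conjugated back.\<close>

lemma conj_set_bar:
  assumes K: "subgroup K S" "K \<subseteq> M" and g: "g \<in> G"
  shows "conj_set S g (bar K) = bar (conj_set S g K)"
proof (rule equalityI)
  show "conj_set S g (bar K) \<subseteq> bar (conj_set S g K)" by (rule conj_set_bar_subset[OF K g])
  have gc: "g \<in> carrier S" and ig: "inv g \<in> G"
    using g G_car subgroup.m_inv_closed[OF G] by auto
  have Kc: "K \<subseteq> carrier S" using subgroup.subset[OF K(1)] .
  have gK: "subgroup (conj_set S g K) S" "conj_set S g K \<subseteq> M"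
    using conj_set_subgroup[OF gc K(1)] conj_set_mono[OF K(2), of S g] conj_set_plinth[OF g] by auto
  have barc: "bar (conj_set S g K) \<subseteq> carrier S"
    by (rule subgroup.subset[OF bar_subgroup[OF gK]])
  have "bar (conj_set S g K) = conj_set S g (conj_set S (inv g) (bar (conj_set S g K)))"
    by (rule conj_set_conj_set_inv[OF gc barc, symmetric])
  also have "\<dots> \<subseteq> conj_set S g (bar (conj_set S (inv g) (conj_set S g K)))"
    by (rule conj_set_mono[OF conj_set_bar_subset[OF gK ig]])
  also have "\<dots> = conj_set S g (bar K)"
    unfolding conj_set_inv_conj_set[OF gc Kc] ..
  finally show "bar (conj_set S g K) \<subseteq> conj_set S g (bar K)" .
qed

lemma bar_member:
  assumes "K \<in> \<K>"
  shows "subgroup (bar K) S" "K \<subseteq> bar K" "\<And>T. T \<in> Ts \<Longrightarrow> \<sigma> T ` bar K = \<sigma> T ` K"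
  by (fact bar_subgroup[OF \<K>_member(1,2)[OF assms]] bar_superset[OF \<K>_member(1,2)[OF assms]]
      proj_bar[OF \<K>_member(1,2)[OF assms]])+

lemma conj_set_bar_\<K>: "h \<in> H \<Longrightarrow> K \<in> \<K> \<Longrightarrow> conj_set S h (bar K) = bar (conj_set S h K)"
  by (rule conj_set_bar[OF \<K>_member(1,2) H_G])

definition "Mb = \<Inter>(bar ` \<K>)"

lemma Mb_subset_bar: "K \<in> \<K> \<Longrightarrow> Mb \<subseteq> bar K"
  by (auto simp: Mb_def)

lemma Mb_subset: "Mb \<subseteq> M"
proof -
  obtain K where "K \<in> \<K>" using \<K>_nonempty by blast
  then show ?thesis using Mb_subset_bar[of K] by (auto simp: bar_iff)
qed

lemma Mb_subgroup: "subgroup Mb S"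
  unfolding Mb_def by (rule subgroups_Inter) (use \<K>_nonempty bar_member(1) in auto)

lemma Mb_stab: "point_stab \<Omega> M \<omega> \<subseteq> Mb"
  unfolding Mb_def by (rule INT_greatest) (rule order_trans[OF \<K>_member(4) bar_member(2)])

text \<open>By transitivity of \<open>H\<close> on the system, one \<open>bar K\<close> equal to
  \<open>M\<close> would make all of them equal to \<open>M\<close>, although some member projects
  properly to \<open>T\<close>.\<close>

lemma bar_proper:
  assumes K: "K \<in> \<K>" and T: "T \<in> Ts"
  shows "bar K \<noteq> M"
proof
  assume *: "bar K = M"
  obtain A where "A \<in> P T" using P_card[OF T] by fastforce
  then obtain L where L: "L \<in> \<K>" "A = \<sigma> T ` L" "A \<noteq> T" by (rule P_E[OF _ T])
  obtain h where h: "h \<in> H" "conj_set S h K = L" using \<K>_transitive[OF K L(1)] by (rule bexE)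
  have "bar L = M"
    using conj_set_bar_\<K>[OF h(1) K] conj_set_plinth[OF H_G[OF h(1)]] unfolding * h(2) by simp
  then have "\<sigma> T ` L = T" using bar_member(3)[OF L(1) T] proj_M[OF T] by simp
  then show False using L by simp
qed

lemma Ts_nonempty: "Ts \<noteq> {}"
proof
  assume "Ts = {}"
  then have "M = {\<one>}" using generate_factors generate_empty by simp
  then show False using plinth_nontrivial by simp
qed

lemma Mb_proper: "Mb \<noteq> M"
proof
  assume *: "Mb = M"
  obtain K where K: "K \<in> \<K>" using \<K>_nonempty by blast
  obtain T where T: "T \<in> Ts" using Ts_nonempty by blast
  show False using Mb_subset_bar[OF K] bar_proper[OF K T] * by (auto simp: bar_iff)
qed

text \<open>Conjugation by \<open>H\<close> permutes the groups \<open>bar K\<close> whose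
  intersection \<open>Mb\<close> is.\<close>

lemma Mb_conj:
  assumes h: "h \<in> H"
  shows "conj_set S h Mb = Mb"
proof (rule conj_set_invariant[OF H_subgroup _ _ h])
  show "Mb \<subseteq> carrier S" by (rule subgroup.subset[OF Mb_subgroup])
  fix h x assume h: "h \<in> H" and x: "x \<in> Mb"
  have "h \<otimes> x \<otimes> inv h \<in> bar K" if K: "K \<in> \<K>" for K
  proof -
    have ih: "inv h \<in> H" by (rule subgroup.m_inv_closed[OF H_subgroup h])
    have L: "conj_set S (inv h) K \<in> \<K>" by (rule \<K>_conj[OF ih K])
    have hL: "conj_set S h (conj_set S (inv h) K) = K"
      by (rule conj_set_conj_set_inv[OF H_car[OF h] subgroup.subset[OF \<K>_member(1)[OF K]]])
    have "h \<otimes> x \<otimes> inv h \<in> conj_set S h (bar (conj_set S (inv h) K))"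
      unfolding conj_set_image[of S h]
    proof (rule image_eqI[where x = x])
      show "h \<otimes> x \<otimes> inv h = h \<otimes> x \<otimes> inv h" ..
      show "x \<in> bar (conj_set S (inv h) K)" using x Mb_subset_bar[OF L] by blast
    qed
    then show ?thesis using conj_set_bar_\<K>[OF h L] hL by simp
  qed
  then show "h \<otimes> x \<otimes> inv h \<in> Mb" by (simp add: Mb_def)
qed

text \<open>An element of both projections, viewed in \<open>M\<close>, already lies in
  \<open>Mb\<close>: over \<open>T\<close> every member projects onto \<open>T\<close> or to one of
  these two subgroups, and over the other factors its component is the identity.\<close>

lemma proj_Mb:
  assumes T1: "T1 \<in> Ts" and AB1: "P T1 = {A1, B1}" and T: "T \<in> Ts"
  shows "\<sigma> T ` member_over \<Omega> G M Ts \<omega> E A1 T \<inter> \<sigma> T ` member_over \<Omega> G M Ts \<omega> E B1 T = \<sigma> T ` Mb"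
    (is "?A \<inter> ?B = _")
proof (intro equalityI subsetI)
  note PT = P_eq[OF T1 AB1 T]
  fix t assume t: "t \<in> ?A \<inter> ?B"
  have tT: "t \<in> T" using t AB_subgroup(2)[OF T1 AB1 T] by blast
  have "t \<in> bar K" if K: "K \<in> \<K>" for K
  proof -
    have "\<sigma> T' t \<in> \<sigma> T' ` K" if T': "T' \<in> Ts" for T'
    proof (cases "T' = T")
      case True
      have "t \<in> \<sigma> T ` K"
      proof (cases "\<sigma> T ` K = T")
        case True
        then show ?thesis using tT by simp
      next
        case False
        then have "\<sigma> T ` K \<in> P T" unfolding P_iff using K by (intro bexI[of _ K] conjI refl)
        then show ?thesis unfolding PT by (rule mem_Int_pairD[OF t])
      qed
      then show ?thesis using True proj_factor[OF T tT] by simp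
    next
      case False
      then show ?thesis
        using proj_other[OF T' T _ tT] subgroup.one_closed[OF proj_subgroup(1)[OF T' \<K>_member(1,2)[OF K]]]
        by simp
    qed
    then show ?thesis using tT factor_subset[OF T] by (auto simp: bar_iff)
  qed
  then have "t \<in> Mb" by (simp add: Mb_def)
  then have "\<sigma> T t \<in> \<sigma> T ` Mb" by (rule imageI)
  then show "t \<in> \<sigma> T ` Mb" unfolding proj_factor[OF T tT] .
next
  fix t assume "t \<in> \<sigma> T ` Mb"
  then obtain x where x: "x \<in> Mb" "t = \<sigma> T x" by (rule imageE)
  have "t \<in> \<sigma> T ` K" if "K \<in> \<K>" for K
    using x Mb_subset_bar[OF that] T by (auto simp: bar_iff)
  then show "t \<in> ?A \<inter> ?B"
    using member_over(1)[OF T1 AB1_mem(1)[OF T1 AB1] T] member_over(1)[OF T1 AB1_mem(2)[OF T1 AB1] T] by blast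
qed

section \<open>Blocks of the quotient and the induced homomorphism\<close>

definition "\<Omega>b = translates M (point_orbit \<Omega> Mb \<omega>)"
definition "\<omega>b = block_of \<Omega>b \<omega>"

lemma \<omega>b_eq: "\<omega>b = point_orbit \<Omega> Mb \<omega>"
  unfolding \<omega>b_def \<Omega>b_def by (rule block_of_base[OF Mb_subgroup Mb_subset base Mb_stab])

lemma \<omega>b_mem: "\<omega>b \<in> \<Omega>b"
  unfolding \<omega>b_eq \<Omega>b_def by (rule orbit_in_translates[OF Mb_subgroup Mb_subset base Mb_stab])

lemma \<Omega>b_Pow: "\<Omega>b \<subseteq> Pow \<Omega>"
  using partition_onD1[OF translates_partition[OF Mb_subgroup Mb_subset base Mb_stab]] unfolding \<Omega>b_def by blast

lemma \<Omega>b_finite: "finite \<Omega>b"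
  using finite_subset[OF \<Omega>b_Pow] finite_space by simp

text \<open>For \<open>g = m \<otimes> h\<close>, translates of the \<open>Mb\<close>-orbit go to
  translates of the orbit of the \<open>h\<close>-conjugate of \<open>Mb\<close>, which is
  \<open>Mb\<close> again.\<close>

lemma \<Omega>b_image: "g \<in> G \<Longrightarrow> (\<lambda>B. g ` B) ` \<Omega>b = \<Omega>b"
proof -
  assume g: "g \<in> G"
  obtain m h where mh: "m \<in> M" "h \<in> H" "g = m \<otimes> h"
    using plinth_stab_split[OF g base] by blast
  show ?thesis
    using image_translates[OF mh(2) base Mb_subset mh(1)] unfolding \<Omega>b_def mh(3) Mb_conj[OF mh(2)] .
qed

definition "\<phi> = induced_perm \<Omega>b"

lemma \<phi>_apply: "B \<in> \<Omega>b \<Longrightarrow> \<phi> g B = g ` B"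
  by (simp add: \<phi>_def induced_perm_def)

lemma \<phi>_eq: "\<phi> = (\<lambda>g. \<lambda>B\<in>\<Omega>b. g ` B)"
  by (auto simp: \<phi>_def induced_perm_def fun_eq_iff)

lemma \<phi>_action: "K \<subseteq> G \<Longrightarrow> subgroup K S \<Longrightarrow> group_action (S\<lparr>carrier := K\<rparr>) \<Omega>b \<phi>"
  unfolding \<phi>_eq
proof (rule group_actionI)
  assume KG: "K \<subseteq> G"
  show "g ` B \<in> \<Omega>b" if "g \<in> K" "B \<in> \<Omega>b" for g B
    using \<Omega>b_image[of g] that KG by blast
  show "\<one> ` B = B" if "B \<in> \<Omega>b" for B
    by (rule perm_image_one) (use that \<Omega>b_Pow in blast)
  show "(g \<otimes> h) ` B = g ` (h ` B)" if "g \<in> K" "h \<in> K" "B \<in> \<Omega>b" for g h B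
    by (rule perm_image_mult) (use that KG \<Omega>b_Pow G_car in auto)
qed

lemma \<phi>_hom: "group_hom (S\<lparr>carrier := G\<rparr>) (BijGroup \<Omega>b) \<phi>"
  using \<phi>_action[OF order_refl G] by (simp add: group_action_def)

lemma \<phi>_hom_M: "group_hom (S\<lparr>carrier := M\<rparr>) (BijGroup \<Omega>b) \<phi>"
  using \<phi>_action[OF plinth_subset M] by (simp add: group_action_def)

abbreviation "Sb \<equiv> BijGroup \<Omega>b"

lemma \<phi>_mult: "g \<in> G \<Longrightarrow> h \<in> G \<Longrightarrow> \<phi> (g \<otimes> h) = \<phi> g \<otimes>\<^bsub>Sb\<^esub> \<phi> h"
  using group_hom.axioms(3)[OF \<phi>_hom] by (simp add: group_hom_axioms_def hom_def)

lemma \<phi>_one: "\<phi> \<one> = \<one>\<^bsub>Sb\<^esub>"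
  using group_hom.hom_one[OF \<phi>_hom] by simp

lemma \<phi>_inv: "g \<in> G \<Longrightarrow> \<phi> (inv g) = inv\<^bsub>Sb\<^esub> \<phi> g"
  using group_hom.hom_inv[OF \<phi>_hom, of g] m_inv_consistent[OF G] by simp

lemma \<phi>_conj: 
  assumes "g \<in> G" "x \<in> G"
  shows "\<phi> (g \<otimes> x \<otimes> inv g) = \<phi> g \<otimes>\<^bsub>Sb\<^esub> \<phi> x \<otimes>\<^bsub>Sb\<^esub> inv\<^bsub>Sb\<^esub> \<phi> g"
  using assms subgroup.m_closed[OF G] subgroup.m_inv_closed[OF G] by (simp add: \<phi>_mult \<phi>_inv)

lemma \<phi>_conj_set:
  assumes "g \<in> G" "X \<subseteq> G"
  shows "conj_set Sb (\<phi> g) (\<phi> ` X) = \<phi> ` conj_set S g X"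
  unfolding conj_set_image image_image
  by (rule image_cong[OF refl]) (use \<phi>_conj[OF assms(1)] assms(2) in auto)

lemma \<phi>_inj: "inj_on \<phi> M"
proof -
  define N where "N = {m \<in> M. \<phi> m = \<one>\<^bsub>Sb\<^esub>}"
  interpret b: group Sb by (rule group_BijGroup)
  have NM: "N \<subseteq> M" by (auto simp: N_def)
  have NG: "n \<in> G" if "n \<in> N" for n using that plinth_subset by (auto simp: N_def)
  have N: "subgroup N S"
  proof (rule subgroupI)
    show "N \<subseteq> carrier S" using NM M_car by blast
    have "\<one> \<in> N" using \<phi>_one subgroup.one_closed[OF M] by (simp add: N_def)
    then show "N \<noteq> {}" by blast
    show "inv n \<in> N" if n: "n \<in> N" for n
      using \<phi>_inv[OF NG[OF n]] n subgroup.m_inv_closed[OF M] by (simp add: N_def)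
    show "m \<otimes> n \<in> N" if "m \<in> N" "n \<in> N" for m n
      using \<phi>_mult[OF NG NG, of m n] that subgroup.m_closed[OF M] by (simp add: N_def)
  qed
  have "N = {\<one>} \<or> N = M"
  proof (rule plinth_minimal[OF N NM])
    fix g n assume g: "g \<in> G" and n: "n \<in> N"
    have "\<phi> g \<in> carrier Sb" using group_hom.hom_closed[OF \<phi>_hom, of g] g by simp
    then have "\<phi> (g \<otimes> n \<otimes> inv g) = \<one>\<^bsub>Sb\<^esub>"
      using \<phi>_conj[OF g NG[OF n]] n by (simp add: N_def)
    then show "g \<otimes> n \<otimes> inv g \<in> N" using plinth_conj[OF g] n by (simp add: N_def)
  qed
  moreover have "N \<noteq> M"
  proof
    assume NMeq: "N = M"
    \<comment> \<open>If all of \<open>M\<close> acted trivially it would fix the block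
      \<open>\<omega>b\<close>, whose stabiliser in \<open>M\<close> is \<open>Mb\<close>.\<close>
    have "m \<in> Mb" if m: "m \<in> M" for m
    proof -
      have "m \<in> N" using m unfolding NMeq .
      then have "\<phi> m = \<one>\<^bsub>Sb\<^esub>" by (simp add: N_def)
      then have "\<phi> m \<omega>b = \<omega>b" using \<omega>b_mem by (simp add: BijGroup_def)
      then have "m \<in> set_stab \<Omega> M (point_orbit \<Omega> Mb \<omega>)"
        using m \<phi>_apply[OF \<omega>b_mem] by (simp add: set_stab_iff \<omega>b_eq)
      then show ?thesis unfolding set_stab_orbit[OF Mb_subgroup Mb_subset base Mb_stab] .
    qed
    then show False using Mb_subset Mb_proper by blast
  qed
  ultimately have N1: "N = {\<one>}" by blast
  show ?thesis
  proof (rule inj_onI)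
    fix x y assume xy: "x \<in> M" "y \<in> M" "\<phi> x = \<phi> y"
    have xG: "x \<in> G" "y \<in> G" "inv x \<in> G"
      using xy plinth_subset subgroup.m_inv_closed[OF M] by auto
    have "\<phi> x \<in> carrier Sb" using group_hom.hom_closed[OF \<phi>_hom, of x] xG by simp
    then have "\<phi> (inv x \<otimes> y) = \<one>\<^bsub>Sb\<^esub>"
      using \<phi>_mult[OF xG(3,2)] \<phi>_inv[OF xG(1)] xy(3) by simp
    then have "inv x \<otimes> y \<in> N"
      using xy subgroup.m_closed[OF M] subgroup.m_inv_closed[OF M] by (simp add: N_def)
    then have "inv x \<otimes> y = \<one>" using N1 by blast
    then have "x \<otimes> (inv x \<otimes> y) = x \<otimes> \<one>" by simp
    then show "x = y" using xy M_car by (simp flip: m_assoc)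
  qed
qed

lemma faithful: "faithful_action (S\<lparr>carrier := M\<rparr>) \<Omega>b \<phi>"
  by (intro faithful_action.intro faithful_action_axioms.intro \<phi>_action[OF plinth_subset M])
    (simp add: \<phi>_inj)

lemma Gb_subgroup: "subgroup (\<phi> ` G) Sb"
  using group_hom.img_is_subgroup[OF \<phi>_hom] by simp

lemma \<phi>_image_subgroup: "subgroup K S \<Longrightarrow> K \<subseteq> G \<Longrightarrow> subgroup (\<phi> ` K) Sb"
  using group_hom.subgroup_img_is_subgroup[OF \<phi>_hom, of K] subgroup_restrict_iff[OF G] by blast

text \<open>Minimality is pulled back: the part of \<open>M\<close> that maps into a normal subgroup
  of the image of \<open>G\<close> is normal in \<open>G\<close>. Injectivity of
  \<open>\<phi>\<close> on \<open>M\<close> enters only in the nontriviality of the image.\<close>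

lemma plinth_b: "plinth \<Omega>b (\<phi> ` G) (\<phi> ` M)"
proof -
  interpret b: perm_space \<Omega>b Sb by unfold_locales simp
  have Mbs: "subgroup (\<phi> ` M) Sb" by (rule \<phi>_image_subgroup[OF M plinth_subset])
  have norm: "\<phi> ` M \<lhd> Sb\<lparr>carrier := \<phi> ` G\<rparr>"
    unfolding b.normal_restrict_iff[OF Gb_subgroup]
  proof (intro conjI Mbs image_mono plinth_subset ballI)
    fix x y assume "x \<in> \<phi> ` G" "y \<in> \<phi> ` M"
    then obtain g m where gm: "g \<in> G" "m \<in> M" "x = \<phi> g" "y = \<phi> m" by blast
    then have "x \<otimes>\<^bsub>Sb\<^esub> y \<otimes>\<^bsub>Sb\<^esub> inv\<^bsub>Sb\<^esub> x = \<phi> (g \<otimes> m \<otimes> inv g)"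
      using \<phi>_conj[OF gm(1), of m] plinth_subset by auto
    then show "x \<otimes>\<^bsub>Sb\<^esub> y \<otimes>\<^bsub>Sb\<^esub> inv\<^bsub>Sb\<^esub> x \<in> \<phi> ` M" using plinth_conj[OF gm(1,2)] by simp
  qed
  have nontriv: "\<phi> ` M \<noteq> {\<one>\<^bsub>Sb\<^esub>}"
  proof
    assume *: "\<phi> ` M = {\<one>\<^bsub>Sb\<^esub>}"
    have "m = \<one>" if m: "m \<in> M" for m
    proof (rule inj_onD[OF \<phi>_inj _ m subgroup.one_closed[OF M]])
      have "\<phi> m \<in> \<phi> ` M" using m by (rule imageI)
      then show "\<phi> m = \<phi> \<one>" unfolding * \<phi>_one by simp
    qed
    then show False using plinth_nontrivial subgroup.one_closed[OF M] by blast
  qed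
  have minimal: "N' = {\<one>\<^bsub>Sb\<^esub>} \<or> N' = \<phi> ` M"
    if N': "N' \<lhd> Sb\<lparr>carrier := \<phi> ` G\<rparr>" "N' \<subseteq> \<phi> ` M" for N'
  proof -
    note N'' = N'(1)[unfolded b.normal_restrict_iff[OF Gb_subgroup]]
    \<comment> \<open>Elements of \<open>M\<close> only, so that minimality of the plinth applies;
      \<open>N'\<close> is still all of the image of \<open>N\<close>, being contained in the image
      of \<open>M\<close>.\<close>
    define N where "N = {m \<in> M. \<phi> m \<in> N'}"
    have NM: "N \<subseteq> M" by (auto simp: N_def)
    have NG: "n \<in> G" if "n \<in> N" for n using that plinth_subset by (auto simp: N_def)
    have N: "subgroup N S"
    proof (rule subgroupI)
      show "N \<subseteq> carrier S" using NM M_car by blast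
      have "\<one> \<in> N" using \<phi>_one subgroup.one_closed[OF M] subgroup.one_closed[of N' Sb] N'' by (simp add: N_def)
      then show "N \<noteq> {}" by blast
      show "inv n \<in> N" if n: "n \<in> N" for n
        using \<phi>_inv[OF NG[OF n]] n subgroup.m_inv_closed[OF M] subgroup.m_inv_closed[of N' Sb] N''
        by (simp add: N_def)
      show "m \<otimes> n \<in> N" if "m \<in> N" "n \<in> N" for m n
        using \<phi>_mult[OF NG NG, of m n] that subgroup.m_closed[OF M] subgroup.m_closed[of N' Sb] N''
        by (simp add: N_def)
    qed
    have "N = {\<one>} \<or> N = M"
    proof (rule plinth_minimal[OF N NM])
      fix g n assume g: "g \<in> G" and n: "n \<in> N"
      have "\<phi> (g \<otimes> n \<otimes> inv g) \<in> N'"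
        using \<phi>_conj[OF g NG[OF n]] n g N'' by (simp add: N_def)
      then show "g \<otimes> n \<otimes> inv g \<in> N" using plinth_conj[OF g] n by (simp add: N_def)
    qed
    moreover have "N' = \<phi> ` N" using N'(2) by (auto simp: N_def)
    ultimately show ?thesis using \<phi>_one by auto
  qed
  have "transitive_action (Sb\<lparr>carrier := \<phi> ` M\<rparr>) \<Omega>b (\<lambda>g. g)"
  proof (intro transitive_action.intro transitive_action_axioms.intro b.inclusion_action[OF Mbs])
    fix B B' assume "B \<in> \<Omega>b" "B' \<in> \<Omega>b"
    then obtain m m' where m: "m \<in> M" "B = m ` \<omega>b" and m': "m' \<in> M" "B' = m' ` \<omega>b"
      unfolding \<Omega>b_def translates_def \<omega>b_eq by blast
    have car: "m \<in> carrier S" "m' \<in> carrier S" using m m' M_car by auto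
    have "\<omega>b \<subseteq> \<Omega>" using \<omega>b_mem \<Omega>b_Pow by blast
    then have "(m' \<otimes> inv m) ` B = B'"
      using m m' car by (simp add: perm_image_mult perm_image_closed perm_image_inv)
    then have "\<phi> (m' \<otimes> inv m) B = B'" using \<phi>_apply[OF \<open>B \<in> \<Omega>b\<close>] by simp
    moreover have "m' \<otimes> inv m \<in> M"
      using m m' subgroup.m_closed[OF M] subgroup.m_inv_closed[OF M] by blast
    ultimately show "\<exists>g\<in>carrier (Sb\<lparr>carrier := \<phi> ` M\<rparr>). g B = B'" by auto
  qed
  then show ?thesis
    unfolding plinth_def minimal_normal_def using norm nontriv minimal by simp
qed

lemma innately_transitive_b: "innately_transitive \<Omega>b Sb (\<phi> ` G) (\<phi> ` M)"
  by (intro innately_transitive.intro innately_transitive_axioms.intro perm_space.intro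
      refl \<Omega>b_finite Gb_subgroup plinth_b)

sublocale b: innately_transitive \<Omega>b Sb "\<phi> ` G" "\<phi> ` M"
  by (rule innately_transitive_b)

section \<open>The Cartesian system and decomposition of the quotient\<close>

abbreviation "\<K>b \<equiv> (\<lambda>K. \<phi> ` K) ` bar ` \<K>"
abbreviation "Tsb \<equiv> (\<lambda>T. \<phi> ` T) ` Ts"

lemma factors_b: "factor_decomposition Sb (\<phi> ` M) Tsb"
  by (rule factor_decomposition_image(1)[OF factors \<phi>_hom_M \<phi>_inj])

lemma proj_b: "T \<in> Ts \<Longrightarrow> m \<in> M \<Longrightarrow> factor_proj Sb Tsb (\<phi> ` T) (\<phi> m) = \<phi> (\<sigma> T m)"
  by (rule factor_decomposition_image(2)[OF factors \<phi>_hom_M \<phi>_inj])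

lemma bar_M: "bar K \<subseteq> M"
  by (auto simp: bar_iff)

text \<open>Enlarging the members preserves the factorisations, since
  \<open>K \<subseteq> bar K\<close>. What changes is the intersection, from the stabiliser of
  \<open>\<omega>\<close> to \<open>Mb\<close>, and that is the stabiliser of the block
  \<open>\<omega>b\<close>.\<close>

lemma \<K>b_system: "cartesian_system \<Omega>b (\<phi> ` M) \<omega>b \<K>b"
  unfolding cartesian_system_def
proof (intro conjI ballI)
  show "\<K>b \<noteq> {}" using \<K>_nonempty by simp
next
  fix X assume "X \<in> \<K>b"
  then obtain K where K: "K \<in> \<K>" "X = \<phi> ` bar K" by blast
  show "subgroup X (Sb\<lparr>carrier := \<phi> ` M\<rparr>)"
    unfolding b.subgroup_restrict_iff[OF b.M] K(2)
  proof
    show "subgroup (\<phi> ` bar K) Sb"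
      by (rule \<phi>_image_subgroup[OF bar_member(1)[OF K(1)] order_trans[OF bar_M plinth_subset]])
    show "\<phi> ` bar K \<subseteq> \<phi> ` M" by (rule image_mono[OF bar_M])
  qed
  obtain T where T: "T \<in> Ts" using Ts_nonempty by blast
  show "X \<noteq> \<phi> ` M"
    using inj_on_image_eq_iff[OF \<phi>_inj bar_M order_refl] bar_proper[OF K(1) T] unfolding K(2) by simp
  show "X <#>\<^bsub>Sb\<^esub> (\<phi> ` M \<inter> \<Inter>(\<K>b - {X})) = \<phi> ` M"
  proof (intro equalityI subsetI)
    fix y assume "y \<in> X <#>\<^bsub>Sb\<^esub> (\<phi> ` M \<inter> \<Inter>(\<K>b - {X}))"
    then obtain u v where "u \<in> X" "v \<in> \<phi> ` M" "y = u \<otimes>\<^bsub>Sb\<^esub> v" unfolding set_mult_def by blast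
    moreover have "X \<subseteq> \<phi> ` M" unfolding K(2) by (rule image_mono[OF bar_M])
    ultimately show "y \<in> \<phi> ` M" using subgroup.m_closed[OF b.M] by blast
  next
    fix y assume "y \<in> \<phi> ` M"
    then obtain m where m: "m \<in> M" "y = \<phi> m" by blast
    note m(1)
    also have "M = K <#> (M \<inter> \<Inter>(\<K> - {K}))"
      using system K(1) unfolding cartesian_system_def S_def by simp
    finally obtain k c where kc: "k \<in> K" "c \<in> M" "c \<in> \<Inter>(\<K> - {K})" "m = k \<otimes> c"
      unfolding set_mult_def by blast
    have "k \<in> G" "c \<in> G" using kc \<K>_member(2)[OF K(1)] plinth_subset by auto
    then have "y = \<phi> k \<otimes>\<^bsub>Sb\<^esub> \<phi> c" unfolding m(2) kc(4) by (rule \<phi>_mult)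
    moreover have "\<phi> k \<in> X" unfolding K(2) using kc(1) bar_member(2)[OF K(1)] by blast
    moreover have "\<phi> c \<in> Y" if Y: "Y \<in> \<K>b - {X}" for Y
    proof -
      obtain L where L: "L \<in> \<K>" "Y = \<phi> ` bar L" using Y by blast
      \<comment> \<open>Different images come from different members, so \<open>c\<close> lies in
        \<open>L\<close> and therefore in the larger \<open>bar L\<close>.\<close>
      then have "L \<noteq> K" using Y K(2) by blast
      then have "c \<in> L" using kc(3) L(1) by blast
      then show ?thesis unfolding L(2) using bar_member(2)[OF L(1)] by blast
    qed
    ultimately show "y \<in> X <#>\<^bsub>Sb\<^esub> (\<phi> ` M \<inter> \<Inter>(\<K>b - {X}))"
      using imageI[OF kc(2), of \<phi>] by (simp only:) (intro set_multI IntI InterI)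
  qed
next
  have stab: "point_stab \<Omega>b (\<phi> ` M) \<omega>b = \<phi> ` Mb"
  proof -
    have "\<phi> m \<omega>b = \<omega>b \<longleftrightarrow> m \<in> Mb" if m: "m \<in> M" for m
    proof -
      have "\<phi> m \<omega>b = \<omega>b \<longleftrightarrow> m \<in> set_stab \<Omega> M (point_orbit \<Omega> Mb \<omega>)"
        using m \<phi>_apply[OF \<omega>b_mem] by (simp add: set_stab_iff \<omega>b_eq)
      then show ?thesis unfolding set_stab_orbit[OF Mb_subgroup Mb_subset base Mb_stab] .
    qed
    then show ?thesis using Mb_subset by (auto simp: point_stab_iff)
  qed
  \<comment> \<open>Image and intersection commute because \<open>\<phi>\<close> is injective on
    \<open>M\<close>, which contains every \<open>bar K\<close>.\<close>
  have "\<phi> ` Mb = \<Inter>\<K>b"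
    unfolding Mb_def
    using image_INT[OF \<phi>_inj, of \<K> bar] \<K>_nonempty bar_M by (auto simp: image_image)
  then show "\<Inter>\<K>b = point_stab \<Omega>b (\<phi> ` M) \<omega>b" using stab by simp
qed

text \<open>In \<open>g = m \<otimes> h\<close> the element \<open>h\<close> fixes
  \<open>\<omega>b\<close> because \<open>H\<close> normalises \<open>Mb\<close>; hence
  \<open>m\<close> fixes \<open>\<omega>b\<close> too, and so lies in \<open>Mb\<close>.\<close>

lemma set_stab_split:
  assumes "g \<in> set_stab \<Omega> G \<omega>b"
  shows "\<exists>m\<in>Mb. \<exists>h\<in>H. g = m \<otimes> h"
proof -
  have g: "g \<in> G" "g ` \<omega>b = \<omega>b" using assms by (auto simp: set_stab_iff)
  obtain m h where mh: "m \<in> M" "h \<in> H" "g = m \<otimes> h"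
    using plinth_stab_split[OF g(1) base] by blast
  have "\<omega>b \<subseteq> \<Omega>" using \<omega>b_mem \<Omega>b_Pow by blast
  moreover have "h ` \<omega>b = \<omega>b"
    using image_orbit[OF mh(2) base Mb_subset] unfolding \<omega>b_eq Mb_conj[OF mh(2)] .
  ultimately have "m ` \<omega>b = \<omega>b"
    using g(2) unfolding mh(3) by (simp add: perm_image_mult[OF M_car[OF mh(1)] H_car[OF mh(2)]])
  then have "m \<in> set_stab \<Omega> M (point_orbit \<Omega> Mb \<omega>)" using mh(1) by (simp add: set_stab_iff \<omega>b_eq)
  then have "m \<in> Mb" unfolding set_stab_orbit[OF Mb_subgroup Mb_subset base Mb_stab] .
  then show ?thesis using mh by blast
qed

lemma point_stab_b: "point_stab \<Omega>b (\<phi> ` G) \<omega>b = \<phi> ` set_stab \<Omega> G \<omega>b"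
  using \<phi>_apply[OF \<omega>b_mem] by (auto simp: point_stab_iff set_stab_iff)

lemma H_set_stab: "h \<in> H \<Longrightarrow> h \<in> set_stab \<Omega> G \<omega>b"
  using image_orbit[OF _ base Mb_subset, of h] Mb_conj[of h] H_G[of h] by (simp add: set_stab_iff \<omega>b_eq)

lemma \<K>b_conj_H:
  assumes h: "h \<in> H" and K: "K \<in> \<K>"
  shows "conj_set Sb (\<phi> h) (\<phi> ` bar K) = \<phi> ` bar (conj_set S h K)"
  unfolding \<phi>_conj_set[OF H_G[OF h] order_trans[OF bar_M plinth_subset]] conj_set_bar_\<K>[OF h K] ..

text \<open>The part of \<open>g\<close> in \<open>Mb\<close> lies in every \<open>bar L\<close> and
  so normalises it; only the part in \<open>H\<close> moves anything.\<close>

lemma \<K>b_conj: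
  assumes y: "y \<in> \<phi> ` set_stab \<Omega> G \<omega>b" and X: "X \<in> \<K>b"
  shows "conj_set Sb y X \<in> \<K>b"
proof -
  obtain g where g: "g \<in> set_stab \<Omega> G \<omega>b" "y = \<phi> g" using y by (rule imageE)
  obtain m h where mh: "m \<in> Mb" "h \<in> H" "g = m \<otimes> h" using set_stab_split[OF g(1)] by blast
  obtain K where K: "K \<in> \<K>" "X = \<phi> ` bar K" using X by blast
  have m: "m \<in> M" "m \<in> G" using mh(1) Mb_subset plinth_subset by auto
  have L: "conj_set S h K \<in> \<K>" by (rule \<K>_conj[OF mh(2) K(1)])
  have mL: "m \<in> bar (conj_set S h K)" using Mb_subset_bar[OF L] mh(1) by blast
  have "conj_set S g (bar K) = conj_set S m (conj_set S h (bar K))"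
    unfolding mh(3)
    by (rule conj_set_mult[OF M_car[OF m(1)] H_car[OF mh(2)] subgroup.subset[OF bar_member(1)[OF K(1)]]])
  also have "\<dots> = bar (conj_set S h K)"
    unfolding conj_set_bar_\<K>[OF mh(2) K(1)] by (rule conj_set_self[OF bar_member(1)[OF L] mL])
  finally have eq: "conj_set S g (bar K) = bar (conj_set S h K)" .
  have gG: "g \<in> G" using g(1) by (simp add: set_stab_iff)
  have "conj_set Sb y X = \<phi> ` bar (conj_set S h K)"
    unfolding g(2) K(2) \<phi>_conj_set[OF gG order_trans[OF bar_M plinth_subset]] eq ..
  then show ?thesis using L by blast
qed

abbreviation "Eb \<equiv> decomposition_of_system \<Omega>b (\<phi> ` M) \<omega>b \<K>b"

lemma \<K>b_finite: "finite \<K>b"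
  using \<K>_finite by simp

lemma Eb_CD_tr: "Eb \<in> CD_tr \<Omega>b (\<phi> ` G)"
proof (rule b.decomposition_of_system_CD_tr[OF \<K>b_system \<omega>b_mem \<K>b_finite])
  show "conj_set Sb y X \<in> \<K>b" if "y \<in> point_stab \<Omega>b (\<phi> ` G) \<omega>b" "X \<in> \<K>b" for y X
    by (rule \<K>b_conj[OF that(1)[unfolded point_stab_b] that(2)])
  fix X Y assume "X \<in> \<K>b" "Y \<in> \<K>b"
  then obtain K L where K: "K \<in> \<K>" "X = \<phi> ` bar K" and L: "L \<in> \<K>" "Y = \<phi> ` bar L" by blast
  obtain h where h: "h \<in> H" "conj_set S h K = L" using \<K>_transitive[OF K(1) L(1)] by (rule bexE)
  have "conj_set Sb (\<phi> h) X = Y" using \<K>b_conj_H[OF h(1) K(1)] unfolding K(2) L(2) h(2) .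
  moreover have "\<phi> h \<in> point_stab \<Omega>b (\<phi> ` G) \<omega>b"
    unfolding point_stab_b by (rule imageI[OF H_set_stab[OF h(1)]])
  ultimately show "\<exists>y\<in>point_stab \<Omega>b (\<phi> ` G) \<omega>b. conj_set Sb y X = Y" by blast
qed

text \<open>Passing to \<open>bar\<close> leaves projections unchanged and \<open>\<phi>\<close>
  intertwines the projections of the two decompositions; injectivity on \<open>M\<close> keeps
  proper subgroups of \<open>T\<close> proper.\<close>

lemma projections_b:
  assumes T: "T \<in> Ts"
  shows "proper_projections \<Omega>b (\<phi> ` M) Tsb \<omega>b Eb (\<phi> ` T) = (\<lambda>X. \<phi> ` X) ` P T"
proof -
  have sys: "system_of_decomposition \<Omega>b (\<phi> ` M) \<omega>b Eb = \<K>b"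
    by (rule b.system_of_decomposition_of_system[OF \<K>b_system \<omega>b_mem])
  have proj: "factor_proj Sb Tsb (\<phi> ` T) ` \<phi> ` bar K = \<phi> ` \<sigma> T ` K" if K: "K \<in> \<K>" for K
  proof -
    have "factor_proj Sb Tsb (\<phi> ` T) ` \<phi> ` bar K = \<phi> ` \<sigma> T ` bar K"
      unfolding image_image by (rule image_cong[OF refl proj_b[OF T]]) (use bar_M in blast)
    then show ?thesis unfolding bar_member(3)[OF K T] .
  qed
  have ne: "\<phi> ` \<sigma> T ` K \<noteq> \<phi> ` T \<longleftrightarrow> \<sigma> T ` K \<noteq> T" if K: "K \<in> \<K>" for K
    using inj_on_image_eq_iff[OF \<phi>_inj order_trans[OF proj_subgroup(2)[OF T \<K>_member(1,2)[OF K]] factor_subset[OF T]]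
        factor_subset[OF T]] by simp
  show ?thesis
  proof (intro equalityI subsetI)
    fix X assume "X \<in> proper_projections \<Omega>b (\<phi> ` M) Tsb \<omega>b Eb (\<phi> ` T)"
    then obtain Y where Y: "Y \<in> \<K>b" "X = factor_proj Sb Tsb (\<phi> ` T) ` Y" "X \<noteq> \<phi> ` T"
      unfolding proper_projections_def sys by blast
    obtain K where K: "K \<in> \<K>" "Y = \<phi> ` bar K" using Y(1) by blast
    have X: "X = \<phi> ` \<sigma> T ` K" using Y(2) unfolding K(2) proj[OF K(1)] .
    have "\<sigma> T ` K \<noteq> T" using Y(3) ne[OF K(1)] unfolding X by simp
    then have "\<sigma> T ` K \<in> P T" unfolding P_iff using K(1) by (intro bexI[of _ K] conjI refl)
    then show "X \<in> (\<lambda>X. \<phi> ` X) ` P T" unfolding X by (rule imageI[where f = "\<lambda>X. \<phi> ` X"])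
  next
    fix X assume "X \<in> (\<lambda>X. \<phi> ` X) ` P T"
    then obtain A where A: "A \<in> P T" "X = \<phi> ` A" by (rule imageE)
    obtain K where K: "K \<in> \<K>" "A = \<sigma> T ` K" "A \<noteq> T" using A(1) by (rule P_E[OF _ T])
    have X: "X = factor_proj Sb Tsb (\<phi> ` T) ` \<phi> ` bar K" unfolding proj[OF K(1)] A(2) K(2) ..
    have "X \<noteq> \<phi> ` T" using ne[OF K(1)] K(3) unfolding A(2) K(2) by simp
    moreover have "\<phi> ` bar K \<in> \<K>b" using K(1) by blast
    ultimately show "X \<in> proper_projections \<Omega>b (\<phi> ` M) Tsb \<omega>b Eb (\<phi> ` T)"
      unfolding proper_projections_def sys mem_Collect_eq X by (intro exI[of _ "\<phi> ` bar K"] conjI refl)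
  qed
qed

lemma P_M: "T \<in> Ts \<Longrightarrow> A \<in> P T \<Longrightarrow> A \<subseteq> M"
  using factor_subset by (blast elim: P_E)

lemma Eb_CD_2nc: "Eb \<in> CD_2nc \<Omega>b (\<phi> ` G) (\<phi> ` M) Tsb"
proof (rule b.CD_2ncI[OF factors_b Eb_CD_tr \<omega>b_mem])
  fix Tb assume "Tb \<in> Tsb"
  then obtain T where T: "T \<in> Ts" "Tb = \<phi> ` T" by (rule imageE)
  have inj: "inj_on (\<lambda>X. \<phi> ` X) (P T)"
  proof (rule inj_onI)
    fix X Y assume X: "X \<in> P T" and Y: "Y \<in> P T" and eq: "\<phi> ` X = \<phi> ` Y"
    show "X = Y"
      using inj_on_image_eq_iff[OF \<phi>_inj P_M[OF T(1) X] P_M[OF T(1) Y]] eq by simp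
  qed
  show "card (proper_projections \<Omega>b (\<phi> ` M) Tsb \<omega>b Eb Tb) = 2"
    unfolding T(2) projections_b[OF T(1)] card_image[OF inj] by (rule P_card[OF T(1)])
  fix X Y assume "X \<in> proper_projections \<Omega>b (\<phi> ` M) Tsb \<omega>b Eb Tb"
    and "Y \<in> proper_projections \<Omega>b (\<phi> ` M) Tsb \<omega>b Eb Tb" and XY: "X \<noteq> Y"
  then obtain A B where A: "A \<in> P T" "X = \<phi> ` A" and B: "B \<in> P T" "Y = \<phi> ` B"
    unfolding T(2) projections_b[OF T(1)] by blast
  have AB: "A \<noteq> B" using XY A B by blast
  show "\<not> conjugate_under Sb (point_stab \<Omega>b (\<phi> ` G) \<omega>b) X Y"
  proof
    assume "conjugate_under Sb (point_stab \<Omega>b (\<phi> ` G) \<omega>b) X Y"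
    then obtain g where g: "g \<in> set_stab \<Omega> G \<omega>b" "Y = conj_set Sb (\<phi> g) X"
      unfolding conjugate_under_def point_stab_b by blast
    obtain m h where mh: "m \<in> Mb" "h \<in> H" "g = m \<otimes> h" using set_stab_split[OF g(1)] by blast
    have m: "m \<in> M" using mh(1) Mb_subset by blast
    have gG: "g \<in> G" using g(1) by (simp add: set_stab_iff)
    have "\<phi> ` B = \<phi> ` conj_set S g A"
      using g(2) unfolding A(2) B(2) \<phi>_conj_set[OF gG order_trans[OF P_M[OF T(1) A(1)] plinth_subset]] .
    \<comment> \<open>\<open>\<phi>\<close> can be cancelled only for subsets of \<open>M\<close>,
      so the conjugate has to be placed inside \<open>M\<close>.\<close>
    moreover have gA: "conj_set S g A \<subseteq> M"
      using conj_set_mono[OF P_M[OF T(1) A(1)], of S g] conj_set_plinth[OF gG] by simp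
    ultimately have Bg: "B = conj_set S g A"
      using inj_on_image_eq_iff[OF \<phi>_inj P_M[OF T(1) B(1)] gA] by simp
    obtain K where K: "K \<in> \<K>" "A = \<sigma> T ` K" "A \<subseteq> carrier S" using A(1) by (rule P_E[OF _ T(1)])
    obtain L where L: "L \<in> \<K>" "B = \<sigma> T ` L" "B \<subseteq> carrier S" "subgroup B S" "B \<subseteq> T"
      using B(1) by (rule P_E[OF _ T(1)])
    have hA: "conj_set S h A \<subseteq> carrier S" by (rule conj_set_closed[OF H_car[OF mh(2)] K(3)])
    have im: "inv m \<in> M" by (rule subgroup.m_inv_closed[OF M m])
    have "B = conj_set S m (conj_set S h A)"
      unfolding Bg mh(3) by (rule conj_set_mult[OF M_car[OF m] H_car[OF mh(2)] K(3)])
    then have "conj_set S (inv m) B = conj_set S h A"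
      using conj_set_inv_conj_set[OF M_car[OF m] hA] by simp
    \<comment> \<open>This removes the part of \<open>g\<close> in \<open>Mb\<close> and leaves a
      conjugacy under \<open>H\<close>. The \<open>T\<close>-component of \<open>m\<close> lies in
      \<open>B\<close> because \<open>m\<close> lies in \<open>bar L\<close>.\<close>
    moreover have "conj_set S (inv m) B = B"
    proof -
      have "\<sigma> T m \<in> B"
        using Mb_subset_bar[OF L(1)] mh(1) T(1) unfolding L(2) by (auto simp: bar_iff)
      then have i: "\<sigma> T (inv m) \<in> B"
        using proj_inv[OF T(1) m] subgroup.m_inv_closed[OF L(4)] by simp
      \<comment> \<open>Only the \<open>T\<close>-component matters: the rest of
        \<open>inv m\<close> lies in the complement \<open>C T\<close>, which commutes with
        \<open>T\<close> and hence with \<open>B\<close>.\<close>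
      have "conj_set S (inv m) B = conj_set S (\<sigma> T (inv m)) B"
      proof -
        obtain c where c: "c \<in> C T" "inv m = \<sigma> T (inv m) \<otimes> c"
          using proj_split(1)[OF T(1) im] by (rule bexE)
        have cB: "conj_set S c B = B"
        proof -
          have "c \<otimes> b \<otimes> inv c = b" if b: "b \<in> B" for b
          proof -
            have "b \<otimes> c = c \<otimes> b" by (rule C_commute[OF T(1) _ c(1)]) (use b L(5) in blast)
            moreover have car: "b \<in> carrier S" "c \<in> carrier S" using b L(3) C_carrier[OF c(1)] by auto
            ultimately have "c \<otimes> b \<otimes> inv c = b \<otimes> c \<otimes> inv c" by simp
            then show ?thesis using car by (simp add: m_assoc)
          qed
          then show ?thesis by (auto simp: conj_set_image)
        qed
        have "conj_set S (\<sigma> T (inv m) \<otimes> c) B = conj_set S (\<sigma> T (inv m)) (conj_set S c B)"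
          by (rule conj_set_mult[OF factor_carrier[OF T(1) proj_closed[OF T(1) im]] C_carrier[OF c(1)] L(3)])
        then show ?thesis unfolding c(2)[symmetric] cB .
      qed
      then show ?thesis using conj_set_self[OF L(4) i] by simp
    qed
    ultimately have "B = conj_set S h A" by simp
    then have "conjugate_under S H A B" using mh(2) unfolding conjugate_under_def by (rule bexI)
    then show False using P_nonconj[OF T(1) A(1) B(1) AB] by simp
  qed
qed

section \<open>The conjugation actions and the digraph\<close>

lemma \<K>_action: "transitive_action (S\<lparr>carrier := H\<rparr>) \<K> (\<lambda>g. \<lambda>K\<in>\<K>. conj_set S g K)"
proof (rule transitive_actionI[OF H_subgroup])
  show "conj_set S h K \<in> \<K>" if "h \<in> H" "K \<in> \<K>" for h K by (rule \<K>_conj[OF that])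
  show "\<exists>h\<in>H. conj_set S h K = L" if "K \<in> \<K>" "L \<in> \<K>" for K L by (rule \<K>_transitive[OF that])
  show "conj_set S \<one> K = K" if "K \<in> \<K>" for K
    by (rule conj_set_one[OF subgroup.subset[OF \<K>_member(1)[OF that]]])
  show "conj_set S (g \<otimes> h) K = conj_set S g (conj_set S h K)" if "g \<in> H" "h \<in> H" "K \<in> \<K>" for g h K
    by (rule conj_set_mult[OF H_car[OF that(1)] H_car[OF that(2)] subgroup.subset[OF \<K>_member(1)[OF that(3)]]])
qed

lemma Ts_action: "transitive_action (S\<lparr>carrier := H\<rparr>) Ts (\<lambda>g. \<lambda>T\<in>Ts. conj_set S g T)"
proof (rule transitive_actionI[OF H_subgroup])
  show "conj_set S h T \<in> Ts" if "h \<in> H" "T \<in> Ts" for h T by (rule Ts_conj[OF H_G[OF that(1)] that(2)])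
  show "\<exists>h\<in>H. conj_set S h T = T'" if "T \<in> Ts" "T' \<in> Ts" for T T' by (rule Ts_transitive[OF that])
  show "conj_set S \<one> T = T" if "T \<in> Ts" for T by (rule conj_set_one[OF T_sub[OF that]])
  show "conj_set S (g \<otimes> h) T = conj_set S g (conj_set S h T)" if "g \<in> H" "h \<in> H" "T \<in> Ts" for g h T
    by (rule conj_set_mult[OF H_car[OF that(1)] H_car[OF that(2)] T_sub[OF that(3)]])
qed

context
  fixes T1 A1 B1
  assumes T1: "T1 \<in> Ts" and AB1: "P T1 = {A1, B1}"
begin

abbreviation "D \<equiv> decomposition_digraph \<Omega> G M Ts \<omega> E A1 B1"

text \<open>Vertices and arcs are subgroups of the same group, so disjointness has content. A factor
  in the system would project trivially to any other factor, against \<open>P_nontrivial\<close>; a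
  sole factor is \<open>M\<close>, which is not a member.\<close>

lemma \<K>_Ts_disjoint: "\<K> \<inter> Ts = {}"
proof -
  have False if K: "K \<in> \<K>" "K \<in> Ts" for K
  proof (cases "Ts = {K}")
    case True
    then have "generate S K = M" using generate_factors by simp
    then have "M \<subseteq> K" using generate_subgroup_incl[OF order_refl factor_subgroup[OF K(2)]] by simp
    then have "K = M" using factor_subset[OF K(2)] by blast
    then show False using \<K>_member(3)[OF K(1)] by simp
  next
    case False
    then obtain T where T: "T \<in> Ts" "T \<noteq> K" using K(2) by blast
    have "\<sigma> T ` K = {\<one>}"
    proof
      show "\<sigma> T ` K \<subseteq> {\<one>}" using proj_other[OF T(1) K(2)] T(2) by auto
      show "{\<one>} \<subseteq> \<sigma> T ` K"
        using subgroup.one_closed[OF proj_subgroup(1)[OF T(1) \<K>_member(1,2)[OF K(1)]]] by blast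
    qed
    moreover from this have "\<sigma> T ` K \<in> P T"
      unfolding P_iff using T_nontrivial[OF T(1)] K(1) by auto
    ultimately show False using P_nontrivial[OF T(1)] by blast
  qed
  then show ?thesis by blast
qed

lemma D_digraph: "generalised_digraph D"
  unfolding generalised_digraph_def
proof (intro conjI)
  note a = member_over(1)[OF T1 AB1_mem(1)[OF T1 AB1]] and b = member_over(1)[OF T1 AB1_mem(2)[OF T1 AB1]]
  show "loopfree_digraph D"
  proof unfold_locales
    fix e assume "e \<in> arcs D"
    then have e: "e \<in> Ts" by (simp add: decomposition_digraph_def)
    show "tail D e \<in> verts D" using a[OF e] by (simp add: decomposition_digraph_def)
    show "head D e \<in> verts D" using b[OF e] by (simp add: decomposition_digraph_def)
    \<comment> \<open>Equal ends would have equal projections to \<open>e\<close>, contrary to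
      \<open>AB_distinct\<close>.\<close>
    show "tail D e \<noteq> head D e"
      using AB_distinct[OF T1 AB1 e] by (auto simp: decomposition_digraph_def)
  qed
  show "verts D \<noteq> {}" using \<K>_nonempty by (simp add: decomposition_digraph_def)
  show "verts D \<inter> arcs D = {}" using \<K>_Ts_disjoint by (simp add: decomposition_digraph_def)
qed

lemma D_hom:
  "(\<lambda>g. (\<lambda>K\<in>\<K>. conj_set S g K, \<lambda>T\<in>Ts. conj_set S g T)) \<in> hom (S\<lparr>carrier := H\<rparr>) (digraph_aut_group D)"
proof -
  interpret V: transitive_action "S\<lparr>carrier := H\<rparr>" \<K> "\<lambda>g. \<lambda>K\<in>\<K>. conj_set S g K" by (rule \<K>_action)
  interpret A: transitive_action "S\<lparr>carrier := H\<rparr>" Ts "\<lambda>g. \<lambda>T\<in>Ts. conj_set S g T" by (rule Ts_action)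
  interpret Vh: group_hom "S\<lparr>carrier := H\<rparr>" "BijGroup \<K>" "\<lambda>g. \<lambda>K\<in>\<K>. conj_set S g K" by (rule V.group_hom)
  interpret Ah: group_hom "S\<lparr>carrier := H\<rparr>" "BijGroup Ts" "\<lambda>g. \<lambda>T\<in>Ts. conj_set S g T" by (rule A.group_hom)
  show ?thesis
  proof (rule homI)
    fix g assume "g \<in> carrier (S\<lparr>carrier := H\<rparr>)"
    then have g: "g \<in> H" by simp
    have "conj_set S g (member_over \<Omega> G M Ts \<omega> E X T) = member_over \<Omega> G M Ts \<omega> E X (conj_set S g T)"
      "member_over \<Omega> G M Ts \<omega> E X T \<in> \<K>"
      if "X \<in> P T1" "T \<in> Ts" for X T
      by (rule member_over_conj[OF T1 that g], rule member_over(1)[OF T1 that])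
    note mo = this[OF AB1_mem(1)[OF T1 AB1]] this[OF AB1_mem(2)[OF T1 AB1]]
    show "(\<lambda>K\<in>\<K>. conj_set S g K, \<lambda>T\<in>Ts. conj_set S g T) \<in> carrier (digraph_aut_group D)"
      using Vh.hom_closed[of g] Ah.hom_closed[of g] g mo
      by (simp add: digraph_aut_group_def digraph_auts_def decomposition_digraph_def DirProd_def)
  next
    fix g h assume "g \<in> carrier (S\<lparr>carrier := H\<rparr>)" "h \<in> carrier (S\<lparr>carrier := H\<rparr>)"
    then show "(\<lambda>K\<in>\<K>. conj_set S (g \<otimes>\<^bsub>S\<lparr>carrier := H\<rparr>\<^esub> h) K, \<lambda>T\<in>Ts. conj_set S (g \<otimes>\<^bsub>S\<lparr>carrier := H\<rparr>\<^esub> h) T) =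
        (\<lambda>K\<in>\<K>. conj_set S g K, \<lambda>T\<in>Ts. conj_set S g T) \<otimes>\<^bsub>digraph_aut_group D\<^esub>
        (\<lambda>K\<in>\<K>. conj_set S h K, \<lambda>T\<in>Ts. conj_set S h T)"
      using Vh.hom_mult[of g h] Ah.hom_mult[of g h]
      by (simp add: digraph_aut_group_def decomposition_digraph_def DirProd_def)
  qed
qed

end

end

text \<open>The centre of \<open>M\<close> is normalised by \<open>G\<close>, so by minimality it is
  trivial or all of \<open>M\<close>; the latter would make \<open>M\<close> commutative.\<close>

lemma (in innately_transitive) plinth_trivial_centre:
  assumes noncomm: "\<not> comm_group (S\<lparr>carrier := M\<rparr>)"
    and z: "z \<in> M" "\<And>m. m \<in> M \<Longrightarrow> z \<otimes> m = m \<otimes> z"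
  shows "z = \<one>"
proof -
  define Z where "Z = {z \<in> M. \<forall>m\<in>M. z \<otimes> m = m \<otimes> z}"
  have ZM: "Z \<subseteq> M" by (auto simp: Z_def)
  then have Zc: "Z \<subseteq> carrier S" using M_car by blast
  \<comment> \<open>Whatever \<open>Z\<close> generates is still central, so \<open>Z\<close> equals
    the subgroup it generates; this is how \<open>Z\<close> is seen to be a subgroup.\<close>
  have commute: "y \<otimes> m = m \<otimes> y" if "y \<in> generate S Z" "m \<in> M" for y m
    using commute_generate[OF M_car[OF that(2)] Zc _ that(1)] that(2) by (simp add: Z_def)
  have "generate S Z \<subseteq> M" by (rule generate_subgroup_incl[OF ZM M])
  then have "generate S Z \<subseteq> Z" using commute by (auto simp: Z_def)
  then have "generate S Z = Z" using generate.incl[of _ Z S] by blast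
  then have Z: "subgroup Z S" using generate_is_subgroup[OF Zc] by simp
  have "Z = {\<one>} \<or> Z = M"
  proof (rule plinth_minimal[OF Z ZM])
    fix g z assume g: "g \<in> G" and zZ: "z \<in> Z"
    have gc: "g \<in> carrier S" and zc: "z \<in> carrier S" using g G_car zZ Zc by auto
    have "(g \<otimes> z \<otimes> inv g) \<otimes> m = m \<otimes> (g \<otimes> z \<otimes> inv g)" if "m \<in> M" for m
    proof -
      obtain n where n: "n \<in> M" "m = g \<otimes> n \<otimes> inv g"
        using \<open>m \<in> M\<close> conj_set_plinth[OF g] unfolding conj_set_image by blast
      have "z \<otimes> n = n \<otimes> z" using zZ n(1) by (simp add: Z_def)
      then show ?thesis
        unfolding n(2) using conj_mult[OF gc zc M_car[OF n(1)]] conj_mult[OF gc M_car[OF n(1)] zc] by simp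
    qed
    then show "g \<otimes> z \<otimes> inv g \<in> Z" using plinth_conj[OF g] zZ ZM by (auto simp: Z_def)
  qed
  moreover have "Z \<noteq> M"
  proof
    assume *: "Z = M"
    have "x \<otimes> y = y \<otimes> x" if "x \<in> M" "y \<in> M" for x y
    proof -
      have "x \<in> Z" using that(1) unfolding * .
      then show ?thesis using that(2) by (simp add: Z_def)
    qed
    then have "comm_group (S\<lparr>carrier := M\<rparr>)"
      by (intro group.group_comm_groupI subgroup_imp_group[OF M]) simp
    then show False using noncomm by simp
  qed
  ultimately show ?thesis using z by (auto simp: Z_def)
qed

theorem theorem6p1:
  fixes \<Omega> :: "'a set" and G M :: "('a \<Rightarrow> 'a) set" and Ts :: "('a \<Rightarrow> 'a) set set"
    and T0 :: "'b monoid" and \<omega> :: 'a and \<E> :: "'a set set set"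
    and T1 A1 B1 :: "('a \<Rightarrow> 'a) set"
  assumes "finite \<Omega>" and "\<omega> \<in> \<Omega>"
    and "subgroup G (BijGroup \<Omega>)" and "plinth \<Omega> G M"
    and "\<not> comm_group (perm_grp \<Omega> M)"
    and "simple_group T0" and "finite (carrier T0)" and "\<not> comm_group T0"
    and "internal_direct_product (BijGroup \<Omega>) M Ts"
    and "\<forall>T\<in>Ts. perm_grp \<Omega> T \<cong> T0"
    and "\<E> \<in> CD_2nc \<Omega> G M Ts"
    and "T1 \<in> Ts" and "proper_projections \<Omega> M Ts \<omega> \<E> T1 = {A1, B1}"
    \<comment> \<open>notation\<close>
    and S: "S = BijGroup \<Omega>"
    and \<sigma>: "\<sigma> = factor_proj S Ts"
    and G\<omega>: "G\<omega> = point_stab \<Omega> G \<omega>"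
    and \<K>: "\<K> = system_of_decomposition \<Omega> M \<omega> \<E>"
    and A: "A = (\<lambda>T. \<sigma> T ` member_over \<Omega> G M Ts \<omega> \<E> A1 T)"
    and B: "B = (\<lambda>T. \<sigma> T ` member_over \<Omega> G M Ts \<omega> \<E> B1 T)"
    and \<K>b: "\<K>b = bar_subgroup S M Ts ` \<K>"
    and Mb\<omega>: "Mb\<omega> = \<Inter>\<K>b"
    and \<Omega>b: "\<Omega>b = translates M (point_orbit \<Omega> Mb\<omega> \<omega>)"
    and \<omega>b: "\<omega>b = block_of \<Omega>b \<omega>"
    and \<phi>: "\<phi> = induced_perm \<Omega>b"
    and Gb: "Gb = \<phi> ` G"
    and Gb\<omega>: "Gb\<omega> = \<phi> ` set_stab \<Omega> G \<omega>b"
    and Mb: "Mb = \<phi> ` M"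
    and Tsb: "Tsb = (\<lambda>T. \<phi> ` T) ` Ts"
    and \<K>\<phi>: "\<K>\<phi> = (\<lambda>K. \<phi> ` K) ` \<K>b"
    and D: "D = decomposition_digraph \<Omega> G M Ts \<omega> \<E> A1 B1"
  shows
    \<comment> \<open>[a]\<close>
    "(faithful_action (perm_grp \<Omega> M) \<Omega>b \<phi> \<and>
      cartesian_system \<Omega>b Mb \<omega>b \<K>\<phi> \<and>
      (\<forall>g\<in>Gb\<omega>. \<forall>K\<in>\<K>\<phi>. conj_set (BijGroup \<Omega>b) g K \<in> \<K>\<phi>) \<and>
      subgroup Gb (BijGroup \<Omega>b) \<and> plinth \<Omega>b Gb Mb \<and>
      decomposition_of_system \<Omega>b Mb \<omega>b \<K>\<phi> \<in> CD_2nc \<Omega>b Gb Mb Tsb)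
     \<and>
     \<comment> \<open>[b]\<close>
     (\<forall>T\<in>Ts.
        (subgroup (A T) (perm_grp \<Omega> T) \<and> A T \<noteq> T \<and>
         subgroup (B T) (perm_grp \<Omega> T) \<and> B T \<noteq> T) \<and>
        \<not> conjugate_under S G\<omega> (A T) (B T) \<and>
        (A T <#>\<^bsub>S\<^esub> B T = T \<and> A T \<inter> B T = \<sigma> T ` Mb\<omega>) \<and>
        (normalizer_in S G\<omega> T = normalizer_in S G\<omega> (A T) \<and>
         normalizer_in S G\<omega> (A T) = normalizer_in S G\<omega> (B T)))
     \<and>
     \<comment> \<open>[c]\<close>
     (generalised_digraph D \<and>
      (\<lambda>g. (\<lambda>K\<in>\<K>. conj_set S g K, \<lambda>T\<in>Ts. conj_set S g T))
         \<in> hom (perm_grp \<Omega> G\<omega>) (digraph_aut_group D) \<and>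
      transitive_action (perm_grp \<Omega> G\<omega>) \<K> (\<lambda>g. \<lambda>K\<in>\<K>. conj_set S g K) \<and>
      transitive_action (perm_grp \<Omega> G\<omega>) Ts (\<lambda>g. \<lambda>T\<in>Ts. conj_set S g T))"
proof -
  let ?S = "BijGroup \<Omega>"
  interpret IT: innately_transitive \<Omega> ?S G M
    using assms(1,3,4) by (intro innately_transitive.intro innately_transitive_axioms.intro perm_space.intro refl)
  have T_sub: "T \<subseteq> carrier ?S" "subgroup T ?S" if "T \<in> Ts" for T
    using assms(9) that IT.M_car IT.normal_restrict_iff[OF IT.M, of T]
    unfolding internal_direct_product_def by auto
  have fd: "factor_decomposition ?S M Ts"
  proof (intro factor_decomposition.intro factor_decomposition_axioms.intro IT.is_group IT.M assms(9))
    show "z = \<one>\<^bsub>?S\<^esub>" if "z \<in> M" "\<And>m. m \<in> M \<Longrightarrow> z \<otimes>\<^bsub>?S\<^esub> m = m \<otimes>\<^bsub>?S\<^esub> z" for z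
      by (rule IT.plinth_trivial_centre[OF assms(5) that])
  qed
  have simple: "simple_group (?S\<lparr>carrier := T\<rparr>)" if T: "T \<in> Ts" for T
  proof -
    interpret T0: simple_group T0 by fact
    have grp: "group (?S\<lparr>carrier := T\<rparr>)" by (rule IT.subgroup_imp_group[OF T_sub(2)[OF T]])
    have "?S\<lparr>carrier := T\<rparr> \<cong> T0" using assms(10) T by blast
    \<comment> \<open>Simplicity is transported along an isomorphism that starts at the simple
      group, so the given one is reversed.\<close>
    then have "T0 \<cong> ?S\<lparr>carrier := T\<rparr>" by (rule group.iso_sym[OF grp])
    then obtain h where "h \<in> iso T0 (?S\<lparr>carrier := T\<rparr>)" unfolding is_iso_def by blast
    then show ?thesis by (rule T0.iso_simple[OF grp])
  qed
  interpret I: two_class_decomposition \<Omega> ?S G M Ts \<E> \<omega>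
    by (intro two_class_decomposition.intro two_class_decomposition_axioms.intro IT.innately_transitive_axioms
        fd simple assms(11,2))
  note T1 = assms(12,13)
  have Kb: "\<K>b = I.bar ` I.\<K>" unfolding \<K>b S \<K> ..
  have Mb_eq: "Mb\<omega> = I.Mb" unfolding Mb\<omega> Kb I.Mb_def ..
  have \<Omega>b_eq: "\<Omega>b = I.\<Omega>b" unfolding \<Omega>b Mb_eq I.\<Omega>b_def ..
  have \<omega>b_eq: "\<omega>b = I.\<omega>b" unfolding \<omega>b \<Omega>b_eq I.\<omega>b_def ..
  have \<phi>_eq: "\<phi> = I.\<phi>" unfolding \<phi> \<Omega>b_eq I.\<phi>_def ..
  note eqs = \<omega>b_eq \<phi>_eq \<Omega>b_eq Mb_eq Kb
  have part_a: "faithful_action (perm_grp \<Omega> M) \<Omega>b \<phi> \<and> cartesian_system \<Omega>b Mb \<omega>b \<K>\<phi> \<and>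
      (\<forall>g\<in>Gb\<omega>. \<forall>K\<in>\<K>\<phi>. conj_set (BijGroup \<Omega>b) g K \<in> \<K>\<phi>) \<and>
      subgroup Gb (BijGroup \<Omega>b) \<and> plinth \<Omega>b Gb Mb \<and>
      decomposition_of_system \<Omega>b Mb \<omega>b \<K>\<phi> \<in> CD_2nc \<Omega>b Gb Mb Tsb"
    unfolding Mb Gb Gb\<omega> \<K>\<phi> Tsb eqs
    by (intro conjI ballI I.faithful I.\<K>b_system I.\<K>b_conj I.Gb_subgroup I.plinth_b I.Eb_CD_2nc)
  have part_b: "(subgroup (A T) (perm_grp \<Omega> T) \<and> A T \<noteq> T \<and> subgroup (B T) (perm_grp \<Omega> T) \<and> B T \<noteq> T) \<and>
      \<not> conjugate_under S G\<omega> (A T) (B T) \<and>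
      (A T <#>\<^bsub>S\<^esub> B T = T \<and> A T \<inter> B T = \<sigma> T ` Mb\<omega>) \<and>
      (normalizer_in S G\<omega> T = normalizer_in S G\<omega> (A T) \<and>
       normalizer_in S G\<omega> (A T) = normalizer_in S G\<omega> (B T))" if T: "T \<in> Ts" for T
  proof -
    note restrict = IT.subgroup_restrict_iff[OF I.factor_subgroup[OF T]]
    have "normalizer_in ?S I.H T = normalizer_in ?S I.H (I.\<sigma> T ` member_over \<Omega> G M Ts \<omega> \<E> A1 T)"
      "normalizer_in ?S I.H T = normalizer_in ?S I.H (I.\<sigma> T ` member_over \<Omega> G M Ts \<omega> \<E> B1 T)"
      by (rule I.normalizer_in_projection[OF T1 T I.AB_P(1)[OF T1 T]],
          rule I.normalizer_in_projection[OF T1 T I.AB_P(2)[OF T1 T]])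
    then show ?thesis
      unfolding A B \<sigma> G\<omega> S Mb_eq restrict
      using I.AB_subgroup[OF T1 T] I.AB_nonconj[OF T1 T] I.AB_factorisation[OF T1 T] I.proj_Mb[OF T1 T]
      by (intro conjI) simp_all
  qed
  have part_c: "generalised_digraph D \<and>
      (\<lambda>g. (\<lambda>K\<in>\<K>. conj_set S g K, \<lambda>T\<in>Ts. conj_set S g T)) \<in> hom (perm_grp \<Omega> G\<omega>) (digraph_aut_group D) \<and>
      transitive_action (perm_grp \<Omega> G\<omega>) \<K> (\<lambda>g. \<lambda>K\<in>\<K>. conj_set S g K) \<and>
      transitive_action (perm_grp \<Omega> G\<omega>) Ts (\<lambda>g. \<lambda>T\<in>Ts. conj_set S g T)"
    unfolding D \<K> S G\<omega>
    by (intro conjI I.D_digraph[OF T1] I.D_hom[OF T1] I.\<K>_action I.Ts_action)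
  show ?thesis using part_a part_b part_c by blast
qed

end
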